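(* Let $U\in C^1\big([0,\infty);(H_0^1(\Omega))^N\big)$ be the solution of $$\frac{\mathrm{d}U}{\mathrm{d}t}=\mathcal{G}U-U\langle\mathcal{G}U,U\rangle,\qquad U(0)=U_0,$$ with $U_0\in\mathcal{S}$. Then: 1. there exists an orthogonal matrix $Q_*\in\mathcal{O}^N$, independent of $t$, such that $\lim_{t\to\infty}\|U(t)-V_*Q_*\|_a=0$; 2. $\lim_{t\to\infty}E(U(t))=E(V_* )$; 3. $\lim_{t\to\infty}\|\nabla_GE_{\mathcal{G}}(U(t))\|_a=0$.
   Context: $\Omega\subset\mathbb{R}^d$ is a bounded domain, and $(\cdot,\cdot)$ denotes the $L^2(\Omega)$ inner product. $\mathcal{V}:\Omega\to\mathbb{R}$ is a potential such that $a(u,v)=\int_\Omega(\nabla u\cdot\nabla v+\mathcal{V}uv)\,dx$ on $H_0^1(\Omega)$ is symmetric, bounded and coercive, with $c_1\|\nabla u\|^2\leqslant a(u,u)\leqslant c_2\|\nabla u\|^2$ for constants $c_1,c_2>0$. Let $\lambda_1\leqslant\lambda_2\leqslant\cdots$ be the eigenvalues (with multiplicity) of $a(u,v)=\lambda(u,v)$ for all $v\in H_0^1(\Omega)$. Assume $\lambda_N<\lambda_{N+1}$. Let $V_*=(v_1,\dots,v_N)$ consist of $L^2$-orthonormal eigenfunctions for $\lambda_1,\dots,\lambda_N$. $\mathcal{G}=(-\Delta+\mathcal{V})^{-1}$: $\mathcal{G}f\in H_0^1(\Omega)$ is the unique element with $a(\mathcal{G}f,v)=(f,v)$ for all $v\in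 H_0^1(\Omega)$. For $N$-tuples: - $\mathcal{G}U=(\mathcal{G}u_1,\dots,\mathcal{G}u_N)$; - $UA$ has $j$-th entry $\sum_iu_iA_{ij}$; - $\langle U,V\rangle=((u_i,v_j))_{i,j}$ and $\langle U,V\rangle_a=(a(u_i,v_j))_{i,j}$; - $\|U\|_a^2=\operatorname{tr}\langle U,U\rangle_a$. Define $E(U)=\frac12\operatorname{tr}\langle U,U\rangle_a$ and $\nabla_GE_{\mathcal{G}}(U)=\mathcal{G}U-U\langle\mathcal{G}U,U\rangle$. $\mathcal{O}^N$ is the set of $N\times N$ orthogonal matrices. The quasi-Stiefel set is $\mathcal{M}^N_{\geqslant}=\{U:\langle U,U\rangle-I_N\text{ positive semidefinite}\}$. Set $$E_{\mathrm{ES}}=\tfrac12\Big(\sum_{i=1}^{N-1}\lambda_i+\lambda_{N+1}\Big),\qquad E_1=\tfrac12\big(E(V_* )+E_{\mathrm{ES}}\big),$$ $$\mathcal{S}=\{U\in(H_0^1(\Omega))^N: UQ\in\mathcal{M}^N_{\geqslant}\text{ for some }Q\in\mathcal{O}^N,\ E(U)\leqslant E_1\}.$$ *)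

theory Defs
  imports "HOL-Analysis.Analysis"
begin

fun Ck_on :: "nat \<Rightarrow> 'a::euclidean_space set \<Rightarrow> ('a \<Rightarrow> real) \<Rightarrow> bool" where
  "Ck_on 0 S f = continuous_on S f"
| "Ck_on (Suc k) S f =
     ((\<forall>x\<in>S. f differentiable (at x)) \<and>
      (\<forall>b\<in>Basis. Ck_on k S (\<lambda>x. frechet_derivative f (at x) b)))"

definition smooth_fun :: "('a::euclidean_space \<Rightarrow> real) \<Rightarrow> bool" where
  "smooth_fun f \<longleftrightarrow> (\<forall>k. Ck_on k UNIV f)"

definition test_fun :: "'a::euclidean_space set \<Rightarrow> ('a \<Rightarrow> real) \<Rightarrow> bool" where
  "test_fun \<Omega> \<phi> \<longleftrightarrow> smooth_fun \<phi> \<and> compact (closure {x. \<phi> x \<noteq> 0})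
       \<and> closure {x. \<phi> x \<noteq> 0} \<subseteq> \<Omega>"

definition cgrad :: "('a::euclidean_space \<Rightarrow> real) \<Rightarrow> 'a \<Rightarrow> 'a" where
  "cgrad f x = (\<Sum>b\<in>Basis. frechet_derivative f (at x) b *\<^sub>R b)"

definition L2inner :: "'a::euclidean_space set \<Rightarrow> ('a \<Rightarrow> real) \<Rightarrow> ('a \<Rightarrow> real) \<Rightarrow> real" where
  "L2inner \<Omega> u v = (LINT x:\<Omega>|lebesgue. u x * v x)"

definition sq_int :: "'a::euclidean_space set \<Rightarrow> ('a \<Rightarrow> 'b::euclidean_space) \<Rightarrow> bool" where
  "sq_int \<Omega> g \<longleftrightarrow> set_borel_measurable lebesgue \<Omega> g
      \<and> set_integrable lebesgue \<Omega> (\<lambda>x. (norm (g x))\<^sup>2)"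

definition H01_grad :: "'a::euclidean_space set \<Rightarrow> ('a \<Rightarrow> real) \<Rightarrow> ('a \<Rightarrow> 'a) \<Rightarrow> bool" where
  "H01_grad \<Omega> u g \<longleftrightarrow> sq_int \<Omega> u \<and> sq_int \<Omega> g \<and>
     (\<exists>\<phi>::nat \<Rightarrow> 'a \<Rightarrow> real. (\<forall>k. test_fun \<Omega> (\<phi> k)) \<and>
        ((\<lambda>k. LINT x:\<Omega>|lebesgue. (\<phi> k x - u x)\<^sup>2) \<longlonglongrightarrow> 0) \<and>
        ((\<lambda>k. LINT x:\<Omega>|lebesgue. (norm (cgrad (\<phi> k) x - g x))\<^sup>2) \<longlonglongrightarrow> 0))"

definition H01 :: "'a::euclidean_space set \<Rightarrow> ('a \<Rightarrow> real) set" where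
  "H01 \<Omega> = {u. \<exists>g. H01_grad \<Omega> u g}"

text \<open>weak gradient (determined almost everywhere)\<close>
definition wgrad :: "'a::euclidean_space set \<Rightarrow> ('a \<Rightarrow> real) \<Rightarrow> 'a \<Rightarrow> 'a" where
  "wgrad \<Omega> u = (SOME g. H01_grad \<Omega> u g)"

definition grad_sq :: "'a::euclidean_space set \<Rightarrow> ('a \<Rightarrow> real) \<Rightarrow> real" where
  "grad_sq \<Omega> u = (LINT x:\<Omega>|lebesgue. (norm (wgrad \<Omega> u x))\<^sup>2)"

definition H1norm :: "'a::euclidean_space set \<Rightarrow> ('a \<Rightarrow> real) \<Rightarrow> real" where
  "H1norm \<Omega> u = sqrt (L2inner \<Omega> u u + grad_sq \<Omega> u)"

definition aform :: "'a::euclidean_space set \<Rightarrow> ('a \<Rightarrow> real) \<Rightarrow> ('a \<Rightarrow> real) \<Rightarrow> ('a \<Rightarrow> real) \<Rightarrow> real" where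
  "aform \<Omega> V u v = (LINT x:\<Omega>|lebesgue. wgrad \<Omega> u x \<bullet> wgrad \<Omega> v x + V x * u x * v x)"

definition Gop :: "'a::euclidean_space set \<Rightarrow> ('a \<Rightarrow> real) \<Rightarrow> ('a \<Rightarrow> real) \<Rightarrow> ('a \<Rightarrow> real)" where
  "Gop \<Omega> V f = (SOME g. g \<in> H01 \<Omega> \<and> (\<forall>v\<in>H01 \<Omega>. aform \<Omega> V g v = L2inner \<Omega> f v))"

section \<open>N-tuples and N\<times>N matrices (indices 0..N-1)\<close>

type_synonym 'a tuple = "nat \<Rightarrow> 'a \<Rightarrow> real"
type_synonym mat = "nat \<Rightarrow> nat \<Rightarrow> real"

definition tmul :: "nat \<Rightarrow> 'a tuple \<Rightarrow> mat \<Rightarrow> 'a tuple" where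
  "tmul N U A = (\<lambda>j x. \<Sum>i<N. A i j * U i x)"

definition tsub :: "'a tuple \<Rightarrow> 'a tuple \<Rightarrow> 'a tuple" where
  "tsub U W = (\<lambda>j x. U j x - W j x)"

definition gram :: "'a::euclidean_space set \<Rightarrow> 'a tuple \<Rightarrow> 'a tuple \<Rightarrow> mat" where
  "gram \<Omega> U W = (\<lambda>i j. L2inner \<Omega> (U i) (W j))"

definition orthogonal_mat :: "nat \<Rightarrow> mat \<Rightarrow> bool" where
  "orthogonal_mat N Q \<longleftrightarrow> (\<forall>i<N. \<forall>j<N. (\<Sum>k<N. Q k i * Q k j) = (if i = j then 1 else 0))"

definition psd_mat :: "nat \<Rightarrow> mat \<Rightarrow> bool" where
  "psd_mat N A \<longleftrightarrow> (\<forall>i<N. \<forall>j<N. A i j = A j i) \<and>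
      (\<forall>y::nat \<Rightarrow> real. (\<Sum>i<N. \<Sum>j<N. y i * A i j * y j) \<ge> 0)"

definition quasi_stiefel :: "'a::euclidean_space set \<Rightarrow> nat \<Rightarrow> 'a tuple set" where
  "quasi_stiefel \<Omega> N = {U. psd_mat N (\<lambda>i j. gram \<Omega> U U i j - (if i = j then 1 else 0))}"

definition in_H01N :: "'a::euclidean_space set \<Rightarrow> nat \<Rightarrow> 'a tuple \<Rightarrow> bool" where
  "in_H01N \<Omega> N U \<longleftrightarrow> (\<forall>j<N. U j \<in> H01 \<Omega>)"

definition anorm :: "'a::euclidean_space set \<Rightarrow> ('a \<Rightarrow> real) \<Rightarrow> nat \<Rightarrow> 'a tuple \<Rightarrow> real" where
  "anorm \<Omega> V N U = sqrt (\<Sum>j<N. aform \<Omega> V (U j) (U j))"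

definition energy :: "'a::euclidean_space set \<Rightarrow> ('a \<Rightarrow> real) \<Rightarrow> nat \<Rightarrow> 'a tuple \<Rightarrow> real" where
  "energy \<Omega> V N U = (\<Sum>j<N. aform \<Omega> V (U j) (U j)) / 2"

definition Gtuple :: "'a::euclidean_space set \<Rightarrow> ('a \<Rightarrow> real) \<Rightarrow> 'a tuple \<Rightarrow> 'a tuple" where
  "Gtuple \<Omega> V U = (\<lambda>j. Gop \<Omega> V (U j))"

definition gradGE :: "'a::euclidean_space set \<Rightarrow> ('a \<Rightarrow> real) \<Rightarrow> nat \<Rightarrow> 'a tuple \<Rightarrow> 'a tuple" where
  "gradGE \<Omega> V N U = tsub (Gtuple \<Omega> V U) (tmul N U (gram \<Omega> (Gtuple \<Omega> V U) U))"

definition standing_assms :: "'a::euclidean_space set \<Rightarrow> ('a \<Rightarrow> real) \<Rightarrow> bool" where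
  "standing_assms \<Omega> V \<longleftrightarrow> open \<Omega> \<and> connected \<Omega> \<and> bounded \<Omega> \<and> \<Omega> \<noteq> {} \<and>
     V \<in> borel_measurable lebesgue \<and>
     (\<forall>u\<in>H01 \<Omega>. \<forall>v\<in>H01 \<Omega>. set_integrable lebesgue \<Omega> (\<lambda>x. V x * u x * v x)) \<and>
     (\<exists>C. \<forall>u\<in>H01 \<Omega>. \<forall>v\<in>H01 \<Omega>. \<bar>aform \<Omega> V u v\<bar> \<le> C * H1norm \<Omega> u * H1norm \<Omega> v) \<and>
     (\<exists>c1 c2. c1 > 0 \<and> c2 > 0 \<and>
        (\<forall>u\<in>H01 \<Omega>. c1 * grad_sq \<Omega> u \<le> aform \<Omega> V u u \<and> aform \<Omega> V u u \<le> c2 * grad_sq \<Omega> u))"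

text \<open>\<lambda> 0 \<le> \<lambda> 1 \<le> ... (0-based: \<lambda> k is the paper's \<lambda>_{k+1}) are all eigenvalues of
  a(u,v) = \<lambda>(u,v), repeated according to multiplicity: there is an L^2-orthonormal
  family of eigenfunctions e k \<in> H_0^1 for \<lambda> k which is complete in H_0^1.\<close>
definition is_eigen :: "'a::euclidean_space set \<Rightarrow> ('a \<Rightarrow> real) \<Rightarrow> real \<Rightarrow> ('a \<Rightarrow> real) \<Rightarrow> bool" where
  "is_eigen \<Omega> V \<mu> e \<longleftrightarrow> e \<in> H01 \<Omega> \<and> (\<forall>v\<in>H01 \<Omega>. aform \<Omega> V e v = \<mu> * L2inner \<Omega> e v)"

definition eigenvalue_seq :: "'a::euclidean_space set \<Rightarrow> ('a \<Rightarrow> real) \<Rightarrow> (nat \<Rightarrow> real) \<Rightarrow> bool" where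
  "eigenvalue_seq \<Omega> V lam \<longleftrightarrow> mono lam \<and>
     (\<exists>e::nat \<Rightarrow> 'a \<Rightarrow> real. (\<forall>k. is_eigen \<Omega> V (lam k) (e k)) \<and>
        (\<forall>j k. L2inner \<Omega> (e j) (e k) = (if j = k then 1 else 0)) \<and>
        (\<forall>u\<in>H01 \<Omega>. (\<forall>k. L2inner \<Omega> u (e k) = 0) \<longrightarrow> L2inner \<Omega> u u = 0))"

text \<open>U \<in> C^1([0,\<infinity>); (H_0^1)^N) solves dU/dt = \<G>U - U\<langle>\<G>U,U\<rangle> (derivative and
  continuity measured in the H^1 norm; one-sided at t = 0).\<close>
definition flow_solution :: "'a::euclidean_space set \<Rightarrow> ('a \<Rightarrow> real) \<Rightarrow> nat \<Rightarrow> (real \<Rightarrow> 'a tuple) \<Rightarrow> bool" where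
  "flow_solution \<Omega> V N U \<longleftrightarrow>
     (\<forall>t\<ge>0. in_H01N \<Omega> N (U t)) \<and>
     (\<forall>t\<ge>0. \<forall>j<N.
        ((\<lambda>s. H1norm \<Omega> (\<lambda>x. (U s j x - U t j x) / (s - t) - gradGE \<Omega> V N (U t) j x))
           \<longlongrightarrow> 0) (at t within {0..})) \<and>
     (\<forall>t\<ge>0. \<forall>j<N.
        ((\<lambda>s. H1norm \<Omega> (\<lambda>x. gradGE \<Omega> V N (U s) j x - gradGE \<Omega> V N (U t) j x))
           \<longlongrightarrow> 0) (at t within {0..}))"

end

theory Submission
  imports Defs
begin

text \<open>
  In the coefficients \<open>x\<^sub>k = ((u\<^sub>j, e\<^sub>k))\<^sub>j\<close> with respect to an eigenbasis the flow reads
  \<open>x\<^sub>k' = (1/\<lambda>\<^sub>k - B) x\<^sub>k\<close> with \<open>B = \<langle>\<G>U, U\<rangle>\<close> positive semidefinite, and \<open>D = \<langle>U, U\<rangle> - I\<close> satisfies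
  \<open>D' = - B D - D B\<close>; hence the Frobenius norm of \<open>D\<close> does not grow and \<open>U\<close> stays bounded.
  Let \<open>X\<close> be the square matrix of the first \<open>N\<close> coefficient vectors. The quasi-Stiefel condition and the
  energy bound force \<open>X(0)\<close> to be invertible, by a Courant--Fischer argument. Then
  \<open>\<Phi>(t) = X(t) exp(- t \<Lambda>\<^sup>-\<^sup>1) X(0)\<^sup>-\<^sup>1\<close> is the fundamental solution of \<open>\<Phi>' = - B \<Phi>\<close>, and it decays exponentially
  because \<open>X\<close> is bounded. Uniqueness gives \<open>D = \<Phi> D(0) \<Phi>\<^sup>T\<close> and \<open>x\<^sub>k(t) = exp(t/\<lambda>\<^sub>k) \<Phi>(t) x\<^sub>k(0)\<close>, so \<open>D\<close> and,
  thanks to the spectral gap, all coefficients with \<open>k > N\<close> decay exponentially. Therefore \<open>X X\<^sup>T \<rightarrow> I\<close>, hence also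
  \<open>X\<^sup>T X \<rightarrow> I\<close>, at an exponential rate, which makes \<open>X'\<close> integrable, and \<open>X\<close> converges to an orthogonal matrix.
\<close>

subsection \<open>Finite-dimensional linear algebra\<close>

text \<open>A singular initial block would force E(U_0) up to E_ES, which the spectral gap puts
  strictly above E_1. Convergence to one matrix Q_*, and not merely to the orbit of V_*, needs an
  integrable velocity; hence exponential rates throughout. The obstacle is that P - I controls X
  X^T, whereas the velocity of X is governed by X^T X - I; an identity for Frobenius norms links the
  two. No existence theory for differential equations enters: B is treated as a given coefficient,
  comparison solutions are built from the flow itself, and a monotone norm gives uniqueness. The
  high modes must vanish in the energy norm, so their estimate is uniform in k and is summed against
  lam k, using the finite energy of U_0. Elements of H_0^1 are functions, not classes, and both weak
  gradients and G are chosen by SOME. Hilbert space facts are therefore proved for semi-inner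
  products, and closability of the gradient makes the energy form independent of the choice.\<close>

abbreviation (input) delta :: "nat \<Rightarrow> nat \<Rightarrow> real" where
  "delta i j \<equiv> (if i = j then 1 else 0)"

text \<open>Gaussian elimination on the last equation: a nonzero coefficient at p lets the unknown p
  be eliminated, and a vanishing row imposes nothing. The unknowns form an arbitrary finite set
  because the eliminated one can be any of them.\<close>

lemma homogeneous_system_nontrivial:
  fixes A :: "nat \<Rightarrow> 'b \<Rightarrow> real"
  assumes "finite S" "m < card S"
  shows "\<exists>x. (\<exists>j\<in>S. x j \<noteq> 0) \<and> (\<forall>i<m. (\<Sum>j\<in>S. A i j * x j) = 0)"
  using assms
proof (induction m arbitrary: S A)
  case 0
  then obtain j where "j \<in> S" by fastforce
  then show ?case by (intro exI[of _ "\<lambda>_. 1"]) auto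
next
  case (Suc m)
  show ?case
  proof (cases "\<forall>j\<in>S. A m j = 0")
    case True
    obtain x where "\<exists>j\<in>S. x j \<noteq> 0" "\<forall>i<m. (\<Sum>j\<in>S. A i j * x j) = 0"
      using Suc.IH[OF Suc.prems(1), of A] Suc.prems(2) by auto
    with True show ?thesis by (intro exI[of _ x]) (auto simp: less_Suc_eq)
  next
    case False
    then obtain p where p: "p \<in> S" "A m p \<noteq> 0" by auto
    define S' where "S' = S - {p}"
    have S': "finite S'" "p \<notin> S'" "S = insert p S'" "m < card S'"
      using Suc.prems p by (auto simp: S'_def)
    obtain x where x: "\<exists>j\<in>S'. x j \<noteq> 0"
      "\<forall>i<m. (\<Sum>j\<in>S'. (A i j - A i p * A m j / A m p) * x j) = 0"
      using Suc.IH[OF S'(1,4), of "\<lambda>i j. A i j - A i p * A m j / A m p"] by auto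
    define r where "r = - (\<Sum>j\<in>S'. A m j * x j) / A m p"
    have sum: "(\<Sum>j\<in>S. A i j * (x(p := r)) j) = A i p * r + (\<Sum>j\<in>S'. A i j * x j)" for i
    proof -
      have "(\<Sum>j\<in>S'. A i j * (x(p := r)) j) = (\<Sum>j\<in>S'. A i j * x j)"
        using S'(2) by (intro sum.cong) auto
      then show ?thesis using S' by simp
    qed
    have "(\<Sum>j\<in>S. A i j * (x(p := r)) j) = 0" if "i < Suc m" for i
    proof (cases "i = m")
      case True
      then show ?thesis using p by (simp only: sum) (simp add: r_def)
    next
      case False
      with that have "i < m" by simp
      with x(2) have "0 = (\<Sum>j\<in>S'. (A i j - A i p * A m j / A m p) * x j)" by simp
      also have "\<dots> = (\<Sum>j\<in>S'. A i j * x j) - A i p / A m p * (\<Sum>j\<in>S'. A m j * x j)"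
        by (simp add: left_diff_distrib sum_subtractf sum_distrib_left mult.assoc)
      finally show ?thesis by (simp only: sum) (simp add: r_def field_simps)
    qed
    moreover have "\<exists>j\<in>S. (x(p := r)) j \<noteq> 0" using x(1) S' by auto
    ultimately show ?thesis by blast
  qed
qed

lemma sum_delta_mult:
  fixes f :: "nat \<Rightarrow> real"
  assumes "i < N"
  shows "(\<Sum>l<N. delta i l * f l) = f i" "(\<Sum>l<N. delta l i * f l) = f i"
    "(\<Sum>l<N. f l * delta i l) = f i" "(\<Sum>l<N. f l * delta l i) = f i"
  using assms by (simp_all add: if_distrib if_distribR cong: if_cong)

lemma sum_rotate3:
  "(\<Sum>a\<in>A. \<Sum>b\<in>B. \<Sum>c\<in>C. f a b c) = (\<Sum>b\<in>B. \<Sum>c\<in>C. \<Sum>a\<in>A. f a b c)"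
proof -
  have "(\<Sum>a\<in>A. \<Sum>b\<in>B. \<Sum>c\<in>C. f a b c) = (\<Sum>b\<in>B. \<Sum>a\<in>A. \<Sum>c\<in>C. f a b c)"
    by (rule sum.swap)
  also have "\<dots> = (\<Sum>b\<in>B. \<Sum>c\<in>C. \<Sum>a\<in>A. f a b c)"
    by (rule sum.cong[OF refl], rule sum.swap)
  finally show ?thesis .
qed

text \<open>Both sides equal tr(G^2) - 2 tr(G) + N, with G = X X^T and G = X^T X respectively, and
  these products have the same traces and the same traces of squares. Approximate orthonormality of
  rows thus carries over to columns with the same error.\<close>

lemma frobenius_gram_transpose:
  fixes X :: mat
  shows "(\<Sum>i<N. \<Sum>j<N. ((\<Sum>k<N. X i k * X j k) - delta i j)\<^sup>2)
       = (\<Sum>i<N. \<Sum>j<N. ((\<Sum>k<N. X k i * X k j) - delta i j)\<^sup>2)"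
proof -
  have expand: "(\<Sum>i<N. \<Sum>j<N. (Y i j - delta i j)\<^sup>2)
      = (\<Sum>i<N. \<Sum>j<N. (Y i j)\<^sup>2) - 2 * (\<Sum>i<N. Y i i) + real N" for Y :: mat
  proof -
    have "(\<Sum>j<N. (Y i j - delta i j)\<^sup>2) = (\<Sum>j<N. (Y i j)\<^sup>2) - 2 * Y i i + 1" if "i < N" for i
    proof -
      have "(\<Sum>j<N. (Y i j - delta i j)\<^sup>2)
          = (\<Sum>j<N. (Y i j)\<^sup>2 - 2 * (Y i j * delta i j) + delta i j * delta i j)"
        by (intro sum.cong) (auto simp: power2_eq_square algebra_simps)
      also have "\<dots> = (\<Sum>j<N. (Y i j)\<^sup>2) - 2 * (\<Sum>j<N. Y i j * delta i j) + (\<Sum>j<N. delta i j * delta i j)"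
        by (simp only: sum.distrib sum_subtractf sum_distrib_left)
      finally show ?thesis using sum_delta_mult[OF that] by simp
    qed
    then show ?thesis
      by (simp add: sum.distrib sum_subtractf sum_distrib_left)
  qed
  have four: "(\<Sum>i<N. \<Sum>j<N. (\<Sum>k<N. Y i k * Y j k)\<^sup>2)
      = (\<Sum>i<N. \<Sum>j<N. \<Sum>k<N. \<Sum>l<N. Y i k * Y j k * (Y i l * Y j l))" for Y :: mat
    by (simp add: power2_eq_square sum_product)
  have "(\<Sum>i<N. \<Sum>j<N. \<Sum>k<N. \<Sum>l<N. X i k * X j k * (X i l * X j l))
      = (\<Sum>i<N. \<Sum>k<N. \<Sum>l<N. \<Sum>j<N. X i k * X j k * (X i l * X j l))"
    by (rule sum.cong[OF refl], rule sum_rotate3)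
  also have "\<dots> = (\<Sum>k<N. \<Sum>l<N. \<Sum>i<N. \<Sum>j<N. X i k * X j k * (X i l * X j l))"
    by (rule sum_rotate3)
  also have "\<dots> = (\<Sum>k<N. \<Sum>l<N. \<Sum>i<N. \<Sum>j<N. X i k * X i l * (X j k * X j l))"
    by (simp add: ac_simps)
  finally have sq: "(\<Sum>i<N. \<Sum>j<N. (\<Sum>k<N. X i k * X j k)\<^sup>2) = (\<Sum>i<N. \<Sum>j<N. (\<Sum>k<N. X k i * X k j)\<^sup>2)"
    using four[of X] four[of "\<lambda>i j. X j i"] by simp
  have tr: "(\<Sum>i<N. \<Sum>k<N. X i k * X i k) = (\<Sum>i<N. \<Sum>k<N. X k i * X k i)"
    by (rule sum.swap)
  show ?thesis
    using expand[of "\<lambda>i j. \<Sum>k<N. X i k * X j k"] expand[of "\<lambda>i j. \<Sum>k<N. X k i * X k j"] sq tr by simp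
qed

text \<open>The row defect vanishes, and the column defect has the same Frobenius norm.\<close>

lemma orthonormal_rows_imp_columns:
  fixes X :: mat
  assumes "\<And>i j. i < N \<Longrightarrow> j < N \<Longrightarrow> (\<Sum>k<N. X i k * X j k) = delta i j"
    and ij: "i < N" "j < N"
  shows "(\<Sum>k<N. X k i * X k j) = delta i j"
proof -
  have "(\<Sum>i<N. \<Sum>j<N. ((\<Sum>k<N. X k i * X k j) - delta i j)\<^sup>2) = 0"
    using assms(1) by (subst frobenius_gram_transpose[symmetric]) simp
  then have "\<forall>i<N. (\<Sum>j<N. ((\<Sum>k<N. X k i * X k j) - delta i j)\<^sup>2) = 0"
    by (subst (asm) sum_nonneg_eq_0_iff) (auto intro: sum_nonneg)
  then have "(\<Sum>j<N. ((\<Sum>k<N. X k i * X k j) - delta i j)\<^sup>2) = 0" using ij by blast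
  then have "\<forall>j\<in>{..<N}. ((\<Sum>k<N. X k i * X k j) - delta i j)\<^sup>2 = 0"
    by (subst (asm) sum_nonneg_eq_0_iff) auto
  then have "((\<Sum>k<N. X k i * X k j) - delta i j)\<^sup>2 = 0" using ij(2) by blast
  then show ?thesis by (simp only: power_eq_0_iff) simp
qed

text \<open>The Gram matrix S = X X^T satisfies a . S a = |X^T a|^2, so it inherits injectivity from
  the hypothesis on X. If S b = e_l, then X^T b is column l of the wanted inverse.\<close>

lemma right_inverse_exists:
  fixes X :: mat
  assumes inj: "\<And>y. (\<And>k. k < N \<Longrightarrow> (\<Sum>j<N. y j * X j k) = 0) \<Longrightarrow> (\<forall>j<N. y j = 0)"
  shows "\<exists>A. \<forall>i<N. \<forall>j<N. (\<Sum>k<N. X i k * A k j) = delta i j"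
proof -
  define S where "S i j = (\<Sum>k<N. X i k * X j k)" for i j
  have Sinj: "\<forall>j<N. a j = 0" if "\<And>i. i < N \<Longrightarrow> (\<Sum>j<N. S i j * a j) = 0" for a
  proof (rule inj)
    fix k assume "k < N"
    have "(\<Sum>k<N. (\<Sum>j<N. a j * X j k)\<^sup>2) = (\<Sum>k<N. \<Sum>i<N. \<Sum>j<N. a i * X i k * (a j * X j k))"
      by (simp add: power2_eq_square sum_product)
    also have "\<dots> = (\<Sum>i<N. \<Sum>j<N. \<Sum>k<N. a i * X i k * (a j * X j k))"
      by (rule sum_rotate3)
    also have "\<dots> = (\<Sum>i<N. a i * (\<Sum>j<N. S i j * a j))"
      by (simp add: S_def sum_distrib_left sum_distrib_right ac_simps)
    also have "\<dots> = 0" using that by simp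
    finally have "\<forall>k\<in>{..<N}. (\<Sum>j<N. a j * X j k)\<^sup>2 = 0"
      by (subst (asm) sum_nonneg_eq_0_iff) auto
    then have "(\<Sum>j<N. a j * X j k)\<^sup>2 = 0" using \<open>k < N\<close> by blast
    then show "(\<Sum>j<N. a j * X j k) = 0" by simp
  qed
  have "\<exists>b. \<forall>i<N. (\<Sum>j<N. S i j * b j) = delta i l" for l
  proof -
    \<comment> \<open>N equations in N + 1 unknowns, the last unknown multiplying the right-hand
      side e_l. Injectivity of S forbids it to vanish, and dividing by it gives the
      solution.\<close>
    obtain x where x: "\<exists>j\<in>{..<Suc N}. x j \<noteq> 0"
      "\<And>i. i < N \<Longrightarrow> (\<Sum>j<Suc N. (if j < N then S i j else delta i l) * x j) = 0"
      using homogeneous_system_nontrivial[of "{..<Suc N}" N "\<lambda>i j. if j < N then S i j else delta i l"]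
      by auto
    have x2: "(\<Sum>j<N. S i j * x j) + delta i l * x N = 0" if "i < N" for i
      using x(2)[OF that] by simp
    have "x N \<noteq> 0"
    proof
      assume "x N = 0"
      with x2 have "\<forall>j<N. x j = 0" by (intro Sinj) simp
      with \<open>x N = 0\<close> x(1) show False by (auto simp: less_Suc_eq)
    qed
    then have "(\<Sum>j<N. S i j * (- x j / x N)) = delta i l" if "i < N" for i
    proof -
      have "(\<Sum>j<N. S i j * (- x j / x N)) = - (\<Sum>j<N. S i j * x j) / x N"
        by (simp add: sum_divide_distrib sum_negf)
      also have "\<dots> = delta i l * x N / x N" using x2[OF that] by (simp add: field_simps)
      finally show ?thesis using \<open>x N \<noteq> 0\<close> by simp
    qed
    then show ?thesis by (intro exI[of _ "\<lambda>j. - x j / x N"]) blast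
  qed
  then obtain b where b: "\<And>l i. i < N \<Longrightarrow> (\<Sum>j<N. S i j * b l j) = delta i l" by metis
  have "(\<Sum>k<N. X i k * (\<Sum>j<N. X j k * b l j)) = delta i l" if "i < N" for i l
  proof -
    have "(\<Sum>k<N. X i k * (\<Sum>j<N. X j k * b l j)) = (\<Sum>j<N. \<Sum>k<N. X i k * (X j k * b l j))"
      by (simp only: sum_distrib_left) (rule sum.swap)
    also have "\<dots> = (\<Sum>j<N. S i j * b l j)" by (simp add: S_def sum_distrib_right mult.assoc)
    finally show ?thesis using b[OF that] by simp
  qed
  then show ?thesis by (intro exI[of _ "\<lambda>k l. \<Sum>j<N. X j k * b l j"]) blast
qed

text \<open>If the rows of \<open>c\<close> dominate an orthonormal system but some unit combination of them
  misses the first \<open>N\<close> coordinates, then successively choosing unit vectors orthogonal to the previous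
  ones and to the first coordinates (as in the Courant--Fischer principle) forces the energy up.\<close>

lemma energy_lower_bound_of_kernel:
  fixes c :: "nat \<Rightarrow> nat \<Rightarrow> real"
  assumes lam: "mono lam" "0 \<le> lam 0"
    and N1: "N \<ge> 1"
    and csum: "\<And>i j. i < N \<Longrightarrow> j < N \<Longrightarrow> (\<lambda>k. c i k * c j k) sums P i j"
    and asum: "\<And>i j. i < N \<Longrightarrow> j < N \<Longrightarrow> (\<lambda>k. lam k * (c i k * c j k)) sums R i j"
    and ge: "\<And>y. (\<Sum>j<N. (y j)\<^sup>2) \<le> (\<Sum>i<N. \<Sum>j<N. y i * P i j * y j)"
    and y: "\<And>k. k < N \<Longrightarrow> (\<Sum>j<N. y j * c j k) = 0" "\<exists>j<N. y j \<noteq> 0"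
  shows "(\<Sum>i<N - 1. lam i) + lam N \<le> (\<Sum>j<N. R j j)"
proof -
  have quad: "(\<lambda>k. w k * (\<Sum>j<N. z j * c j k)\<^sup>2) sums (\<Sum>i<N. \<Sum>j<N. z i * M i j * z j)"
    if "\<And>i j. i < N \<Longrightarrow> j < N \<Longrightarrow> (\<lambda>k. w k * (c i k * c j k)) sums M i j" for w M z
  proof -
    have "(\<lambda>k. \<Sum>i<N. \<Sum>j<N. z i * (w k * (c i k * c j k)) * z j) sums (\<Sum>i<N. \<Sum>j<N. z i * M i j * z j)"
      by (intro sums_sum sums_mult sums_mult2 that) auto
    moreover have "(\<Sum>i<N. \<Sum>j<N. z i * (w k * (c i k * c j k)) * z j) = w k * (\<Sum>j<N. z j * c j k)\<^sup>2" for k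
      by (simp add: power2_eq_square sum_product sum_distrib_left ac_simps)
    ultimately show ?thesis by simp
  qed
  \<comment> \<open>Modes below q contribute nothing for such a z, all others carry a weight of at
    least \<open>lam q\<close>, and \<open>ge\<close> bounds the total mass from below by the
    Euclidean norm.\<close>
  have lower: "lam q * (\<Sum>j<N. (z j)\<^sup>2) \<le> (\<Sum>i<N. \<Sum>j<N. z i * R i j * z j)"
    if "\<And>k. k < q \<Longrightarrow> (\<Sum>j<N. z j * c j k) = 0" for z q
  proof -
    have "lam q \<ge> 0" using lam by (metis monoD order_trans zero_le)
    then have "lam q * (\<Sum>j<N. (z j)\<^sup>2) \<le> lam q * (\<Sum>i<N. \<Sum>j<N. z i * P i j * z j)"
      by (intro mult_left_mono ge)
    also have "\<dots> \<le> (\<Sum>i<N. \<Sum>j<N. z i * R i j * z j)"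
    proof (rule sums_le)
      show "(\<lambda>k. lam q * (\<Sum>j<N. z j * c j k)\<^sup>2) sums (lam q * (\<Sum>i<N. \<Sum>j<N. z i * P i j * z j))"
        using sums_mult[OF quad[of "\<lambda>_. 1" P z], of "lam q"] csum by simp
      show "(\<lambda>k. lam k * (\<Sum>j<N. z j * c j k)\<^sup>2) sums (\<Sum>i<N. \<Sum>j<N. z i * R i j * z j)"
        by (rule quad[OF asum])
      show "lam q * (\<Sum>j<N. z j * c j k)\<^sup>2 \<le> lam k * (\<Sum>j<N. z j * c j k)\<^sup>2" for k
        using that[of k] lam(1) by (cases "k < q") (auto intro!: mult_right_mono simp: monoD)
    qed
    finally show ?thesis .
  qed
  have unit: "\<exists>f. (\<Sum>j<N. f j * f j) = 1 \<and> (\<forall>j. f j = s j / sqrt (\<Sum>j<N. s j * s j))"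
    if s: "\<exists>j<N. s j \<noteq> 0" for s :: "nat \<Rightarrow> real"
  proof -
    have "(\<Sum>j<N. s j * s j) > 0"
    proof -
      obtain j where "j < N" "s j \<noteq> 0" using s by auto
      then show ?thesis by (intro sum_pos2[of _ j]) (auto simp: zero_less_mult_iff linorder_neq_iff)
    qed
    then have eq: "(\<Sum>j<N. (s j / sqrt (\<Sum>j<N. s j * s j)) * (s j / sqrt (\<Sum>j<N. s j * s j))) = 1"
      by (simp flip: sum_divide_distrib)
    show ?thesis
      by (intro exI[of _ "\<lambda>j. s j / sqrt (\<Sum>j<N. s j * s j)"] conjI allI refl eq)
  qed
  \<comment> \<open>The vector y kills N coordinates, one more than counting dimensions would
    provide. Vector number r >= 1 is orthogonal to r predecessors, which leaves room for N - 1 - r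
    coordinate conditions.\<close>
  have family: "\<exists>f::nat \<Rightarrow> nat \<Rightarrow> real. (\<forall>r\<le>m. \<forall>s\<le>m. (\<Sum>j<N. f r j * f s j) = delta r s)
      \<and> (\<forall>k<N. (\<Sum>j<N. f 0 j * c j k) = 0)
      \<and> (\<forall>r\<in>{1..m}. \<forall>k<N - 1 - r. (\<Sum>j<N. f r j * c j k) = 0)" if "m < N" for m
    using that
  proof (induction m)
    case 0
    obtain f where f: "(\<Sum>j<N. f j * f j) = 1" "\<And>j. f j = y j / sqrt (\<Sum>j<N. y j * y j)"
      using unit[OF y(2)] by auto
    have "(\<Sum>j<N. f j * c j k) = 0" if "k < N" for k
      using y(1)[OF that] by (simp add: f(2) flip: sum_divide_distrib)
    then show ?case using f(1) by (intro exI[of _ "\<lambda>_. f"]) auto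
  next
    case (Suc m)
    then obtain f where f: "\<And>r s. r \<le> m \<Longrightarrow> s \<le> m \<Longrightarrow> (\<Sum>j<N. f r j * f s j) = delta r s"
      "\<And>k. k < N \<Longrightarrow> (\<Sum>j<N. f 0 j * c j k) = 0"
      "\<And>r k. r \<in> {1..m} \<Longrightarrow> k < N - 1 - r \<Longrightarrow> (\<Sum>j<N. f r j * c j k) = 0" by force
    obtain s where s: "\<exists>j<N. s j \<noteq> 0"
      "\<And>i. i < N - 1 \<Longrightarrow> (\<Sum>j<N. (if i \<le> m then f i j else c j (i - Suc m)) * s j) = 0"
      using homogeneous_system_nontrivial[of "{..<N}" "N - 1" "\<lambda>i j. if i \<le> m then f i j else c j (i - Suc m)"]
        N1 by auto
    obtain g where g: "(\<Sum>j<N. g j * g j) = 1" "\<And>j. g j = s j / sqrt (\<Sum>j<N. s j * s j)"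
      using unit[OF s(1)] by auto
    have scale: "(\<Sum>j<N. h j * g j) = (\<Sum>j<N. h j * s j) / sqrt (\<Sum>j<N. s j * s j)" for h
      by (simp add: g(2) sum_divide_distrib)
    have gf: "(\<Sum>j<N. f r j * g j) = 0" if "r \<le> m" for r
      using s(2)[of r] that Suc.prems by (simp add: scale)
    have gc: "(\<Sum>j<N. g j * c j k) = 0" if "k < N - 1 - Suc m" for k
      using s(2)[of "k + Suc m"] that scale[of "\<lambda>j. c j k"] by (simp add: mult.commute)
    have gf': "(\<Sum>j<N. g j * f r j) = 0" if "r \<le> m" for r
      using gf[OF that] by (simp add: mult.commute)
    show ?case
      using f g(1) gf gf' gc by (intro exI[of _ "f(Suc m := g)"]) (auto simp: le_Suc_eq)
  qed
  obtain f :: "nat \<Rightarrow> nat \<Rightarrow> real" where f0: "\<forall>r\<le>N-1. \<forall>s\<le>N-1. (\<Sum>j<N. f r j * f s j) = delta r s"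
    and f1: "\<And>k. k < N \<Longrightarrow> (\<Sum>j<N. f 0 j * c j k) = 0"
    and f2: "\<And>r k. r \<in> {1..N-1} \<Longrightarrow> k < N - 1 - r \<Longrightarrow> (\<Sum>j<N. f r j * c j k) = 0"
    using family[of "N - 1"] N1 by auto
  have orth: "(\<Sum>j<N. f r j * f s j) = delta r s" if "r < N" "s < N" for r s
    using f0 that by auto
  \<comment> \<open>The vectors \<open>f r\<close> resolve the identity, so their quadratic forms
    add up to the trace of R.\<close>
  have cols: "(\<Sum>r<N. f r i * f r j) = delta i j" if "i < N" "j < N" for i j
    using orthonormal_rows_imp_columns[of N f] orth that by auto
  have norm1: "(\<Sum>j<N. (f r j)\<^sup>2) = 1" if "r < N" for r
    using orth[OF that that] by (simp add: power2_eq_square)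
  have "(\<Sum>r<N. \<Sum>i<N. \<Sum>j<N. f r i * R i j * f r j) = (\<Sum>i<N. \<Sum>j<N. \<Sum>r<N. f r i * R i j * f r j)"
    by (rule sum_rotate3)
  also have "\<dots> = (\<Sum>i<N. \<Sum>j<N. R i j * (\<Sum>r<N. f r i * f r j))"
    by (simp add: sum_distrib_left ac_simps)
  also have "\<dots> = (\<Sum>i<N. \<Sum>j<N. R i j * delta i j)"
    by (intro sum.cong refl) (simp only: cols lessThan_iff)
  also have "\<dots> = (\<Sum>j<N. R j j)"
    by (rule sum.cong[OF refl]) (simp only: sum_delta_mult lessThan_iff)
  finally have total: "(\<Sum>r<N. \<Sum>i<N. \<Sum>j<N. f r i * R i j * f r j) = (\<Sum>j<N. R j j)" .
  \<comment> \<open>\<open>f 0\<close> accounts for \<open>lam N\<close>, and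
    \<open>f (Suc r)\<close> for \<open>lam (N - 1 - Suc r)\<close>, so the other eigenvalues appear
    in reverse order.\<close>
  have "(\<Sum>i<N - 1. lam i) + lam N = lam N + (\<Sum>i<N - 1. lam (N - 1 - Suc i))"
    using sum.nat_diff_reindex[of lam "N - 1"] by linarith
  also have "\<dots> \<le> (\<Sum>i<N. \<Sum>j<N. f 0 i * R i j * f 0 j)
      + (\<Sum>r<N - 1. \<Sum>i<N. \<Sum>j<N. f (Suc r) i * R i j * f (Suc r) j)"
  proof (intro add_mono sum_mono)
    show "lam N \<le> (\<Sum>i<N. \<Sum>j<N. f 0 i * R i j * f 0 j)"
      using lower[of N "f 0"] f1 norm1[of 0] N1 by simp
    show "lam (N - 1 - Suc r) \<le> (\<Sum>i<N. \<Sum>j<N. f (Suc r) i * R i j * f (Suc r) j)" if "r \<in> {..<N - 1}" for r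
      using lower[of "N - 1 - Suc r" "f (Suc r)"] f2[of "Suc r"] norm1[of "Suc r"] that by simp
  qed
  also have "\<dots> = (\<Sum>r<N. \<Sum>i<N. \<Sum>j<N. f r i * R i j * f r j)"
    using N1 sum.lessThan_Suc_shift[of "\<lambda>r. \<Sum>i<N. \<Sum>j<N. f r i * R i j * f r j" "N - 1"] by simp
  finally show ?thesis using total by simp
qed

subsection \<open>Exponentially decaying functions\<close>

text \<open>Constant and rate are hidden behind a quantifier, so that sums, products and square
  roots need no bookkeeping of rates. The admissible multipliers are the functions in
  \<open>bdd_time\<close>.\<close>

definition exp_small :: "(real \<Rightarrow> real) \<Rightarrow> bool" where
  "exp_small f \<longleftrightarrow> (\<exists>C \<gamma>. \<gamma> > 0 \<and> (\<forall>t\<ge>0. \<bar>f t\<bar> \<le> C * exp (- \<gamma> * t)))"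

definition bdd_time :: "(real \<Rightarrow> real) \<Rightarrow> bool" where
  "bdd_time f \<longleftrightarrow> (\<exists>C. \<forall>t\<ge>0. \<bar>f t\<bar> \<le> C)"

lemma exp_small_dominated:
  assumes "exp_small f" "\<And>t. t \<ge> 0 \<Longrightarrow> \<bar>g t\<bar> \<le> f t"
  shows "exp_small g"
  using assms unfolding exp_small_def by (meson abs_ge_self order_trans)

lemma exp_small_cong:
  assumes "exp_small f" "\<And>t. t \<ge> 0 \<Longrightarrow> g t = f t"
  shows "exp_small g"
  using assms unfolding exp_small_def by simp

lemma exp_small_exp: "\<gamma> > 0 \<Longrightarrow> exp_small (\<lambda>t. exp (- \<gamma> * t))"
  unfolding exp_small_def by (intro exI[of _ 1] exI[of _ \<gamma>]) auto

lemma exp_small_zero: "exp_small (\<lambda>_. 0)"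
  unfolding exp_small_def by (intro exI[of _ 0] exI[of _ 1]) auto

lemma exp_small_add:
  assumes "exp_small f" "exp_small g"
  shows "exp_small (\<lambda>t. f t + g t)"
proof -
  obtain C \<gamma> where f: "\<gamma> > 0" "\<And>t. t \<ge> 0 \<Longrightarrow> \<bar>f t\<bar> \<le> C * exp (- \<gamma> * t)"
    using assms(1) unfolding exp_small_def by blast
  obtain D \<delta> where g: "\<delta> > 0" "\<And>t. t \<ge> 0 \<Longrightarrow> \<bar>g t\<bar> \<le> D * exp (- \<delta> * t)"
    using assms(2) unfolding exp_small_def by blast
  have "C \<ge> 0" "D \<ge> 0" using f(2)[of 0] g(2)[of 0] by auto
  have "\<bar>f t + g t\<bar> \<le> (C + D) * exp (- min \<gamma> \<delta> * t)" if "t \<ge> 0" for t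
  proof -
    have "C * exp (- \<gamma> * t) \<le> C * exp (- min \<gamma> \<delta> * t)" "D * exp (- \<delta> * t) \<le> D * exp (- min \<gamma> \<delta> * t)"
      using that \<open>C \<ge> 0\<close> \<open>D \<ge> 0\<close> by (auto intro!: mult_left_mono mult_right_mono)
    then show ?thesis using f(2)[OF that] g(2)[OF that] by (simp add: distrib_right)
  qed
  then show ?thesis unfolding exp_small_def
    using f(1) g(1) by (intro exI[of _ "C + D"] exI[of _ "min \<gamma> \<delta>"]) auto
qed

lemma exp_small_mult_bdd:
  assumes "exp_small f" "bdd_time g"
  shows "exp_small (\<lambda>t. f t * g t)" "exp_small (\<lambda>t. g t * f t)"
proof -
  obtain C \<gamma> where f: "\<gamma> > 0" "\<And>t. t \<ge> 0 \<Longrightarrow> \<bar>f t\<bar> \<le> C * exp (- \<gamma> * t)"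
    using assms(1) unfolding exp_small_def by blast
  obtain D where g: "\<And>t. t \<ge> 0 \<Longrightarrow> \<bar>g t\<bar> \<le> D"
    using assms(2) unfolding bdd_time_def by blast
  have "\<bar>f t * g t\<bar> \<le> (C * D) * exp (- \<gamma> * t)" if "t \<ge> 0" for t
  proof -
    have "\<bar>f t\<bar> * \<bar>g t\<bar> \<le> (C * exp (- \<gamma> * t)) * D"
      using f(2)[OF that] by (intro mult_mono f(2) g that) linarith+
    then show ?thesis by (simp add: abs_mult mult.commute mult.left_commute)
  qed
  then show "exp_small (\<lambda>t. f t * g t)" unfolding exp_small_def using f(1) by blast
  then show "exp_small (\<lambda>t. g t * f t)" by (simp add: mult.commute)
qed

lemma bdd_time_const: "bdd_time (\<lambda>_. a)"
  unfolding bdd_time_def by (intro exI[of _ "\<bar>a\<bar>"]) auto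

lemma bdd_time_add: "bdd_time f \<Longrightarrow> bdd_time g \<Longrightarrow> bdd_time (\<lambda>t. f t + g t)"
  unfolding bdd_time_def by (meson abs_triangle_ineq add_mono order_trans)

lemma bdd_time_mult: "bdd_time f \<Longrightarrow> bdd_time g \<Longrightarrow> bdd_time (\<lambda>t. f t * g t)"
  unfolding bdd_time_def abs_mult by (meson abs_ge_zero mult_mono order_trans)

lemma bdd_time_sum: "(\<And>i. i \<in> I \<Longrightarrow> bdd_time (f i)) \<Longrightarrow> bdd_time (\<lambda>t. \<Sum>i\<in>I. f i t)"
  by (induction I rule: infinite_finite_induct) (auto intro: bdd_time_const bdd_time_add)

lemma exp_small_cmult: "exp_small f \<Longrightarrow> exp_small (\<lambda>t. a * f t)"
  by (rule exp_small_mult_bdd(2)[OF _ bdd_time_const])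

lemma exp_small_diff:
  assumes "exp_small f" "exp_small g"
  shows "exp_small (\<lambda>t. f t - g t)"
  using exp_small_add[OF assms(1) exp_small_cmult[OF assms(2), of "-1"]] by simp

lemma exp_small_sum:
  assumes "\<And>i. i \<in> I \<Longrightarrow> exp_small (f i)"
  shows "exp_small (\<lambda>t. \<Sum>i\<in>I. f i t)"
  using assms by (induction I rule: infinite_finite_induct) (auto intro: exp_small_zero exp_small_add)

lemma exp_small_imp_bdd: "exp_small f \<Longrightarrow> bdd_time f"
proof -
  assume "exp_small f"
  then obtain C \<gamma> where f: "\<gamma> > 0" "\<And>t. t \<ge> 0 \<Longrightarrow> \<bar>f t\<bar> \<le> C * exp (- \<gamma> * t)"
    unfolding exp_small_def by blast
  have "C \<ge> 0" using f(2)[of 0] by auto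
  have "\<bar>f t\<bar> \<le> C" if "t \<ge> 0" for t
  proof -
    have "C * exp (- \<gamma> * t) \<le> C * 1" using that f(1) \<open>C \<ge> 0\<close> by (intro mult_left_mono) auto
    then show ?thesis using f(2)[OF that] by simp
  qed
  then show ?thesis unfolding bdd_time_def by blast
qed

lemma exp_small_of_square:
  assumes "exp_small (\<lambda>t. (f t)\<^sup>2)"
  shows "exp_small f"
proof -
  obtain C \<gamma> where f: "\<gamma> > 0" "\<And>t. t \<ge> 0 \<Longrightarrow> \<bar>(f t)\<^sup>2\<bar> \<le> C * exp (- \<gamma> * t)"
    using assms unfolding exp_small_def by blast
  have "C \<ge> 0" using f(2)[of 0] order_trans[OF abs_ge_zero] by fastforce
  have "\<bar>f t\<bar> \<le> sqrt C * exp (- (\<gamma> / 2) * t)" if "t \<ge> 0" for t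
  proof (rule power2_le_imp_le)
    have "(exp (- (\<gamma> / 2) * t))\<^sup>2 = exp (- \<gamma> * t)" by (simp flip: exp_double)
    then show "\<bar>f t\<bar>\<^sup>2 \<le> (sqrt C * exp (- (\<gamma> / 2) * t))\<^sup>2"
      using f(2)[OF that] \<open>C \<ge> 0\<close> by (simp add: power_mult_distrib)
  qed (use \<open>C \<ge> 0\<close> in auto)
  then show ?thesis unfolding exp_small_def using f(1) by (intro exI[of _ "sqrt C"] exI[of _ "\<gamma> / 2"]) auto
qed

lemma exp_small_tendsto_0:
  assumes "exp_small f"
  shows "(f \<longlongrightarrow> 0) at_top"
proof -
  obtain C \<gamma> where f: "\<gamma> > 0" "\<And>t. t \<ge> 0 \<Longrightarrow> \<bar>f t\<bar> \<le> C * exp (- \<gamma> * t)"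
    using assms unfolding exp_small_def by blast
  have "((\<lambda>t. C * exp (- \<gamma> * t)) \<longlongrightarrow> C * 0) at_top"
    using f(1) by (intro tendsto_mult tendsto_const filterlim_compose[OF exp_at_bot]
        filterlim_tendsto_neg_mult_at_bot[OF tendsto_const] filterlim_ident) auto
  then show ?thesis
    using f(2) by (intro Lim_null_comparison[of f "\<lambda>t. C * exp (- \<gamma> * t)"])
      (auto simp: eventually_at_top_linorder)
qed

text \<open>At interior points of the half-line the derivative is two-sided; at 0 the one-sided
  derivative supplies the continuity that the mean value argument asks for.\<close>

lemma derivative_nonpos_imp_le:
  fixes f :: "real \<Rightarrow> real"
  assumes "\<And>t. t \<ge> 0 \<Longrightarrow> (f has_real_derivative f' t) (at t within {0..})"
    and "\<And>t. t \<ge> 0 \<Longrightarrow> f' t \<le> 0" and "0 \<le> s" "s \<le> t"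
  shows "f t \<le> f s"
proof (rule DERIV_nonpos_imp_decreasing_open[OF assms(4)])
  fix x assume "s < x" "x < t"
  then have "at x within {0..} = at x" using assms(3) by (intro at_within_interior) (auto simp: interior_Ici)
  then show "\<exists>y. DERIV f x :> y \<and> y \<le> 0"
    using assms(1,2)[of x] assms(3) \<open>s < x\<close> by auto
next
  show "continuous_on {s..t} f"
  proof (rule continuous_on_subset[of "{0..}"])
    show "continuous_on {0..} f"
      using assms(1) by (auto simp: continuous_on_eq_continuous_within intro: DERIV_continuous)
  qed (use assms in auto)
qed

text \<open>With E the tail integral of the bound on f', f - E is increasing and f + E is
  decreasing. Hence f - E stays below f 0 + E 0 and converges, and E tends to 0.\<close>

lemma exp_small_derivative_imp_convergent:
  fixes f :: "real \<Rightarrow> real"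
  assumes d: "\<And>t. t \<ge> 0 \<Longrightarrow> (f has_real_derivative f' t) (at t within {0..})"
    and "exp_small f'"
  shows "\<exists>l. (f \<longlongrightarrow> l) at_top"
proof -
  obtain C \<gamma> where f': "\<gamma> > 0" "\<And>t. t \<ge> 0 \<Longrightarrow> \<bar>f' t\<bar> \<le> C * exp (- \<gamma> * t)"
    using assms(2) unfolding exp_small_def by blast
  define E where "E t = C / \<gamma> * exp (- \<gamma> * t)" for t
  have "C \<ge> 0" using f'(2)[of 0] by auto
  have dE: "(E has_real_derivative - C * exp (- \<gamma> * t)) (at t within {0..})" for t
    unfolding E_def using f'(1) by (auto intro!: derivative_eq_intros)
  have E0: "(E \<longlongrightarrow> 0) at_top"
    unfolding E_def by (intro exp_small_tendsto_0 exp_small_cmult exp_small_exp f'(1))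
  have up: "f s - E s \<le> f t - E t" if "0 \<le> s" "s \<le> t" for s t
  proof -
    have "- (f t - E t) \<le> - (f s - E s)"
    proof (rule derivative_nonpos_imp_le[OF _ _ that])
      fix t :: real assume t: "t \<ge> 0"
      show "((\<lambda>t. - (f t - E t)) has_real_derivative - (f' t - (- C * exp (- \<gamma> * t)))) (at t within {0..})"
        by (intro DERIV_minus DERIV_diff d t dE)
      show "- (f' t - (- C * exp (- \<gamma> * t))) \<le> 0" using f'(2)[OF t] by simp
    qed
    then show ?thesis by simp
  qed
  have down: "f t + E t \<le> f 0 + E 0" if "0 \<le> t" for t
  proof (rule derivative_nonpos_imp_le[OF _ _ order_refl that])
    fix t :: real assume t: "t \<ge> 0"
    show "((\<lambda>t. f t + E t) has_real_derivative f' t + (- C * exp (- \<gamma> * t))) (at t within {0..})"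
      by (intro DERIV_add d t dE)
    show "f' t + (- C * exp (- \<gamma> * t)) \<le> 0" using f'(2)[OF t] by simp
  qed
  have "E t \<ge> 0" for t using \<open>C \<ge> 0\<close> f'(1) by (auto simp: E_def)
  \<comment> \<open>Freezing the function to the left of 0 makes it monotone on all reals, so that
    its limit is the supremum of its range.\<close>
  define g where "g t = (if t \<le> 0 then f 0 - E 0 else f t - E t)" for t
  have "mono g" using up by (auto simp: mono_def g_def)
  have "g t \<le> f 0 + E 0" for t
    using down[of t] \<open>E t \<ge> 0\<close> \<open>E 0 \<ge> 0\<close> by (auto simp: g_def)
  then have bdd: "bdd_above (range g)" by (auto intro!: bdd_aboveI[of _ "f 0 + E 0"])
  have "(g \<longlongrightarrow> (SUP t. g t)) at_top"
  proof (rule increasing_tendsto)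
    show "\<forall>\<^sub>F t in at_top. g t \<le> (SUP t. g t)"
      using bdd by (intro always_eventually allI cSUP_upper) auto
    fix x assume "x < (SUP t. g t)"
    then obtain s where "x < g s" using bdd by (auto simp: less_cSUP_iff)
    then show "\<forall>\<^sub>F t in at_top. x < g t"
      unfolding eventually_at_top_linorder using \<open>mono g\<close> by (meson less_le_trans monoD)
  qed
  then have "((\<lambda>t. f t - E t) \<longlongrightarrow> (SUP t. g t)) at_top"
    by (rule Lim_transform_eventually)
      (auto simp: g_def eventually_at_top_linorder intro: exI[of _ 1])
  from tendsto_add[OF this E0] show ?thesis by auto
qed

lemma suminf_tail_dominated:
  fixes f g :: "nat \<Rightarrow> real"
  assumes "summable g" "\<And>k. \<bar>f k\<bar> \<le> g k"
  shows "summable f" "\<bar>suminf f\<bar> \<le> suminf g"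
proof -
  have abs: "summable (\<lambda>k. \<bar>f k\<bar>)"
    by (rule summable_comparison_test'[OF assms(1), of 0]) (simp add: assms(2))
  then show "summable f" by (rule summable_rabs_cancel)
  have "\<bar>suminf f\<bar> \<le> (\<Sum>k. \<bar>f k\<bar>)" by (rule summable_rabs[OF abs])
  also have "\<dots> \<le> suminf g" by (rule suminf_le[OF assms(2) abs assms(1)])
  finally show "\<bar>suminf f\<bar> \<le> suminf g" .
qed

subsection \<open>The coefficient system\<close>

text \<open>\<open>c t j k\<close> is the k-th coefficient of the j-th component, \<open>P\<close>
  and \<open>B\<close> are <U,U> and <GU,U>, and \<open>A\<close> inverts the initial low-mode block
  from the right. The derivative of \<open>P\<close> is an assumption of its own, so its series is
  never differentiated term by term.\<close>

locale oja_coefficients =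
  fixes N :: nat and lam :: "nat \<Rightarrow> real" and c :: "real \<Rightarrow> nat \<Rightarrow> nat \<Rightarrow> real"
    and P B :: "real \<Rightarrow> mat" and A :: mat
  assumes N1: "N \<ge> 1"
    and lam_mono: "mono lam" and lam_pos: "lam 0 > 0" and gap: "lam (N - 1) < lam N"
    and P_sums: "\<And>t i j. t \<ge> 0 \<Longrightarrow> i < N \<Longrightarrow> j < N \<Longrightarrow> (\<lambda>k. c t i k * c t j k) sums P t i j"
    and B_sums: "\<And>t i j. t \<ge> 0 \<Longrightarrow> i < N \<Longrightarrow> j < N \<Longrightarrow> (\<lambda>k. c t i k * c t j k / lam k) sums B t i j"
    and c_deriv: "\<And>t j k. t \<ge> 0 \<Longrightarrow> j < N \<Longrightarrow>
        ((\<lambda>t. c t j k) has_real_derivative c t j k / lam k - (\<Sum>i<N. B t i j * c t i k)) (at t within {0..})"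
    and P_deriv: "\<And>t i j. t \<ge> 0 \<Longrightarrow> i < N \<Longrightarrow> j < N \<Longrightarrow>
        ((\<lambda>t. P t i j) has_real_derivative
          2 * B t i j - (\<Sum>l<N. B t l i * P t l j) - (\<Sum>l<N. P t i l * B t l j)) (at t within {0..})"
    and a_summable: "\<And>t j. t \<ge> 0 \<Longrightarrow> j < N \<Longrightarrow> summable (\<lambda>k. lam k * (c t j k)\<^sup>2)"
    and A: "\<And>i j. i < N \<Longrightarrow> j < N \<Longrightarrow> (\<Sum>k<N. c 0 i k * A k j) = delta i j"
begin

lemma lam_ge: "lam k \<ge> lam 0" using lam_mono by (simp add: monoD)

lemma lam_gt0: "lam k > 0" using lam_ge[of k] lam_pos by linarith

lemma lam_neq0 [simp]: "lam k \<noteq> 0" using lam_gt0[of k] by simp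

section \<open>Positivity of B and monotone quantities\<close>

lemma B_sym: "t \<ge> 0 \<Longrightarrow> i < N \<Longrightarrow> j < N \<Longrightarrow> B t i j = B t j i"
  using B_sums[of t i j] B_sums[of t j i] by (auto simp: mult.commute intro: sums_unique2)

text \<open>B is the series of the rank-one matrices x_k x_k^T with positive weights 1 / lam
  k.\<close>

lemma B_psd:
  assumes "t \<ge> 0"
  shows "(\<Sum>i<N. \<Sum>j<N. y i * B t i j * y j) \<ge> 0"
proof -
  have "(\<lambda>k. \<Sum>i<N. \<Sum>j<N. y i * (c t i k * c t j k / lam k) * y j)
      sums (\<Sum>i<N. \<Sum>j<N. y i * B t i j * y j)"
    by (intro sums_sum sums_mult sums_mult2 B_sums assms) auto
  moreover have "(\<Sum>i<N. \<Sum>j<N. y i * (c t i k * c t j k / lam k) * y j) = (\<Sum>j<N. y j * c t j k)\<^sup>2 / lam k" for k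
    by (simp add: power2_eq_square sum_product sum_divide_distrib ac_simps)
  ultimately have "(\<lambda>k. (\<Sum>j<N. y j * c t j k)\<^sup>2 / lam k) sums (\<Sum>i<N. \<Sum>j<N. y i * B t i j * y j)" by simp
  then show ?thesis
    by (rule sums_le[OF _ sums_zero, rotated]) (simp add: lam_gt0 less_imp_le)
qed

text \<open>The derivative of the squared norm is -2 w . B w. Applied to the difference of two
  solutions with equal initial values it yields uniqueness, without a Gronwall estimate.\<close>

lemma linear_flow_nonincreasing:
  assumes w: "\<And>t j. t \<ge> 0 \<Longrightarrow> j < N \<Longrightarrow>
      ((\<lambda>t. w t j) has_real_derivative - (\<Sum>i<N. B t i j * w t i)) (at t within {0..})"
    and "t \<ge> 0"
  shows "(\<Sum>j<N. (w t j)\<^sup>2) \<le> (\<Sum>j<N. (w 0 j)\<^sup>2)"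
proof (rule derivative_nonpos_imp_le[OF _ _ order_refl assms(2)])
  fix t :: real assume t: "t \<ge> 0"
  show "((\<lambda>t. \<Sum>j<N. (w t j)\<^sup>2) has_real_derivative
      (\<Sum>j<N. 2 * w t j * - (\<Sum>i<N. B t i j * w t i))) (at t within {0..})"
    using w[OF t] by (auto intro!: derivative_eq_intros sum.cong)
  have "(\<Sum>j<N. 2 * w t j * - (\<Sum>i<N. B t i j * w t i)) = - 2 * (\<Sum>j<N. \<Sum>i<N. w t j * B t i j * w t i)"
    by (simp add: sum_distrib_left sum_negf mult.assoc)
  also have "(\<Sum>j<N. \<Sum>i<N. w t j * B t i j * w t i) = (\<Sum>j<N. \<Sum>i<N. w t j * B t j i * w t i)"
    using B_sym[OF t] by (intro sum.cong refl) auto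
  finally show "(\<Sum>j<N. 2 * w t j * - (\<Sum>i<N. B t i j * w t i)) \<le> 0"
    using B_psd[OF t, of "w t"] by simp
qed

text \<open>The derivative of the squared Frobenius norm is -2 times the sum of the B-forms of all
  columns and all rows of M. It serves twice: as an a priori bound for P - I and as uniqueness for
  the matrix equation.\<close>

lemma matrix_flow_nonincreasing:
  assumes M: "\<And>t i j. t \<ge> 0 \<Longrightarrow> i < N \<Longrightarrow> j < N \<Longrightarrow> ((\<lambda>t. M t i j) has_real_derivative
      - (\<Sum>l<N. B t l i * M t l j) - (\<Sum>l<N. M t i l * B t l j)) (at t within {0..})"
    and "t \<ge> 0"
  shows "(\<Sum>i<N. \<Sum>j<N. (M t i j)\<^sup>2) \<le> (\<Sum>i<N. \<Sum>j<N. (M 0 i j)\<^sup>2)"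
proof (rule derivative_nonpos_imp_le[OF _ _ order_refl assms(2)])
  fix t :: real assume t: "t \<ge> 0"
  let ?d = "\<lambda>i j. - (\<Sum>l<N. B t l i * M t l j) - (\<Sum>l<N. M t i l * B t l j)"
  show "((\<lambda>t. \<Sum>i<N. \<Sum>j<N. (M t i j)\<^sup>2) has_real_derivative
      (\<Sum>i<N. \<Sum>j<N. 2 * M t i j * ?d i j)) (at t within {0..})"
    using M[OF t] by (auto intro!: derivative_eq_intros sum.cong)
  have total: "(\<Sum>i<N. \<Sum>j<N. 2 * M t i j * ?d i j)
      = - 2 * ((\<Sum>i<N. \<Sum>j<N. \<Sum>l<N. M t i j * B t l i * M t l j)
        + (\<Sum>i<N. \<Sum>j<N. \<Sum>l<N. M t i j * B t l j * M t i l))"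
    by (simp add: sum_distrib_left sum_negf sum.distrib sum_subtractf right_diff_distrib algebra_simps)
  have "(\<Sum>i<N. \<Sum>j<N. \<Sum>l<N. M t i j * B t l i * M t l j)
      = (\<Sum>j<N. \<Sum>i<N. \<Sum>l<N. M t i j * B t i l * M t l j)"
    by (subst sum.swap) (intro sum.cong refl, simp add: B_sym[OF t])
  also have "\<dots> \<ge> 0"
    by (intro sum_nonneg B_psd t)
  finally have left: "(\<Sum>i<N. \<Sum>j<N. \<Sum>l<N. M t i j * B t l i * M t l j) \<ge> 0" .
  have "(\<Sum>i<N. \<Sum>j<N. \<Sum>l<N. M t i j * B t l j * M t i l)
      = (\<Sum>i<N. \<Sum>j<N. \<Sum>l<N. M t i j * B t j l * M t i l)"
    by (intro sum.cong refl) (simp add: B_sym[OF t])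
  also have "\<dots> \<ge> 0"
    by (intro sum_nonneg B_psd t)
  finally have right: "(\<Sum>i<N. \<Sum>j<N. \<Sum>l<N. M t i j * B t l j * M t i l) \<ge> 0" .
  show "(\<Sum>i<N. \<Sum>j<N. 2 * M t i j * ?d i j) \<le> 0"
    unfolding total using left right by simp
qed

text \<open>Replacing P by P - I absorbs the source term 2 B, which leaves a homogeneous linear
  equation.\<close>

lemma defect_deriv:
  assumes "t \<ge> 0" "i < N" "j < N"
  shows "((\<lambda>t. P t i j - delta i j) has_real_derivative
     - (\<Sum>l<N. B t l i * (P t l j - delta l j)) - (\<Sum>l<N. (P t i l - delta i l) * B t l j)) (at t within {0..})"
proof -
  have "- (\<Sum>l<N. B t l i * (P t l j - delta l j)) - (\<Sum>l<N. (P t i l - delta i l) * B t l j)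
      = 2 * B t i j - (\<Sum>l<N. B t l i * P t l j) - (\<Sum>l<N. P t i l * B t l j)"
    using sum_delta_mult(4)[OF assms(3), of "\<lambda>l. B t l i"] sum_delta_mult(1)[OF assms(2), of "\<lambda>l. B t l j"]
      B_sym[OF assms]
    by (simp add: right_diff_distrib left_diff_distrib sum_subtractf)
  then show ?thesis using P_deriv[OF assms] by (auto intro!: derivative_eq_intros)
qed

lemma P_bdd:
  assumes "i < N" "j < N"
  shows "bdd_time (\<lambda>t. P t i j)"
proof -
  define F where "F = (\<Sum>i<N. \<Sum>j<N. (P 0 i j - delta i j)\<^sup>2)"
  have "\<bar>P t i j\<bar> \<le> 1 + sqrt F" if t: "t \<ge> 0" for t
  proof -
    have "(P t i j - delta i j)\<^sup>2 \<le> (\<Sum>j<N. (P t i j - delta i j)\<^sup>2)"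
      using assms by (intro member_le_sum) auto
    also have "\<dots> \<le> (\<Sum>i<N. \<Sum>j<N. (P t i j - delta i j)\<^sup>2)"
      using assms by (intro member_le_sum[of i _ "\<lambda>i. \<Sum>j<N. (P t i j - delta i j)\<^sup>2"]) (auto intro: sum_nonneg)
    also have "\<dots> \<le> F"
      unfolding F_def by (rule matrix_flow_nonincreasing[OF defect_deriv t])
    finally have "\<bar>P t i j - delta i j\<bar> \<le> sqrt F" by (metis real_sqrt_abs real_sqrt_le_iff)
    then show ?thesis by (auto split: if_splits)
  qed
  then show ?thesis unfolding bdd_time_def by blast
qed

lemma head_le_P:
  assumes "t \<ge> 0" "j < N"
  shows "(\<Sum>k<n. (c t j k)\<^sup>2) \<le> P t j j"
  using P_sums[OF assms assms(2)] sum_le_suminf[of "\<lambda>k. c t j k * c t j k" "{..<n}"]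
  by (auto simp: power2_eq_square sums_iff)

lemma c_bdd:
  assumes "j < N"
  shows "bdd_time (\<lambda>t. c t j k)"
proof -
  obtain C where C: "\<And>t. t \<ge> 0 \<Longrightarrow> \<bar>P t j j\<bar> \<le> C"
    using P_bdd[OF assms assms] unfolding bdd_time_def by blast
  have "\<bar>c t j k\<bar> \<le> sqrt C" if "t \<ge> 0" for t
  proof -
    have "(c t j k)\<^sup>2 \<le> (\<Sum>k<Suc k. (c t j k)\<^sup>2)" by (intro member_le_sum) auto
    also have "\<dots> \<le> C" using head_le_P[OF that assms, of "Suc k"] C[OF that] by linarith
    finally show ?thesis by (metis real_sqrt_abs real_sqrt_le_iff)
  qed
  then show ?thesis unfolding bdd_time_def by blast
qed

text \<open>The fundamental solution of \<open>\<Phi>' = - B \<Phi>\<close>, \<open>\<Phi>(0) = I\<close>, read off from the solution itself: every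
  coefficient vector \<open>x\<^sub>k\<close> solves \<open>x\<^sub>k' = (1/\<lambda>\<^sub>k - B) x\<^sub>k\<close>.\<close>

definition Phi :: "real \<Rightarrow> mat" where
  "Phi t j l = (\<Sum>i<N. c t j i * exp (- t / lam i) * A i l)"

lemma Phi_0: "j < N \<Longrightarrow> l < N \<Longrightarrow> Phi 0 j l = delta j l"
  using A by (simp add: Phi_def)

text \<open>The factor exp(-t / lam i) removes the growth term 1 / lam i from column i of the block,
  and the columns of \<open>Phi\<close> combine these columns with constant coefficients.\<close>

lemma Phi_deriv:
  assumes "t \<ge> 0" "j < N"
  shows "((\<lambda>t. Phi t j l) has_real_derivative - (\<Sum>i<N. B t i j * Phi t i l)) (at t within {0..})"
proof -
  have "((\<lambda>t. Phi t j l) has_real_derivative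
      (\<Sum>i<N. ((c t j i / lam i - (\<Sum>m<N. B t m j * c t m i)) * exp (- t / lam i)
        + c t j i * (exp (- t / lam i) * (- 1 / lam i))) * A i l)) (at t within {0..})"
    unfolding Phi_def
    by (intro DERIV_sum DERIV_cmult_right)
      (use c_deriv[OF assms] in \<open>auto intro!: derivative_eq_intros simp: algebra_simps\<close>)
  also have "(\<Sum>i<N. ((c t j i / lam i - (\<Sum>m<N. B t m j * c t m i)) * exp (- t / lam i)
        + c t j i * (exp (- t / lam i) * (- 1 / lam i))) * A i l)
      = (\<Sum>i<N. - (\<Sum>m<N. B t m j * c t m i) * exp (- t / lam i) * A i l)"
    by (intro sum.cong refl) (simp add: algebra_simps)
  also have "\<dots> = - (\<Sum>i<N. \<Sum>m<N. B t m j * (c t m i * exp (- t / lam i) * A i l))"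
    by (simp add: sum_negf sum_distrib_right sum_distrib_left mult.assoc)
  also have "\<dots> = - (\<Sum>m<N. B t m j * Phi t m l)"
    by (subst sum.swap) (simp add: Phi_def sum_distrib_left)
  finally show ?thesis .
qed

text \<open>exp(-t / lam k) x_k and Phi x_k(0) solve the same linear equation with the same initial
  value. Since k is arbitrary, the low block thereby controls the high modes.\<close>

lemma coefficient_formula:
  assumes "t \<ge> 0" "j < N"
  shows "c t j k = exp (t / lam k) * (\<Sum>l<N. Phi t j l * c 0 l k)"
proof -
  define w where "w t j = exp (- t / lam k) * c t j k - (\<Sum>l<N. Phi t j l * c 0 l k)" for t j
  have d: "((\<lambda>t. w t j) has_real_derivative - (\<Sum>i<N. B t i j * w t i)) (at t within {0..})"
    if t: "t \<ge> 0" and j: "j < N" for t j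
  proof -
    have "((\<lambda>t. w t j) has_real_derivative
       (exp (- t / lam k) * (- 1 / lam k) * c t j k
        + exp (- t / lam k) * (c t j k / lam k - (\<Sum>i<N. B t i j * c t i k)))
       - (\<Sum>l<N. - (\<Sum>i<N. B t i j * Phi t i l) * c 0 l k)) (at t within {0..})"
      unfolding w_def
      by (intro DERIV_diff DERIV_sum DERIV_cmult_right Phi_deriv t j)
        (use c_deriv[OF t j] in \<open>auto intro!: derivative_eq_intros simp: algebra_simps\<close>)
    also have "(exp (- t / lam k) * (- 1 / lam k) * c t j k
        + exp (- t / lam k) * (c t j k / lam k - (\<Sum>i<N. B t i j * c t i k)))
       - (\<Sum>l<N. - (\<Sum>i<N. B t i j * Phi t i l) * c 0 l k)
       = - (\<Sum>i<N. B t i j * (exp (- t / lam k) * c t i k)) + (\<Sum>l<N. \<Sum>i<N. B t i j * Phi t i l * c 0 l k)"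
      by (simp add: algebra_simps sum_distrib_left sum_distrib_right sum_negf)
    also have "(\<Sum>l<N. \<Sum>i<N. B t i j * Phi t i l * c 0 l k) = (\<Sum>i<N. B t i j * (\<Sum>l<N. Phi t i l * c 0 l k))"
      by (subst sum.swap) (simp add: sum_distrib_left mult.assoc)
    also have "- (\<Sum>i<N. B t i j * (exp (- t / lam k) * c t i k))
        + (\<Sum>i<N. B t i j * (\<Sum>l<N. Phi t i l * c 0 l k)) = - (\<Sum>i<N. B t i j * w t i)"
      by (simp add: w_def right_diff_distrib sum_subtractf)
    finally show ?thesis .
  qed
  have "w 0 j = 0" if "j < N" for j
  proof -
    have "(\<Sum>l<N. Phi 0 j l * c 0 l k) = (\<Sum>l<N. delta j l * c 0 l k)"
      using that by (intro sum.cong) (auto simp: Phi_0)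
    then show ?thesis using sum_delta_mult(1)[OF that, of "\<lambda>l. c 0 l k"] by (simp add: w_def)
  qed
  then have "(\<Sum>j<N. (w t j)\<^sup>2) \<le> 0"
    using linear_flow_nonincreasing[of w, OF d assms(1)] by simp
  moreover have "(w t j)\<^sup>2 \<le> (\<Sum>j<N. (w t j)\<^sup>2)"
    using assms(2) by (intro member_le_sum) auto
  ultimately have "(w t j)\<^sup>2 \<le> 0" by linarith
  then have "exp (- t / lam k) * c t j k = (\<Sum>l<N. Phi t j l * c 0 l k)" by (simp add: w_def)
  then have "exp (t / lam k) * (exp (- t / lam k) * c t j k) = exp (t / lam k) * (\<Sum>l<N. Phi t j l * c 0 l k)"
    by simp
  then show ?thesis by (simp add: exp_minus field_simps)
qed

text \<open>With D = P - I, the product Phi D(0) Phi^T solves the matrix equation of D and starts at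
  D(0) because Phi starts at I; the difference has nonincreasing Frobenius norm.\<close>

lemma defect_formula:
  assumes "t \<ge> 0" "i < N" "j < N"
  shows "P t i j - delta i j = (\<Sum>p<N. \<Sum>q<N. Phi t i p * (P 0 p q - delta p q) * Phi t j q)"
proof -
  define S where "S t i j = (\<Sum>p<N. \<Sum>q<N. Phi t i p * (P 0 p q - delta p q) * Phi t j q)" for t i j
  define M where "M t i j = P t i j - delta i j - S t i j" for t i j
  have dS: "((\<lambda>t. S t i j) has_real_derivative
      - (\<Sum>l<N. B t l i * S t l j) - (\<Sum>l<N. S t i l * B t l j)) (at t within {0..})"
    if t: "t \<ge> 0" and ij: "i < N" "j < N" for t i j
  proof -
    have "((\<lambda>t. S t i j) has_real_derivative
      (\<Sum>p<N. \<Sum>q<N. - (\<Sum>l<N. B t l i * Phi t l p) * (P 0 p q - delta p q) * Phi t j q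
        + - (\<Sum>l<N. B t l j * Phi t l q) * (Phi t i p * (P 0 p q - delta p q)))) (at t within {0..})"
      unfolding S_def by (intro DERIV_sum DERIV_mult DERIV_cmult_right Phi_deriv t ij)
    also have "(\<Sum>p<N. \<Sum>q<N. - (\<Sum>l<N. B t l i * Phi t l p) * (P 0 p q - delta p q) * Phi t j q
        + - (\<Sum>l<N. B t l j * Phi t l q) * (Phi t i p * (P 0 p q - delta p q)))
      = - (\<Sum>p<N. \<Sum>q<N. \<Sum>l<N. B t l i * (Phi t l p * (P 0 p q - delta p q) * Phi t j q))
        - (\<Sum>p<N. \<Sum>q<N. \<Sum>l<N. (Phi t i p * (P 0 p q - delta p q) * Phi t l q) * B t l j)"
      by (simp only: sum.distrib sum_distrib_right sum_negf mult_minus_left mult.assoc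
          diff_conv_add_uminus mult.commute[of _ "B t _ j"] mult.left_commute[of _ "B t _ j"])
        (simp add: ac_simps)
    also have "(\<Sum>p<N. \<Sum>q<N. \<Sum>l<N. B t l i * (Phi t l p * (P 0 p q - delta p q) * Phi t j q))
       = (\<Sum>l<N. B t l i * S t l j)"
      unfolding S_def sum_distrib_left by (rule sum_rotate3[symmetric])
    also have "(\<Sum>p<N. \<Sum>q<N. \<Sum>l<N. (Phi t i p * (P 0 p q - delta p q) * Phi t l q) * B t l j)
       = (\<Sum>l<N. S t i l * B t l j)"
      unfolding S_def sum_distrib_right by (rule sum_rotate3[symmetric])
    finally show ?thesis .
  qed
  have dM: "((\<lambda>t. M t i j) has_real_derivative
      - (\<Sum>l<N. B t l i * M t l j) - (\<Sum>l<N. M t i l * B t l j)) (at t within {0..})"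
    if t: "t \<ge> 0" and ij: "i < N" "j < N" for t i j
  proof -
    have "((\<lambda>t. M t i j) has_real_derivative
      (- (\<Sum>l<N. B t l i * (P t l j - delta l j)) - (\<Sum>l<N. (P t i l - delta i l) * B t l j))
       - (- (\<Sum>l<N. B t l i * S t l j) - (\<Sum>l<N. S t i l * B t l j))) (at t within {0..})"
      unfolding M_def by (intro DERIV_diff[OF defect_deriv dS] t ij)
    also have "(- (\<Sum>l<N. B t l i * (P t l j - delta l j)) - (\<Sum>l<N. (P t i l - delta i l) * B t l j))
       - (- (\<Sum>l<N. B t l i * S t l j) - (\<Sum>l<N. S t i l * B t l j))
      = - (\<Sum>l<N. B t l i * M t l j) - (\<Sum>l<N. M t i l * B t l j)"
      unfolding M_def right_diff_distrib[of _ _ "S t _ _"] left_diff_distrib[of _ "S t _ _"] sum_subtractf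
      by simp
    finally show ?thesis .
  qed
  have "M 0 i j = 0" if ij: "i < N" "j < N" for i j
  proof -
    have "S 0 i j = (\<Sum>p<N. \<Sum>q<N. delta i p * (P 0 p q - delta p q) * delta j q)"
      unfolding S_def by (intro sum.cong refl) (simp only: Phi_0 ij lessThan_iff)
    also have "\<dots> = (\<Sum>p<N. delta i p * (P 0 p j - delta p j))"
      by (rule sum.cong[OF refl], rule sum_delta_mult(3)[OF ij(2)])
    also have "\<dots> = P 0 i j - delta i j" by (rule sum_delta_mult(1)[OF ij(1)])
    finally show ?thesis by (simp add: M_def)
  qed
  then have "(\<Sum>i<N. \<Sum>j<N. (M t i j)\<^sup>2) \<le> 0"
    using matrix_flow_nonincreasing[of M, OF dM assms(1)] by simp
  moreover have "(M t i j)\<^sup>2 \<le> (\<Sum>j<N. (M t i j)\<^sup>2)" using assms by (intro member_le_sum) auto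
  moreover have "\<dots> \<le> (\<Sum>i<N. \<Sum>j<N. (M t i j)\<^sup>2)"
    using assms by (intro member_le_sum[of i _ "\<lambda>i. \<Sum>j<N. (M t i j)\<^sup>2"]) (auto intro: sum_nonneg)
  ultimately have "(M t i j)\<^sup>2 \<le> 0" by linarith
  then show ?thesis by (simp add: M_def S_def)
qed

end

context oja_coefficients
begin

section \<open>Exponential decay of the defect and of the high modes\<close>

lemma exp_small_Phi:
  assumes "j < N"
  shows "exp_small (\<lambda>t. Phi t j l)"
proof -
  have "exp_small (\<lambda>t. c t j i * exp (- t / lam i) * A i l)" for i
    using exp_small_mult_bdd(1)[OF exp_small_mult_bdd(2)[OF exp_small_exp[of "1 / lam i"] c_bdd[OF assms, of i]]
        bdd_time_const[of "A i l"]] lam_gt0[of i] by simp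
  then show ?thesis unfolding Phi_def by (intro exp_small_sum)
qed

lemma exp_small_defect:
  assumes "i < N" "j < N"
  shows "exp_small (\<lambda>t. P t i j - delta i j)"
proof (rule exp_small_cong[OF _ defect_formula])
  show "exp_small (\<lambda>t. \<Sum>p<N. \<Sum>q<N. Phi t i p * (P 0 p q - delta p q) * Phi t j q)"
    by (intro exp_small_sum exp_small_mult_bdd(1)[OF exp_small_mult_bdd(1)] exp_small_Phi
        bdd_time_const exp_small_imp_bdd assms)
qed (use assms in auto)

definition tail :: "real \<Rightarrow> nat \<Rightarrow> real" where
  "tail t j = (\<Sum>k. lam (k + N) * (c t j (k + N))\<^sup>2)"

lemma tail_summable: "t \<ge> 0 \<Longrightarrow> j < N \<Longrightarrow> summable (\<lambda>k. lam (k + N) * (c t j (k + N))\<^sup>2)"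
  using a_summable summable_iff_shift[of "\<lambda>k. lam k * (c t j k)\<^sup>2" N] by blast

lemma tail_nonneg: "t \<ge> 0 \<Longrightarrow> j < N \<Longrightarrow> tail t j \<ge> 0"
  unfolding tail_def by (intro suminf_nonneg tail_summable) (auto simp: lam_gt0 less_imp_le)

text \<open>Inserting Phi into the formula for x_k gives X(t) diag(exp(t (1/lam k - 1/lam i))) z_k
  with z_k = A x_k(0). For i < N <= k every exponent is at most -g t. Cauchy-Schwarz yields a bound
  that depends on k only through |z_k|^2, and these numbers are summable against lam k because the
  initial data have finite energy.\<close>

lemma exp_small_tail:
  assumes j: "j < N"
  shows "exp_small (\<lambda>t. tail t j)"
proof -
  define z where "z i k = (\<Sum>l<N. A i l * c 0 l k)" for i k
  \<comment> \<open>The decay rate is the gap between the reciprocal eigenvalues on the two sides of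
    index N.\<close>
  define g where "g = 1 / lam (N - 1) - 1 / lam N"
  have "g > 0" using gap lam_gt0[of "N - 1"] by (simp add: g_def field_simps)
  have formula: "c t j k = (\<Sum>i<N. c t j i * (exp (t * (1 / lam k - 1 / lam i)) * z i k))" if "t \<ge> 0" for t k
  proof -
    have "c t j k = exp (t / lam k) * (\<Sum>l<N. \<Sum>i<N. c t j i * exp (- t / lam i) * A i l * c 0 l k)"
      using coefficient_formula[OF that j, of k] by (simp add: Phi_def sum_distrib_right)
    also have "(\<Sum>l<N. \<Sum>i<N. c t j i * exp (- t / lam i) * A i l * c 0 l k)
        = (\<Sum>i<N. c t j i * exp (- t / lam i) * z i k)"
      by (subst sum.swap) (simp add: z_def sum_distrib_left mult.assoc)
    also have "exp (t / lam k) * \<dots> = (\<Sum>i<N. c t j i * (exp (t * (1 / lam k - 1 / lam i)) * z i k))"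
    proof -
      have "exp (t * (1 / lam k - 1 / lam i)) = exp (t / lam k) * exp (- t / lam i)" for i
        by (simp add: right_diff_distrib flip: exp_add)
      then show ?thesis by (simp add: sum_distrib_left ac_simps)
    qed
    finally show ?thesis .
  qed
  have le: "(c t j (k + N))\<^sup>2 \<le> P t j j * exp (- (2 * g) * t) * (\<Sum>i<N. (z i (k + N))\<^sup>2)"
    if t: "t \<ge> 0" for t k
  proof -
    have P0: "P t j j \<ge> 0" using head_le_P[OF t j, of 0] by simp
    have "(c t j (k + N))\<^sup>2 \<le> (\<Sum>i<N. (c t j i)\<^sup>2)
        * (\<Sum>i<N. (exp (t * (1 / lam (k + N) - 1 / lam i)) * z i (k + N))\<^sup>2)"
      by (subst formula[OF t]) (rule Cauchy_Schwarz_ineq_sum)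
    also have "\<dots> \<le> P t j j * (\<Sum>i<N. exp (- (2 * g) * t) * (z i (k + N))\<^sup>2)"
    proof (intro mult_mono head_le_P t j sum_mono sum_nonneg P0)
      fix i assume "i \<in> {..<N}"
      then have "lam i \<le> lam (N - 1)" "lam N \<le> lam (k + N)" using lam_mono by (auto simp: monoD)
      then have "1 / lam (N - 1) \<le> 1 / lam i" "1 / lam (k + N) \<le> 1 / lam N"
        using lam_gt0 by (auto intro!: divide_left_mono)
      then have "1 / lam (k + N) - 1 / lam i \<le> - g" by (simp add: g_def)
      then have "t * (1 / lam (k + N) - 1 / lam i) \<le> t * (- g)" using t by (intro mult_left_mono)
      then have "(exp (t * (1 / lam (k + N) - 1 / lam i)))\<^sup>2 \<le> (exp (t * (- g)))\<^sup>2"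
        by (intro power_mono) auto
      also have "(exp (t * (- g)))\<^sup>2 = exp (- (2 * g) * t)" by (simp add: ac_simps flip: exp_double)
      finally show "(exp (t * (1 / lam (k + N) - 1 / lam i)) * z i (k + N))\<^sup>2
          \<le> exp (- (2 * g) * t) * (z i (k + N))\<^sup>2"
        by (simp add: power_mult_distrib mult_right_mono)
    qed auto
    finally show ?thesis by (simp add: sum_distrib_left mult.assoc)
  qed
  \<comment> \<open>z is a fixed linear image of the initial coefficients and inherits their
    weighted summability.\<close>
  have zs: "summable (\<lambda>k. lam (k + N) * (z i (k + N))\<^sup>2)" for i
  proof (rule suminf_tail_dominated(1))
    show "summable (\<lambda>k. (\<Sum>l<N. (A i l)\<^sup>2) * (\<Sum>l<N. lam (k + N) * (c 0 l (k + N))\<^sup>2))"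
      by (intro summable_mult summable_sum tail_summable) auto
    show "\<bar>lam (k + N) * (z i (k + N))\<^sup>2\<bar> \<le> (\<Sum>l<N. (A i l)\<^sup>2) * (\<Sum>l<N. lam (k + N) * (c 0 l (k + N))\<^sup>2)" for k
    proof -
      have "(z i (k + N))\<^sup>2 \<le> (\<Sum>l<N. (A i l)\<^sup>2) * (\<Sum>l<N. (c 0 l (k + N))\<^sup>2)"
        unfolding z_def by (rule Cauchy_Schwarz_ineq_sum)
      then have "lam (k + N) * (z i (k + N))\<^sup>2 \<le> lam (k + N) * ((\<Sum>l<N. (A i l)\<^sup>2) * (\<Sum>l<N. (c 0 l (k + N))\<^sup>2))"
        using lam_gt0[of "k + N"] by (intro mult_left_mono) auto
      moreover have "lam (k + N) * (z i (k + N))\<^sup>2 \<ge> 0" using lam_gt0[of "k + N"] by simp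
      ultimately show ?thesis by (simp add: mult.left_commute mult.assoc flip: sum_distrib_left)
    qed
  qed
  define K where "K = (\<Sum>k. \<Sum>i<N. lam (k + N) * (z i (k + N))\<^sup>2)"
  have Ks: "summable (\<lambda>k. \<Sum>i<N. lam (k + N) * (z i (k + N))\<^sup>2)" by (intro summable_sum zs)
  show ?thesis
  proof (rule exp_small_dominated)
    show "exp_small (\<lambda>t. P t j j * exp (- (2 * g) * t) * K)"
      using \<open>g > 0\<close> by (intro exp_small_mult_bdd(1)[OF exp_small_mult_bdd(2)] exp_small_exp P_bdd j bdd_time_const) auto
    fix t :: real assume t: "t \<ge> 0"
    have "tail t j \<le> (\<Sum>k. P t j j * exp (- (2 * g) * t) * (\<Sum>i<N. lam (k + N) * (z i (k + N))\<^sup>2))"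
      unfolding tail_def
    proof (rule suminf_le[OF _ tail_summable[OF t j] summable_mult[OF Ks]])
      fix k
      have "lam (k + N) * (c t j (k + N))\<^sup>2
          \<le> lam (k + N) * (P t j j * exp (- (2 * g) * t) * (\<Sum>i<N. (z i (k + N))\<^sup>2))"
        using lam_gt0[of "k + N"] by (intro mult_left_mono le t) auto
      then show "lam (k + N) * (c t j (k + N))\<^sup>2
          \<le> P t j j * exp (- (2 * g) * t) * (\<Sum>i<N. lam (k + N) * (z i (k + N))\<^sup>2)"
        by (simp add: mult.left_commute mult.assoc flip: sum_distrib_left)
    qed
    also have "\<dots> = P t j j * exp (- (2 * g) * t) * K"
      unfolding K_def by (rule suminf_mult[OF Ks])
    finally show "\<bar>tail t j\<bar> \<le> P t j j * exp (- (2 * g) * t) * K" using tail_nonneg[OF t j] by simp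
  qed
qed

text \<open>Estimating |c_i c_j| by (c_i^2 + c_j^2) / 2 and |w k| by W lam k bounds the discarded
  series by W / 2 times the two tails. It is meant for w = 1, giving P, and w = 1 / lam k, giving B;
  both are dominated by a multiple of lam k since all eigenvalues are at least \<open>lam 0\<close>
  > 0.\<close>

lemma exp_small_weighted_remainder:
  assumes ij: "i < N" "j < N"
    and S: "\<And>t. t \<ge> 0 \<Longrightarrow> (\<lambda>k. w k * (c t i k * c t j k)) sums S t"
    and w: "\<And>k. \<bar>w k\<bar> \<le> W * lam k"
  shows "exp_small (\<lambda>t. S t - (\<Sum>k<N. w k * (c t i k * c t j k)))"
proof (rule exp_small_dominated)
  show "exp_small (\<lambda>t. W / 2 * (tail t i + tail t j))"
    by (intro exp_small_cmult exp_small_add exp_small_tail ij)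
  fix t :: real assume t: "t \<ge> 0"
  have "(\<lambda>k. w (k + N) * (c t i (k + N) * c t j (k + N))) sums (S t - (\<Sum>k<N. w k * (c t i k * c t j k)))"
    using S[OF t] by (rule sums_split_initial_segment)
  then have eq: "S t - (\<Sum>k<N. w k * (c t i k * c t j k)) = (\<Sum>k. w (k + N) * (c t i (k + N) * c t j (k + N)))"
    by (simp add: sums_iff)
  have "\<bar>\<Sum>k. w (k + N) * (c t i (k + N) * c t j (k + N))\<bar>
     \<le> (\<Sum>k. W / 2 * (lam (k + N) * (c t i (k + N))\<^sup>2 + lam (k + N) * (c t j (k + N))\<^sup>2))"
  proof (rule suminf_tail_dominated(2))
    show "summable (\<lambda>k. W / 2 * (lam (k + N) * (c t i (k + N))\<^sup>2 + lam (k + N) * (c t j (k + N))\<^sup>2))"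
      by (intro summable_mult summable_add tail_summable t ij)
    fix k
    have "\<bar>c t i (k + N) * c t j (k + N)\<bar> \<le> ((c t i (k + N))\<^sup>2 + (c t j (k + N))\<^sup>2) / 2"
      using sum_squares_bound[of "\<bar>c t i (k + N)\<bar>" "\<bar>c t j (k + N)\<bar>"] by (simp add: abs_mult)
    then have "\<bar>w (k + N)\<bar> * \<bar>c t i (k + N) * c t j (k + N)\<bar>
        \<le> (W * lam (k + N)) * (((c t i (k + N))\<^sup>2 + (c t j (k + N))\<^sup>2) / 2)"
      using w[of "k + N"] abs_ge_zero[of "w (k + N)"] by (intro mult_mono w) linarith+
    also have "\<dots> = W / 2 * (lam (k + N) * (c t i (k + N))\<^sup>2 + lam (k + N) * (c t j (k + N))\<^sup>2)"
      by (simp add: algebra_simps)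
    finally show "\<bar>w (k + N) * (c t i (k + N) * c t j (k + N))\<bar>
        \<le> W / 2 * (lam (k + N) * (c t i (k + N))\<^sup>2 + lam (k + N) * (c t j (k + N))\<^sup>2)"
      by (simp only: abs_mult)
  qed
  also have "\<dots> = W / 2 * (tail t i + tail t j)"
    unfolding tail_def
    by (subst suminf_mult) (auto intro!: summable_add tail_summable t ij simp: suminf_add tail_summable[OF t] ij)
  finally show "\<bar>S t - (\<Sum>k<N. w k * (c t i k * c t j k))\<bar> \<le> W / 2 * (tail t i + tail t j)"
    unfolding eq .
qed

text \<open>Both P - I and the contribution of the modes k >= N to P are exponentially
  small.\<close>

lemma exp_small_row_gram:
  assumes "i < N" "j < N"
  shows "exp_small (\<lambda>t. (\<Sum>k<N. c t i k * c t j k) - delta i j)"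
proof -
  have "exp_small (\<lambda>t. P t i j - (\<Sum>k<N. 1 * (c t i k * c t j k)))"
  proof (rule exp_small_weighted_remainder[OF assms])
    show "(\<lambda>k. 1 * (c t i k * c t j k)) sums P t i j" if "t \<ge> 0" for t
      using P_sums[OF that assms] by simp
    show "\<bar>1\<bar> \<le> (1 / lam 0) * lam k" for k using lam_ge[of k] lam_pos by (simp add: field_simps)
  qed
  from exp_small_diff[OF exp_small_defect[OF assms] this] show ?thesis by simp
qed

text \<open>The Frobenius identity compares sums of squares over all entries, so the square of a
  single entry is estimated and a root is taken, at the price of half the rate.\<close>

lemma exp_small_column_gram:
  assumes "m < N" "k < N"
  shows "exp_small (\<lambda>t. (\<Sum>i<N. c t i m * c t i k) - delta m k)"
proof (rule exp_small_of_square, rule exp_small_dominated)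
  show "exp_small (\<lambda>t. \<Sum>i<N. \<Sum>j<N. ((\<Sum>k<N. c t i k * c t j k) - delta i j)\<^sup>2)"
    unfolding power2_eq_square
    by (intro exp_small_sum exp_small_mult_bdd(1) exp_small_imp_bdd exp_small_row_gram) auto
  fix t :: real
  have "((\<Sum>i<N. c t i m * c t i k) - delta m k)\<^sup>2 \<le> (\<Sum>k<N. ((\<Sum>i<N. c t i m * c t i k) - delta m k)\<^sup>2)"
    using assms by (intro member_le_sum) auto
  also have "\<dots> \<le> (\<Sum>m<N. \<Sum>k<N. ((\<Sum>i<N. c t i m * c t i k) - delta m k)\<^sup>2)"
    using assms by (intro member_le_sum[of m _ "\<lambda>m. \<Sum>k<N. ((\<Sum>i<N. c t i m * c t i k) - delta m k)\<^sup>2"])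
      (auto intro: sum_nonneg)
  also have "\<dots> = (\<Sum>i<N. \<Sum>j<N. ((\<Sum>k<N. c t i k * c t j k) - delta i j)\<^sup>2)"
    by (rule frobenius_gram_transpose[symmetric])
  finally show "\<bar>((\<Sum>i<N. c t i m * c t i k) - delta m k)\<^sup>2\<bar>
      \<le> (\<Sum>i<N. \<Sum>j<N. ((\<Sum>k<N. c t i k * c t j k) - delta i j)\<^sup>2)" by simp
qed

section \<open>The velocity of the coefficients\<close>

lemma B_remainder:
  assumes "i < N" "j < N"
  shows "exp_small (\<lambda>t. B t i j - (\<Sum>m<N. 1 / lam m * (c t i m * c t j m)))"
proof (rule exp_small_weighted_remainder[OF assms])
  show "(\<lambda>k. 1 / lam k * (c t i k * c t j k)) sums B t i j" if "t \<ge> 0" for t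
    using B_sums[OF that assms] by simp
  show "\<bar>1 / lam k\<bar> \<le> (1 / (lam 0)\<^sup>2) * lam k" for k
  proof -
    have "(lam 0)\<^sup>2 \<le> (lam k)\<^sup>2" using lam_ge[of k] lam_pos by (intro power_mono) auto
    then show ?thesis using lam_gt0[of k] lam_pos by (simp add: field_simps power2_eq_square)
  qed
qed

lemma B_bdd:
  assumes "i < N" "j < N"
  shows "bdd_time (\<lambda>t. B t i j)"
proof -
  have "bdd_time (\<lambda>t. (B t i j - (\<Sum>m<N. 1 / lam m * (c t i m * c t j m)))
      + (\<Sum>m<N. 1 / lam m * (c t i m * c t j m)))"
    by (intro bdd_time_add exp_small_imp_bdd[OF B_remainder] bdd_time_sum bdd_time_mult bdd_time_const c_bdd assms)
  then show ?thesis by simp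
qed

text \<open>These numbers are at once the time derivatives of the coefficients and the coefficients
  of the gradient field. The first role gives convergence of the flow, the second the vanishing of
  its gradient.\<close>

definition dc :: "real \<Rightarrow> nat \<Rightarrow> nat \<Rightarrow> real" where
  "dc t j k = c t j k / lam k - (\<Sum>i<N. B t i j * c t i k)"

text \<open>With B replaced by its low-mode part X Lambda^-1 X^T, the velocity of X becomes -X
  Lambda^-1 (X^T X - I): the column Gram matrix appears, not the row one. The second sum is the
  error of this replacement.\<close>

lemma exp_small_dc:
  assumes j: "j < N" and k: "k < N"
  shows "exp_small (\<lambda>t. dc t j k)"
proof -
  have "dc t j k = (\<Sum>m<N. - c t j m / lam m * ((\<Sum>i<N. c t i m * c t i k) - delta m k))
      - (\<Sum>i<N. (B t i j - (\<Sum>m<N. 1 / lam m * (c t i m * c t j m))) * c t i k)" for t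
  proof -
    have "(\<Sum>m<N. - c t j m / lam m * ((\<Sum>i<N. c t i m * c t i k) - delta m k))
        = (\<Sum>m<N. c t j m / lam m * delta m k) - (\<Sum>m<N. \<Sum>i<N. c t j m / lam m * (c t i m * c t i k))"
      by (simp only: minus_divide_left[symmetric] right_diff_distrib mult_minus_left sum_subtractf sum_negf
          sum_distrib_left)
    also have "(\<Sum>m<N. c t j m / lam m * delta m k) = c t j k / lam k"
      by (rule sum_delta_mult(4)[OF k])
    also have "(\<Sum>m<N. \<Sum>i<N. c t j m / lam m * (c t i m * c t i k))
        = (\<Sum>i<N. (\<Sum>m<N. 1 / lam m * (c t i m * c t j m)) * c t i k)"
      by (subst sum.swap) (simp add: sum_distrib_right sum_distrib_left ac_simps)
    finally show ?thesis
      by (simp only: dc_def left_diff_distrib sum_subtractf)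
  qed
  moreover have "exp_small (\<lambda>t. (\<Sum>m<N. - c t j m / lam m * ((\<Sum>i<N. c t i m * c t i k) - delta m k))
      - (\<Sum>i<N. (B t i j - (\<Sum>m<N. 1 / lam m * (c t i m * c t j m))) * c t i k))"
  proof (intro exp_small_diff exp_small_sum)
    fix m assume "m \<in> {..<N}"
    then show "exp_small (\<lambda>t. - c t j m / lam m * ((\<Sum>i<N. c t i m * c t i k) - delta m k))"
      using exp_small_cmult[OF exp_small_mult_bdd(2)[OF exp_small_column_gram[OF _ k, of m] c_bdd[OF j, of m]],
          of "- 1 / lam m"] by simp
  next
    fix i assume "i \<in> {..<N}"
    then show "exp_small (\<lambda>t. (B t i j - (\<Sum>m<N. 1 / lam m * (c t i m * c t j m))) * c t i k)"
      using j by (intro exp_small_mult_bdd(1) B_remainder c_bdd) auto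
  qed
  ultimately show ?thesis by simp
qed

text \<open>For k >= N the two terms of \<open>dc\<close> need not cancel: each consists of
  coefficients beyond N and is controlled by \<open>tail\<close>. The factors 2 come from (x - y)^2
  <= 2 x^2 + 2 y^2.\<close>

lemma dc_energy:
  assumes "t \<ge> 0" "j < N"
  shows "summable (\<lambda>k. lam k * (dc t j k)\<^sup>2)"
    and "\<bar>\<Sum>k. lam (k + N) * (dc t j (k + N))\<^sup>2\<bar>
      \<le> 2 / (lam 0)\<^sup>2 * tail t j + 2 * (\<Sum>i<N. (B t i j)\<^sup>2) * (\<Sum>i<N. tail t i)"
proof -
  define h where "h k = 2 / (lam 0)\<^sup>2 * (lam k * (c t j k)\<^sup>2)
      + 2 * (\<Sum>i<N. (B t i j)\<^sup>2) * (\<Sum>i<N. lam k * (c t i k)\<^sup>2)" for k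
  have le: "\<bar>lam k * (dc t j k)\<^sup>2\<bar> \<le> h k" for k
  proof -
    have "(dc t j k)\<^sup>2 \<le> 2 * (c t j k / lam k)\<^sup>2 + 2 * (\<Sum>i<N. B t i j * c t i k)\<^sup>2"
      unfolding dc_def using sum_squares_bound[of "c t j k / lam k" "- (\<Sum>i<N. B t i j * c t i k)"]
      by (simp add: power2_diff)
    also have "\<dots> \<le> 2 * ((c t j k)\<^sup>2 / (lam 0)\<^sup>2) + 2 * ((\<Sum>i<N. (B t i j)\<^sup>2) * (\<Sum>i<N. (c t i k)\<^sup>2))"
    proof (intro add_mono mult_left_mono Cauchy_Schwarz_ineq_sum)
      have "(lam 0)\<^sup>2 \<le> (lam k)\<^sup>2" using lam_ge[of k] lam_pos by (intro power_mono) auto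
      then show "(c t j k / lam k)\<^sup>2 \<le> (c t j k)\<^sup>2 / (lam 0)\<^sup>2"
        using lam_pos lam_gt0[of k] by (simp add: power_divide frac_le)
    qed auto
    finally have "lam k * (dc t j k)\<^sup>2
       \<le> lam k * (2 * ((c t j k)\<^sup>2 / (lam 0)\<^sup>2) + 2 * ((\<Sum>i<N. (B t i j)\<^sup>2) * (\<Sum>i<N. (c t i k)\<^sup>2)))"
      using lam_gt0[of k] by (intro mult_left_mono) auto
    also have "\<dots> = h k"
      by (simp add: h_def sum_distrib_left[of "lam k", symmetric] distrib_left ac_simps)
    finally show ?thesis using lam_gt0[of k] by (simp add: abs_mult)
  qed
  have "summable h"
    unfolding h_def by (intro summable_add summable_mult summable_sum a_summable assms) auto
  then show "summable (\<lambda>k. lam k * (dc t j k)\<^sup>2)"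
    by (rule suminf_tail_dominated(1)[OF _ le])
  have sums: "(\<lambda>k. h (k + N)) sums (2 / (lam 0)\<^sup>2 * tail t j + 2 * (\<Sum>i<N. (B t i j)\<^sup>2) * (\<Sum>i<N. tail t i))"
    unfolding h_def tail_def
    by (intro sums_add sums_mult sums_sum summable_sums tail_summable assms) auto
  show "\<bar>\<Sum>k. lam (k + N) * (dc t j (k + N))\<^sup>2\<bar>
      \<le> 2 / (lam 0)\<^sup>2 * tail t j + 2 * (\<Sum>i<N. (B t i j)\<^sup>2) * (\<Sum>i<N. tail t i)"
    using suminf_tail_dominated(2)[OF sums_summable[OF sums], of "\<lambda>k. lam (k + N) * (dc t j (k + N))\<^sup>2"]
      le sums_unique[OF sums] by simp
qed

lemma energy_dc_tendsto_0:
  assumes j: "j < N"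
  shows "((\<lambda>t. \<Sum>k. lam k * (dc t j k)\<^sup>2) \<longlongrightarrow> 0) at_top"
proof (rule exp_small_tendsto_0, rule exp_small_cong)
  show "exp_small (\<lambda>t. (\<Sum>k. lam (k + N) * (dc t j (k + N))\<^sup>2) + (\<Sum>k<N. lam k * (dc t j k)\<^sup>2))"
  proof (rule exp_small_add)
    show "exp_small (\<lambda>t. \<Sum>k. lam (k + N) * (dc t j (k + N))\<^sup>2)"
    proof (rule exp_small_dominated[OF _ dc_energy(2)[OF _ j]])
      show "exp_small (\<lambda>t. 2 / (lam 0)\<^sup>2 * tail t j + 2 * (\<Sum>i<N. (B t i j)\<^sup>2) * (\<Sum>i<N. tail t i))"
        unfolding power2_eq_square[of "B _ _ _"]
        by (intro exp_small_add exp_small_cmult exp_small_tail exp_small_mult_bdd(2) exp_small_sum bdd_time_mult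
            bdd_time_const bdd_time_sum B_bdd j) (use j in auto)
    qed
    show "exp_small (\<lambda>t. \<Sum>k<N. lam k * (dc t j k)\<^sup>2)"
      unfolding power2_eq_square
      by (intro exp_small_sum exp_small_cmult exp_small_mult_bdd(1) exp_small_imp_bdd exp_small_dc) (use j in auto)
  qed
  show "(\<Sum>k. lam k * (dc t j k)\<^sup>2) = (\<Sum>k. lam (k + N) * (dc t j (k + N))\<^sup>2) + (\<Sum>k<N. lam k * (dc t j k)\<^sup>2)"
    if "t \<ge> 0" for t
    by (rule suminf_split_initial_segment[OF dc_energy(1)[OF that j]])
qed

text \<open>Each low coefficient has an exponentially small derivative and hence a limit;
  orthogonality of q is the limit of the row Gram estimate. The row \<open>q j\<close>, extended by
  0, lists the coefficients of the j-th limit function.\<close>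

theorem coefficients_converge:
  obtains q :: mat where
    "\<And>i j. i < N \<Longrightarrow> j < N \<Longrightarrow> (\<Sum>k<N. q i k * q j k) = delta i j"
    "\<And>j. j < N \<Longrightarrow> ((\<lambda>t. \<Sum>k. lam k * (c t j k - (if k < N then q j k else 0))\<^sup>2) \<longlongrightarrow> 0) at_top"
    "\<And>j. j < N \<Longrightarrow> ((\<lambda>t. \<Sum>k. lam k * (c t j k)\<^sup>2) \<longlongrightarrow> (\<Sum>k<N. lam k * (q j k)\<^sup>2)) at_top"
proof -
  have "\<exists>l. ((\<lambda>t. c t j k) \<longlongrightarrow> l) at_top" if "j < N" "k < N" for j k
    using exp_small_derivative_imp_convergent[of "\<lambda>t. c t j k" "\<lambda>t. dc t j k"] c_deriv exp_small_dc that
    by (simp add: dc_def)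
  then obtain q where q: "\<And>j k. j < N \<Longrightarrow> k < N \<Longrightarrow> ((\<lambda>t. c t j k) \<longlongrightarrow> q j k) at_top" by metis
  show thesis
  proof
    fix i j assume ij: "i < N" "j < N"
    have "((\<lambda>t. (\<Sum>k<N. c t i k * c t j k) - delta i j) \<longlongrightarrow> (\<Sum>k<N. q i k * q j k) - delta i j) at_top"
      using ij by (intro tendsto_diff tendsto_sum tendsto_mult q tendsto_const) auto
    moreover have "((\<lambda>t. (\<Sum>k<N. c t i k * c t j k) - delta i j) \<longlongrightarrow> 0) at_top"
      by (rule exp_small_tendsto_0[OF exp_small_row_gram[OF ij]])
    ultimately have "(\<Sum>k<N. q i k * q j k) - delta i j = 0"
      using tendsto_unique trivial_limit_at_top_linorder by blast
    then show "(\<Sum>k<N. q i k * q j k) = delta i j" by simp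
  next
    fix j assume j: "j < N"
    \<comment> \<open>A general target p covers both remaining claims: p = \<open>q j\<close> for
      the distance and p = 0 for the energy.\<close>
    have split: "((\<lambda>t. \<Sum>k. lam k * (c t j k - (if k < N then p k else 0))\<^sup>2)
        \<longlongrightarrow> (\<Sum>k<N. lam k * (q j k - p k)\<^sup>2)) at_top" for p :: "nat \<Rightarrow> real"
    proof -
      have "((\<lambda>t. tail t j + (\<Sum>k<N. lam k * (c t j k - p k)\<^sup>2)) \<longlongrightarrow> 0 + (\<Sum>k<N. lam k * (q j k - p k)\<^sup>2)) at_top"
        using j by (intro tendsto_add exp_small_tendsto_0 exp_small_tail tendsto_sum tendsto_mult tendsto_power
            tendsto_diff q tendsto_const) auto
      moreover have "\<forall>\<^sub>F t in at_top. tail t j + (\<Sum>k<N. lam k * (c t j k - p k)\<^sup>2)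
          = (\<Sum>k. lam k * (c t j k - (if k < N then p k else 0))\<^sup>2)"
        unfolding eventually_at_top_linorder
      proof (intro exI[of _ 0] allI impI)
        fix t :: real assume t: "t \<ge> 0"
        let ?h = "\<lambda>k. lam k * (c t j k - (if k < N then p k else 0))\<^sup>2"
        have "summable ?h"
          using tail_summable[OF t j] summable_iff_shift[of ?h N] by simp
        from suminf_split_initial_segment[OF this, of N]
        show "tail t j + (\<Sum>k<N. lam k * (c t j k - p k)\<^sup>2) = suminf ?h"
          by (simp add: tail_def)
      qed
      ultimately show ?thesis by (simp add: tendsto_cong)
    qed
    show "((\<lambda>t. \<Sum>k. lam k * (c t j k - (if k < N then q j k else 0))\<^sup>2) \<longlongrightarrow> 0) at_top"
      using split[of "q j"] by simp
    show "((\<lambda>t. \<Sum>k. lam k * (c t j k)\<^sup>2) \<longlongrightarrow> (\<Sum>k<N. lam k * (q j k)\<^sup>2)) at_top"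
      using split[of "\<lambda>_. 0"] by simp
  qed
qed

end

subsection \<open>Semi-inner products on spaces of functions\<close>

text \<open>For a semidefinite form the leading coefficient c may vanish; a nonnegative affine
  function is constant, so then b = 0. Large t excludes c < 0, and for c > 0 the minimum at t = -b /
  c gives the claim.\<close>

lemma nonneg_quadratic_imp_discriminant:
  fixes a b c :: real
  assumes "\<And>t. a + 2 * b * t + c * t\<^sup>2 \<ge> 0"
  shows "b\<^sup>2 \<le> a * c"
proof (cases "c = 0")
  case True
  have "b = 0"
  proof (rule ccontr)
    assume "b \<noteq> 0"
    then have "a + 2 * b * (- (a + 1) / (2 * b)) = -1" by (simp add: field_simps)
    then show False using assms[of "- (a + 1) / (2 * b)"] True by simp
  qed
  then show ?thesis using True by simp
next
  case False
  have "c \<ge> 0"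
  proof (rule ccontr)
    assume "\<not> c \<ge> 0"
    define t where "t = (\<bar>a\<bar> + 2 * \<bar>b\<bar> + 1) / (- c) + 1"
    have "t \<ge> 1" using \<open>\<not> c \<ge> 0\<close> by (simp add: t_def divide_nonneg_neg)
    have "c * t = - (\<bar>a\<bar> + 2 * \<bar>b\<bar> + 1) + c" using False by (simp add: t_def field_simps)
    then have ct: "c * t < - (\<bar>a\<bar> + 2 * \<bar>b\<bar>)" using \<open>\<not> c \<ge> 0\<close> by linarith
    have "a + 2 * b * t + c * t\<^sup>2 \<le> \<bar>a\<bar> * t + 2 * \<bar>b\<bar> * t + (c * t) * t"
    proof -
      have "a \<le> \<bar>a\<bar> * t" using \<open>t \<ge> 1\<close> mult_left_mono[of 1 t "\<bar>a\<bar>"] by simp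
      moreover have "2 * b * t \<le> 2 * \<bar>b\<bar> * t" using \<open>t \<ge> 1\<close> by (intro mult_right_mono) auto
      ultimately show ?thesis by (simp add: power2_eq_square)
    qed
    also have "\<dots> = (\<bar>a\<bar> + 2 * \<bar>b\<bar> + c * t) * t" by (simp add: algebra_simps)
    also have "\<dots> < 0" using ct \<open>t \<ge> 1\<close> by (intro mult_neg_pos) auto
    finally show False using assms[of t] by simp
  qed
  with False have "c > 0" by simp
  have "0 \<le> (a + 2 * b * (- b / c) + c * (- b / c)\<^sup>2) * c"
    using assms[of "- b / c"] \<open>c > 0\<close> by (intro mult_nonneg_nonneg) auto
  also have "\<dots> = a * c - b\<^sup>2" using \<open>c > 0\<close> by (simp add: field_simps power2_eq_square)
  finally show ?thesis by simp
qed

text \<open>Elements are functions and not classes, so a function of norm zero need not vanish and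
  only semidefiniteness is asked for. The codomain is a general vector space in order to cover
  scalar functions and gradient fields alike; convergence is expressed by forms of
  differences.\<close>

locale semi_inner =
  fixes S :: "('x \<Rightarrow> 'b::real_vector) set" and ip :: "('x \<Rightarrow> 'b) \<Rightarrow> ('x \<Rightarrow> 'b) \<Rightarrow> real"
  assumes zero_mem: "(\<lambda>_. 0) \<in> S"
    and add_mem: "f \<in> S \<Longrightarrow> g \<in> S \<Longrightarrow> (\<lambda>x. f x + g x) \<in> S"
    and scale_mem: "f \<in> S \<Longrightarrow> (\<lambda>x. r *\<^sub>R f x) \<in> S"
    and ip_sym: "f \<in> S \<Longrightarrow> g \<in> S \<Longrightarrow> ip f g = ip g f"
    and ip_add: "f \<in> S \<Longrightarrow> g \<in> S \<Longrightarrow> h \<in> S \<Longrightarrow> ip (\<lambda>x. f x + g x) h = ip f h + ip g h"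
    and ip_scale: "f \<in> S \<Longrightarrow> h \<in> S \<Longrightarrow> ip (\<lambda>x. r *\<^sub>R f x) h = r * ip f h"
    and ip_nonneg: "f \<in> S \<Longrightarrow> ip f f \<ge> 0"
begin

lemma diff_mem: "f \<in> S \<Longrightarrow> g \<in> S \<Longrightarrow> (\<lambda>x. f x - g x) \<in> S"
  using add_mem[of f "\<lambda>x. (- 1) *\<^sub>R g x"] scale_mem[of g "- 1"] by simp

lemma ip_diff: "f \<in> S \<Longrightarrow> g \<in> S \<Longrightarrow> h \<in> S \<Longrightarrow> ip (\<lambda>x. f x - g x) h = ip f h - ip g h"
  using ip_add[of f "\<lambda>x. (- 1) *\<^sub>R g x" h] ip_scale[of g h "- 1"] scale_mem[of g "- 1"] by simp

lemma ip_add_right: "f \<in> S \<Longrightarrow> g \<in> S \<Longrightarrow> h \<in> S \<Longrightarrow> ip h (\<lambda>x. f x + g x) = ip h f + ip h g"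
  using ip_add[of f g h] ip_sym add_mem by metis

lemma ip_scale_right: "f \<in> S \<Longrightarrow> h \<in> S \<Longrightarrow> ip h (\<lambda>x. r *\<^sub>R f x) = r * ip h f"
  using ip_scale[of f h r] ip_sym scale_mem by metis

lemma ip_diff_right: "f \<in> S \<Longrightarrow> g \<in> S \<Longrightarrow> h \<in> S \<Longrightarrow> ip h (\<lambda>x. f x - g x) = ip h f - ip h g"
  using ip_diff[of f g h] ip_sym diff_mem by metis

lemma ip_zero: "h \<in> S \<Longrightarrow> ip (\<lambda>_. 0) h = 0"
  using ip_scale[OF zero_mem, of h 0] by simp

lemma lincomb_mem:
  assumes "\<And>i. i \<in> I \<Longrightarrow> f i \<in> S"
  shows "(\<lambda>x. \<Sum>i\<in>I. r i *\<^sub>R f i x) \<in> S"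
  using assms
proof (induction I rule: infinite_finite_induct)
  case (insert i I)
  then show ?case
    using add_mem[of "\<lambda>x. r i *\<^sub>R f i x" "\<lambda>x. \<Sum>i\<in>I. r i *\<^sub>R f i x"] scale_mem[of "f i" "r i"] by simp
qed (simp_all add: zero_mem)

lemma ip_lincomb:
  assumes "\<And>i. i \<in> I \<Longrightarrow> f i \<in> S" "h \<in> S"
  shows "ip (\<lambda>x. \<Sum>i\<in>I. r i *\<^sub>R f i x) h = (\<Sum>i\<in>I. r i * ip (f i) h)"
  using assms
  by (induction I rule: infinite_finite_induct)
    (auto simp: ip_zero ip_add ip_scale lincomb_mem scale_mem)

lemma ip_lincomb_right:
  assumes "\<And>i. i \<in> I \<Longrightarrow> f i \<in> S" "h \<in> S"
  shows "ip h (\<lambda>x. \<Sum>i\<in>I. r i *\<^sub>R f i x) = (\<Sum>i\<in>I. r i * ip h (f i))"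
proof -
  have "ip h (\<lambda>x. \<Sum>i\<in>I. r i *\<^sub>R f i x) = ip (\<lambda>x. \<Sum>i\<in>I. r i *\<^sub>R f i x) h"
    by (rule ip_sym[OF assms(2) lincomb_mem[OF assms(1)]])
  also have "\<dots> = (\<Sum>i\<in>I. r i * ip (f i) h)" by (rule ip_lincomb[OF assms])
  finally show ?thesis using ip_sym[OF assms(2,1)] by (simp cong: sum.cong)
qed

lemma ip_square_add:
  assumes "f \<in> S" "g \<in> S"
  shows "ip (\<lambda>x. f x + r *\<^sub>R g x) (\<lambda>x. f x + r *\<^sub>R g x) = ip f f + 2 * ip f g * r + ip g g * r\<^sup>2"
  using assms ip_sym[OF assms]
  by (simp add: ip_add ip_add_right ip_scale ip_scale_right add_mem scale_mem power2_eq_square algebra_simps)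

lemma Cauchy_Schwarz_square: "f \<in> S \<Longrightarrow> g \<in> S \<Longrightarrow> (ip f g)\<^sup>2 \<le> ip f f * ip g g"
  by (rule nonneg_quadratic_imp_discriminant)
    (simp add: ip_square_add[symmetric] ip_nonneg add_mem scale_mem)

lemma Cauchy_Schwarz: "f \<in> S \<Longrightarrow> g \<in> S \<Longrightarrow> \<bar>ip f g\<bar> \<le> sqrt (ip f f) * sqrt (ip g g)"
  using real_sqrt_le_mono[OF Cauchy_Schwarz_square[of f g]] by (simp add: real_sqrt_mult)

text \<open>This substitutes for passing to the quotient: adding a null function to an argument
  changes no pairing.\<close>

lemma null_imp_ip_eq_0: "f \<in> S \<Longrightarrow> g \<in> S \<Longrightarrow> ip f f = 0 \<Longrightarrow> ip f g = 0"
  using Cauchy_Schwarz_square[of f g] by simp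

lemma square_add_le:
  assumes "f \<in> S" "g \<in> S"
  shows "ip (\<lambda>x. f x + g x) (\<lambda>x. f x + g x) \<le> 2 * ip f f + 2 * ip g g"
  using ip_square_add[OF assms, of 1] ip_square_add[OF assms, of "-1"]
    ip_nonneg[OF diff_mem[OF assms]] by simp

lemma square_diff_commute:
  assumes "f \<in> S" "g \<in> S"
  shows "ip (\<lambda>x. f x - g x) (\<lambda>x. f x - g x) = ip (\<lambda>x. g x - f x) (\<lambda>x. g x - f x)"
  using assms ip_sym[OF assms] by (simp add: ip_diff ip_diff_right diff_mem)

lemma square_diff_le:
  assumes "f \<in> S" "g \<in> S" "h \<in> S"
  shows "ip (\<lambda>x. f x - h x) (\<lambda>x. f x - h x)
     \<le> 2 * ip (\<lambda>x. f x - g x) (\<lambda>x. f x - g x) + 2 * ip (\<lambda>x. g x - h x) (\<lambda>x. g x - h x)"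
  using square_add_le[OF diff_mem[OF assms(1,2)] diff_mem[OF assms(2,3)]] by simp

text \<open>The difference of the pairings splits into (f - u, g - v), (f - u, v) and (u, g - v),
  each estimated by Cauchy-Schwarz. Membership is eventual because a curve on a half-line lies in S
  only at admissible times.\<close>

lemma ip_tendsto:
  assumes mem: "\<forall>\<^sub>F n in F. f n \<in> S" "\<forall>\<^sub>F n in F. g n \<in> S" "u \<in> S" "v \<in> S"
    and f: "((\<lambda>n. ip (\<lambda>x. f n x - u x) (\<lambda>x. f n x - u x)) \<longlongrightarrow> 0) F"
    and g: "((\<lambda>n. ip (\<lambda>x. g n x - v x) (\<lambda>x. g n x - v x)) \<longlongrightarrow> 0) F"
  shows "((\<lambda>n. ip (f n) (g n)) \<longlongrightarrow> ip u v) F"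
proof -
  define p where "p n = sqrt (ip (\<lambda>x. f n x - u x) (\<lambda>x. f n x - u x))" for n
  define q where "q n = sqrt (ip (\<lambda>x. g n x - v x) (\<lambda>x. g n x - v x))" for n
  have pq: "(p \<longlongrightarrow> 0) F" "(q \<longlongrightarrow> 0) F"
    unfolding p_def q_def using tendsto_real_sqrt[OF f] tendsto_real_sqrt[OF g] by simp_all
  have "((\<lambda>n. p n * q n + p n * sqrt (ip v v) + sqrt (ip u u) * q n) \<longlongrightarrow> 0 * 0 + 0 * sqrt (ip v v) + sqrt (ip u u) * 0) F"
    by (intro tendsto_intros pq)
  then have lim: "((\<lambda>n. p n * q n + p n * sqrt (ip v v) + sqrt (ip u u) * q n) \<longlongrightarrow> 0) F" by simp
  have "\<forall>\<^sub>F n in F. norm (ip (f n) (g n) - ip u v) \<le> p n * q n + p n * sqrt (ip v v) + sqrt (ip u u) * q n"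
    using mem(1,2)
  proof eventually_elim
    case (elim n)
    have "ip (f n) (g n) - ip u v
        = ip (\<lambda>x. f n x - u x) (\<lambda>x. g n x - v x) + ip (\<lambda>x. f n x - u x) v + ip u (\<lambda>x. g n x - v x)"
      using elim mem(3,4) by (simp add: ip_diff ip_diff_right diff_mem)
    then show ?case
      using Cauchy_Schwarz[OF diff_mem[OF elim(1) mem(3)] diff_mem[OF elim(2) mem(4)]]
        Cauchy_Schwarz[OF diff_mem[OF elim(1) mem(3)] mem(4)]
        Cauchy_Schwarz[OF mem(3) diff_mem[OF elim(2) mem(4)]]
      unfolding p_def q_def by simp
  qed
  from Lim_null_comparison[OF this lim] show ?thesis by (rule LIM_zero_cancel)
qed

lemma lincomb_tendsto:
  assumes mem: "\<And>n. f n \<in> S" "\<And>n. g n \<in> S" "u \<in> S" "v \<in> S"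
    and f: "((\<lambda>n. ip (\<lambda>x. f n x - u x) (\<lambda>x. f n x - u x)) \<longlongrightarrow> 0) F"
    and g: "((\<lambda>n. ip (\<lambda>x. g n x - v x) (\<lambda>x. g n x - v x)) \<longlongrightarrow> 0) F"
  shows "((\<lambda>n. ip (\<lambda>x. (r *\<^sub>R f n x + s *\<^sub>R g n x) - (r *\<^sub>R u x + s *\<^sub>R v x))
      (\<lambda>x. (r *\<^sub>R f n x + s *\<^sub>R g n x) - (r *\<^sub>R u x + s *\<^sub>R v x))) \<longlongrightarrow> 0) F"
proof (rule Lim_null_comparison)
  let ?d = "\<lambda>n x. (r *\<^sub>R f n x + s *\<^sub>R g n x) - (r *\<^sub>R u x + s *\<^sub>R v x)"
  let ?p = "\<lambda>n. ip (\<lambda>x. f n x - u x) (\<lambda>x. f n x - u x)"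
  let ?q = "\<lambda>n. ip (\<lambda>x. g n x - v x) (\<lambda>x. g n x - v x)"
  show "((\<lambda>n. 2 * (r * (r * ?p n)) + 2 * (s * (s * ?q n))) \<longlongrightarrow> 0) F"
    by (intro tendsto_add_zero tendsto_mult_right_zero f g)
  show "\<forall>\<^sub>F n in F. norm (ip (?d n) (?d n)) \<le> 2 * (r * (r * ?p n)) + 2 * (s * (s * ?q n))"
  proof (rule always_eventually, rule allI)
    fix n
    have d: "?d n = (\<lambda>x. r *\<^sub>R (f n x - u x) + s *\<^sub>R (g n x - v x))" by (simp add: algebra_simps)
    have m: "(\<lambda>x. f n x - u x) \<in> S" "(\<lambda>x. g n x - v x) \<in> S" by (intro diff_mem mem)+
    note rs = scale_mem[OF m(1), of r] scale_mem[OF m(2), of s]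
    show "norm (ip (?d n) (?d n)) \<le> 2 * (r * (r * ?p n)) + 2 * (s * (s * ?q n))"
      unfolding d using square_add_le[OF rs] ip_nonneg[OF add_mem[OF rs]]
      by (simp only: ip_scale ip_scale_right m rs real_norm_def abs_of_nonneg)
  qed
qed

text \<open>The product rule, from (u s, v s) - (u t, v t) = (u s - u t, v s) + (u t, v s - v t).
  The set T admits one-sided derivatives at the initial time.\<close>

lemma ip_has_derivative:
  assumes mem: "\<And>s. s \<in> T \<Longrightarrow> u s \<in> S" "\<And>s. s \<in> T \<Longrightarrow> v s \<in> S" "p \<in> S" "q \<in> S" and t: "t \<in> T"
    and u: "((\<lambda>s. ip (\<lambda>x. (1 / (s - t)) *\<^sub>R (u s x - u t x) - p x)
        (\<lambda>x. (1 / (s - t)) *\<^sub>R (u s x - u t x) - p x)) \<longlongrightarrow> 0) (at t within T)"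
    and v: "((\<lambda>s. ip (\<lambda>x. (1 / (s - t)) *\<^sub>R (v s x - v t x) - q x)
        (\<lambda>x. (1 / (s - t)) *\<^sub>R (v s x - v t x) - q x)) \<longlongrightarrow> 0) (at t within T)"
  shows "((\<lambda>s. ip (u s) (v s)) has_real_derivative ip p (v t) + ip (u t) q) (at t within T)"
proof -
  define du where "du s = (\<lambda>x. (1 / (s - t)) *\<^sub>R (u s x - u t x))" for s
  define dv where "dv s = (\<lambda>x. (1 / (s - t)) *\<^sub>R (v s x - v t x))" for s
  have u': "((\<lambda>s. ip (\<lambda>x. du s x - p x) (\<lambda>x. du s x - p x)) \<longlongrightarrow> 0) (at t within T)"
    and v': "((\<lambda>s. ip (\<lambda>x. dv s x - q x) (\<lambda>x. dv s x - q x)) \<longlongrightarrow> 0) (at t within T)"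
    using u v by (simp_all only: du_def dv_def)
  have duS: "du s \<in> S" if "s \<in> T" for s unfolding du_def by (intro scale_mem diff_mem mem that t)
  have dvS: "dv s \<in> S" if "s \<in> T" for s unfolding dv_def by (intro scale_mem diff_mem mem that t)
  have ev: "\<forall>\<^sub>F s in at t within T. s \<in> T" "\<forall>\<^sub>F s in at t within T. s \<noteq> t"
    by (auto simp: eventually_at_filter)
  have evS: "\<forall>\<^sub>F s in at t within T. du s \<in> S" "\<forall>\<^sub>F s in at t within T. dv s \<in> S"
      "\<forall>\<^sub>F s in at t within T. v s \<in> S"
    by (rule eventually_mono[OF ev(1)], simp add: duS dvS mem)+
  have dv_sq: "((\<lambda>s. ip (dv s) (dv s)) \<longlongrightarrow> ip q q) (at t within T)"
    by (rule ip_tendsto[OF evS(2,2) mem(4,4) v' v'])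
  \<comment> \<open>Continuity of v at t: the squared distance is (s - t)^2 times the form of the
    difference quotient, which converges.\<close>
  have "((\<lambda>s. (s - t)\<^sup>2 * ip (dv s) (dv s)) \<longlongrightarrow> (t - t)\<^sup>2 * ip q q) (at t within T)"
    by (intro tendsto_intros dv_sq)
  then have "((\<lambda>s. (s - t)\<^sup>2 * ip (dv s) (dv s)) \<longlongrightarrow> 0) (at t within T)" by simp
  moreover have "\<forall>\<^sub>F s in at t within T. (s - t)\<^sup>2 * ip (dv s) (dv s) = ip (\<lambda>x. v s x - v t x) (\<lambda>x. v s x - v t x)"
    using ev
  proof eventually_elim
    case (elim s)
    have d: "(\<lambda>x. v s x - v t x) \<in> S" by (intro diff_mem mem elim t)
    have "ip (dv s) (dv s) = (1 / (s - t)) * ((1 / (s - t)) * ip (\<lambda>x. v s x - v t x) (\<lambda>x. v s x - v t x))"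
      unfolding dv_def by (simp only: ip_scale ip_scale_right d scale_mem)
    then show ?case using elim(2) by (simp add: power2_eq_square)
  qed
  ultimately have v_cont: "((\<lambda>s. ip (\<lambda>x. v s x - v t x) (\<lambda>x. v s x - v t x)) \<longlongrightarrow> 0) (at t within T)"
    by (rule Lim_transform_eventually)
  have "((\<lambda>s. ip (du s) (v s)) \<longlongrightarrow> ip p (v t)) (at t within T)"
    by (rule ip_tendsto[OF evS(1,3) mem(3) mem(2)[OF t] u' v_cont])
  moreover have "((\<lambda>s. ip (u t) (dv s)) \<longlongrightarrow> ip (u t) q) (at t within T)"
    by (rule ip_tendsto[OF _ evS(2) mem(1)[OF t] mem(4) _ v']) (simp_all add: mem t ip_zero zero_mem)
  ultimately have "((\<lambda>s. ip (du s) (v s) + ip (u t) (dv s)) \<longlongrightarrow> ip p (v t) + ip (u t) q) (at t within T)"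
    by (rule tendsto_add)
  moreover have "\<forall>\<^sub>F s in at t within T. ip (du s) (v s) + ip (u t) (dv s) = (ip (u s) (v s) - ip (u t) (v t)) / (s - t)"
    using ev
  proof eventually_elim
    case (elim s)
    have "ip (du s) (v s) = (1 / (s - t)) * (ip (u s) (v s) - ip (u t) (v s))"
      "ip (u t) (dv s) = (1 / (s - t)) * (ip (u t) (v s) - ip (u t) (v t))"
      unfolding du_def dv_def
      using elim(1) t by (simp_all only: ip_scale ip_scale_right ip_diff ip_diff_right diff_mem mem)
    then show ?case using elim(2) by (simp add: field_simps)
  qed
  ultimately show ?thesis
    unfolding has_field_derivative_iff by (rule Lim_transform_eventually)
qed

end

subsection \<open>Eigenfunction expansions\<close>

text \<open>The abstract form of H_0^1 with its L2 product L and its energy form a. By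
  \<open>null\<close> the energy does not see L-null functions, so a family that is total for L
  determines a as well; completeness refers to a.\<close>

locale spectral_pair = L: semi_inner H L + a: semi_inner H a
  for H :: "('x \<Rightarrow> real) set" and L a +
  fixes K :: real and e :: "nat \<Rightarrow> 'x \<Rightarrow> real" and lam :: "nat \<Rightarrow> real"
  assumes poincare: "u \<in> H \<Longrightarrow> L u u \<le> K * a u u"
    and null: "u \<in> H \<Longrightarrow> L u u = 0 \<Longrightarrow> a u u = 0"
    and complete: "\<And>u :: nat \<Rightarrow> 'x \<Rightarrow> real. (\<And>n. u n \<in> H) \<Longrightarrow>
        (\<And>\<epsilon>. \<epsilon> > 0 \<Longrightarrow> \<exists>n0. \<forall>m\<ge>n0. \<forall>n\<ge>n0. a (\<lambda>x. u m x - u n x) (\<lambda>x. u m x - u n x) < \<epsilon>) \<Longrightarrow>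
        \<exists>w\<in>H. (\<lambda>n. a (\<lambda>x. u n x - w x) (\<lambda>x. u n x - w x)) \<longlonglongrightarrow> 0"
    and e_mem: "e k \<in> H"
    and e_eig: "v \<in> H \<Longrightarrow> a (e k) v = lam k * L (e k) v"
    and e_on: "L (e j) (e k) = (if j = k then 1 else 0)"
    and total: "u \<in> H \<Longrightarrow> (\<And>k. L u (e k) = 0) \<Longrightarrow> L u u = 0"
begin

lemmas lincomb_mem = L.lincomb_mem[unfolded real_scaleR_def]
lemmas L_lincomb = L.ip_lincomb[unfolded real_scaleR_def]
lemmas a_lincomb = a.ip_lincomb[unfolded real_scaleR_def]
lemmas a_lincomb_right = a.ip_lincomb_right[unfolded real_scaleR_def]

lemma K_lam: "1 \<le> K * lam k"
  using poincare[OF e_mem[of k]] e_eig[OF e_mem, of k k] by (simp add: e_on)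

lemma lam_pos: "lam k > 0" and K_pos: "K > 0"
proof -
  have "lam k \<ge> 0" for k using a.ip_nonneg[OF e_mem[of k]] e_eig[OF e_mem, of k k] by (simp add: e_on)
  then show "lam k > 0" "K > 0"
    using K_lam[of k] by (metis (no_types, lifting) less_eq_real_def mult_zero_right not_one_le_zero,
      metis (no_types) mult_nonpos_nonneg not_le not_one_le_zero order_trans)
qed

lemma a_eig_right: "v \<in> H \<Longrightarrow> a v (e k) = lam k * L v (e k)"
  using e_eig a.ip_sym L.ip_sym e_mem by metis

lemma a_null: "u \<in> H \<Longrightarrow> v \<in> H \<Longrightarrow> L u u = 0 \<Longrightarrow> a u v = 0"
  using null a.null_imp_ip_eq_0 by blast

abbreviation psum :: "(nat \<Rightarrow> real) \<Rightarrow> nat \<Rightarrow> 'x \<Rightarrow> real" where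
  "psum r n \<equiv> (\<lambda>x. \<Sum>k<n. r k * e k x)"

lemma psum_mem: "psum r n \<in> H" by (rule lincomb_mem[OF e_mem])

lemma a_lincomb_e: 
  assumes "finite I"
  shows "a (\<lambda>x. \<Sum>k\<in>I. r k * e k x) (\<lambda>x. \<Sum>k\<in>I. r k * e k x) = (\<Sum>k\<in>I. lam k * (r k)\<^sup>2)"
proof -
  have "a (\<lambda>x. \<Sum>k\<in>I. r k * e k x) (\<lambda>x. \<Sum>k\<in>I. r k * e k x)
      = (\<Sum>k\<in>I. r k * (\<Sum>l\<in>I. r l * a (e k) (e l)))"
    by (simp add: a_lincomb a_lincomb_right e_mem lincomb_mem)
  also have "\<dots> = (\<Sum>k\<in>I. \<Sum>l\<in>I. if k = l then r k * r l * lam k else 0)"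
    by (auto simp: e_eig[OF e_mem] e_on sum_distrib_left intro!: sum.cong)
  also have "\<dots> = (\<Sum>k\<in>I. lam k * (r k)\<^sup>2)"
    using assms by (auto simp: power2_eq_square intro!: sum.cong)
  finally show ?thesis .
qed

text \<open>The eigenfunctions are orthogonal for a too, so the partial sums are Cauchy in energy.
  Their limit is unique only up to null functions and is therefore described by its
  pairings.\<close>

lemma expansion_exists:
  assumes "summable (\<lambda>k. lam k * (r k)\<^sup>2)"
  shows "\<exists>w\<in>H. (\<forall>v\<in>H. (\<lambda>k. r k * L (e k) v) sums L w v \<and> (\<lambda>k. lam k * r k * L (e k) v) sums a w v)"
proof -
  have diff: "a (\<lambda>x. psum r m x - psum r n x) (\<lambda>x. psum r m x - psum r n x) = (\<Sum>k=n..<m. lam k * (r k)\<^sup>2)"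
    if "n \<le> m" for m n
  proof -
    have "psum r m x - psum r n x = (\<Sum>k=n..<m. r k * e k x)" for x
      using that sum_diff_nat_ivl[of 0 n m "\<lambda>k. r k * e k x"] by (simp add: atLeast0LessThan)
    then show ?thesis using a_lincomb_e[of "{n..<m}" r] by simp
  qed
  have cauchy: "\<exists>n0. \<forall>m\<ge>n0. \<forall>n\<ge>n0. a (\<lambda>x. psum r m x - psum r n x) (\<lambda>x. psum r m x - psum r n x) < \<epsilon>"
    if "\<epsilon> > 0" for \<epsilon>
  proof -
    obtain n0 where n0: "\<And>m n. m \<ge> n0 \<Longrightarrow> \<bar>\<Sum>k=m..<n. lam k * (r k)\<^sup>2\<bar> < \<epsilon>"
      using assms \<open>\<epsilon> > 0\<close> unfolding summable_Cauchy real_norm_def by blast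
    have "a (\<lambda>x. psum r m x - psum r n x) (\<lambda>x. psum r m x - psum r n x) < \<epsilon>" if "m \<ge> n0" "n \<ge> n0" for m n
      using n0[of n m] n0[of m n] that diff[of n m] diff[of m n] a.square_diff_commute[OF psum_mem psum_mem, of r m r n]
      by (cases "n \<le> m") auto
    then show ?thesis by blast
  qed
  obtain w where w: "w \<in> H" "(\<lambda>n. a (\<lambda>x. psum r n x - w x) (\<lambda>x. psum r n x - w x)) \<longlonglongrightarrow> 0"
    using complete[of "psum r"] psum_mem cauchy by blast
  have wL: "(\<lambda>n. L (\<lambda>x. psum r n x - w x) (\<lambda>x. psum r n x - w x)) \<longlonglongrightarrow> 0"
  proof (rule Lim_null_comparison)
    have mem: "(\<lambda>x. psum r n x - w x) \<in> H" for n by (rule L.diff_mem[OF psum_mem w(1)])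
    show "\<forall>\<^sub>F n in sequentially. norm (L (\<lambda>x. psum r n x - w x) (\<lambda>x. psum r n x - w x))
        \<le> K * a (\<lambda>x. psum r n x - w x) (\<lambda>x. psum r n x - w x)"
      using poincare[OF mem] L.ip_nonneg[OF mem] by simp
    show "(\<lambda>n. K * a (\<lambda>x. psum r n x - w x) (\<lambda>x. psum r n x - w x)) \<longlonglongrightarrow> 0"
      using tendsto_mult_right_zero[OF w(2)] by simp
  qed
  have "(\<lambda>k. r k * L (e k) v) sums L w v \<and> (\<lambda>k. lam k * r k * L (e k) v) sums a w v" if v: "v \<in> H" for v
  proof -
    have "(\<lambda>n. L (psum r n) v) \<longlonglongrightarrow> L w v"
      by (rule L.ip_tendsto[OF _ _ w(1) v wL]) (simp_all add: psum_mem v L.ip_zero L.zero_mem)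
    moreover have "(\<lambda>n. a (psum r n) v) \<longlonglongrightarrow> a w v"
      by (rule a.ip_tendsto[OF _ _ w(1) v w(2)]) (simp_all add: psum_mem v a.ip_zero a.zero_mem)
    ultimately show ?thesis
      using v e_mem unfolding sums_def
      by (simp add: L_lincomb a_lincomb e_eig mult.assoc mult.left_commute)
  qed
  with w(1) show ?thesis by blast
qed

lemma Bessel:
  assumes "u \<in> H"
  shows "(\<Sum>k<n. lam k * (L u (e k))\<^sup>2) \<le> a u u"
proof -
  let ?r = "\<lambda>k. L u (e k)"
  have "a u (psum ?r n) = (\<Sum>k<n. lam k * (?r k)\<^sup>2)"
    using a_lincomb_right[of "{..<n}" e u ?r] e_mem assms
    by (simp add: a_eig_right power2_eq_square ac_simps)
  moreover have "a (psum ?r n) u = a u (psum ?r n)" by (rule a.ip_sym[OF psum_mem assms])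
  moreover have "a (\<lambda>x. u x - psum ?r n x) (\<lambda>x. u x - psum ?r n x)
      = a u u - a u (psum ?r n) - (a (psum ?r n) u - a (psum ?r n) (psum ?r n))"
    using assms psum_mem[of ?r n] by (simp add: a.ip_diff a.ip_diff_right a.diff_mem)
  moreover have "a (\<lambda>x. u x - psum ?r n x) (\<lambda>x. u x - psum ?r n x) \<ge> 0"
    by (rule a.ip_nonneg[OF a.diff_mem[OF assms psum_mem]])
  ultimately show ?thesis using a_lincomb_e[of "{..<n}" ?r] by simp
qed

text \<open>By Bessel the series of u defines an element w. All coefficients of u - w vanish, so it
  is L-null by totality and a-null by \<open>null\<close>, and w may be replaced by u in both
  forms.\<close>

lemma Parseval:
  assumes u: "u \<in> H" and v: "v \<in> H"
  shows "(\<lambda>k. L u (e k) * L v (e k)) sums L u v"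
    and "(\<lambda>k. lam k * (L u (e k) * L v (e k))) sums a u v"
proof -
  let ?r = "\<lambda>k. L u (e k)"
  have "summable (\<lambda>k. lam k * (?r k)\<^sup>2)"
    by (rule bounded_imp_summable[of _ "a u u"])
      (use Bessel[OF u] lam_pos in \<open>auto simp: less_imp_le lessThan_Suc_atMost[symmetric] simp del: sum.lessThan_Suc\<close>)
  then obtain w where w: "w \<in> H" "\<And>v. v \<in> H \<Longrightarrow> (\<lambda>k. ?r k * L (e k) v) sums L w v"
    "\<And>v. v \<in> H \<Longrightarrow> (\<lambda>k. lam k * ?r k * L (e k) v) sums a w v"
    using expansion_exists[of "\<lambda>k. L u (e k)"] by blast
  have we: "L w (e k) = ?r k" for k
  proof -
    have "(\<lambda>j. ?r j * L (e j) (e k)) sums ?r k"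
      using sums_single[of k ?r] by (simp add: e_on if_distrib cong: if_cong)
    then show ?thesis using w(2)[OF e_mem] sums_unique2 by blast
  qed
  have d: "(\<lambda>x. u x - w x) \<in> H" by (rule L.diff_mem[OF u w(1)])
  have null: "L (\<lambda>x. u x - w x) (\<lambda>x. u x - w x) = 0"
    by (rule total[OF d]) (simp add: L.ip_diff u w(1) e_mem we)
  have "L u v = L w v" "a u v = a w v"
    using L.null_imp_ip_eq_0[OF d v null] a_null[OF d v null] u v w(1) by (simp_all add: L.ip_diff a.ip_diff)
  then show "(\<lambda>k. L u (e k) * L v (e k)) sums L u v" "(\<lambda>k. lam k * (L u (e k) * L v (e k))) sums a u v"
    using w(2,3)[OF v] L.ip_sym[OF v e_mem] by (simp_all add: mult.assoc)
qed

text \<open>The solution is given by its coefficients, those of f divided by lam k. It has finite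
  energy because 1 / lam k is bounded by the Poincare constant K.\<close>

lemma Riesz:
  assumes f: "f \<in> H"
  shows "\<exists>g\<in>H. \<forall>v\<in>H. a g v = L f v"
proof -
  define r where "r k = L f (e k) / lam k" for k
  have "summable (\<lambda>k. K * (L f (e k))\<^sup>2)"
    using sums_summable[OF Parseval(1)[OF f f]] by (intro summable_mult) (simp add: power2_eq_square)
  moreover have "norm (lam k * (r k)\<^sup>2) \<le> K * (L f (e k))\<^sup>2" for k
  proof -
    have "lam k * (r k)\<^sup>2 = 1 / lam k * (L f (e k))\<^sup>2"
      using lam_pos[of k] by (simp add: r_def power2_eq_square)
    also have "\<dots> \<le> K * (L f (e k))\<^sup>2"
      using K_lam[of k] lam_pos[of k] by (intro mult_right_mono) (auto simp: field_simps)
    finally show ?thesis using lam_pos[of k] by simp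
  qed
  ultimately have "summable (\<lambda>k. lam k * (r k)\<^sup>2)"
    by (rule summable_comparison_test'[of _ 0])
  then obtain g where g: "g \<in> H" "\<And>v. v \<in> H \<Longrightarrow> (\<lambda>k. lam k * r k * L (e k) v) sums a g v"
    using expansion_exists by blast
  have "a g v = L f v" if v: "v \<in> H" for v
  proof -
    have "lam k * r k * L (e k) v = L f (e k) * L v (e k)" for k
      using lam_pos[of k] L.ip_sym[OF v e_mem] by (simp add: r_def)
    then show ?thesis using g(2)[OF v] Parseval(1)[OF f v] sums_unique2 by simp
  qed
  with g(1) show ?thesis by blast
qed

text \<open>A complete eigenfamily need not begin with the prescribed eigenfunctions. Orthogonality
  across the gap confines each \<open>v i\<close> to the span of the \<open>e k\<close> with k < N,
  up to null functions; the transition matrix R is then orthogonal and the two spans agree.\<close>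

lemma replace_low_eigenfunctions:
  assumes gap: "\<And>i k. i < N \<Longrightarrow> N \<le> k \<Longrightarrow> lam i < lam k"
    and v_mem: "\<And>i. i < N \<Longrightarrow> v i \<in> H"
    and v_eig: "\<And>i w. i < N \<Longrightarrow> w \<in> H \<Longrightarrow> a (v i) w = lam i * L (v i) w"
    and v_on: "\<And>i j. i < N \<Longrightarrow> j < N \<Longrightarrow> L (v i) (v j) = (if i = j then 1 else 0)"
  shows "spectral_pair H L a K (\<lambda>k. if k < N then v k else e k) lam"
proof -
  define R where "R i k = L (v i) (e k)" for i k
  have orth: "R i k = 0" if "i < N" "N \<le> k" for i k
  proof -
    have "lam i * R i k = lam k * R i k"
      using v_eig[OF that(1) e_mem, of k] a_eig_right[OF v_mem[OF that(1)], of k] by (simp only: R_def)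
    then show ?thesis using gap[OF that] by simp
  qed
  have rows: "(\<Sum>k<N. R i k * R j k) = delta i j" if "i < N" "j < N" for i j
  proof -
    have "(\<lambda>k. R i k * R j k) sums (\<Sum>k<N. R i k * R j k)"
      by (rule sums_finite) (use orth that in auto)
    then show ?thesis
      using Parseval(1)[OF v_mem[OF that(1)] v_mem[OF that(2)]] v_on[OF that] sums_unique2 unfolding R_def by metis
  qed
  have cols: "(\<Sum>i<N. R i k * R i l) = delta k l" if "k < N" "l < N" for k l
    by (rule orthonormal_rows_imp_columns[OF rows that])
  have span: "L u (e k) = (\<Sum>i<N. R i k * L u (v i))" if "u \<in> H" "k < N" for u k
  proof -
    \<comment> \<open>The candidate for \<open>e k\<close>: both functions have norm one and pair to
      one, so their difference has square 1 - 2 + 1 = 0.\<close>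
    define f where "f = (\<lambda>x. \<Sum>i<N. R i k * v i x)"
    have f: "f \<in> H" unfolding f_def using v_mem by (intro lincomb_mem) auto
    have Lf: "L f w = (\<Sum>i<N. R i k * L (v i) w)" if "w \<in> H" for w
      unfolding f_def using v_mem that by (intro L_lincomb) auto
    have fe: "L f (e k) = 1" using Lf[OF e_mem, of k] cols[OF that(2) that(2)] by (simp add: R_def)
    have fv: "L (v j) f = R j k" if "j < N" for j
    proof -
      have "L (v j) f = L f (v j)" by (rule L.ip_sym[OF v_mem[OF that] f])
      also have "\<dots> = (\<Sum>i<N. R i k * (if i = j then 1 else 0))"
        using v_on that by (simp add: Lf[OF v_mem[OF that]])
      also have "\<dots> = R j k" using sum_delta_mult(4)[OF that] by simp
      finally show ?thesis .
    qed
    have ff: "L f f = 1"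
      using Lf[OF f] fv cols[OF that(2) that(2)] by simp
    have d: "(\<lambda>x. e k x - f x) \<in> H" by (rule L.diff_mem[OF e_mem f])
    have "L (\<lambda>x. e k x - f x) (\<lambda>x. e k x - f x) = 0"
      using L.ip_sym[OF f e_mem, of k] by (simp add: L.ip_diff L.ip_diff_right e_mem f d ff fe e_on)
    from L.null_imp_ip_eq_0[OF d that(1) this] have "L (e k) u = L f u"
      by (simp add: L.ip_diff e_mem f that(1))
    then show ?thesis
      using Lf[OF that(1)] L.ip_sym[OF that(1) e_mem, of k] L.ip_sym[OF that(1) v_mem] by simp
  qed
  show ?thesis
  proof
    let ?e = "\<lambda>k. if k < N then v k else e k"
    fix u assume u: "u \<in> H" "\<And>k. L u (?e k) = 0"
    have "L u (v i) = 0" if "i < N" for i using u(2)[of i] that by simp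
    then have "L u (e k) = 0" for k
      using span[OF u(1), of k] u(2)[of k] by (cases "k < N") auto
    then show "L u u = 0" by (rule total[OF u(1)])
  next
    fix j k
    show "L (if j < N then v j else e j) (if k < N then v k else e k) = (if j = k then 1 else 0)"
      using orth[of j k] orth[of k j] v_on[of j k] e_on[of j k] L.ip_sym[OF e_mem v_mem, of k j]
      by (auto simp: R_def)
  qed (use poincare null complete e_mem e_eig v_mem v_eig in auto)
qed

end

subsection \<open>Square-integrable functions\<close>

definition L2fun :: "'x measure \<Rightarrow> ('x \<Rightarrow> 'b::euclidean_space) set" where
  "L2fun M = {f. f \<in> borel_measurable M \<and> integrable M (\<lambda>x. (norm (f x))\<^sup>2)}"

lemma L2fun_dominated:
  fixes f :: "'x \<Rightarrow> 'b::euclidean_space"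
  assumes "f \<in> borel_measurable M" "integrable M g" "\<And>x. (norm (f x))\<^sup>2 \<le> g x"
  shows "f \<in> L2fun M"
proof -
  have "integrable M (\<lambda>x. (norm (f x))\<^sup>2)"
    by (rule Bochner_Integration.integrable_bound[OF assms(2)]) (use assms(1,3) in \<open>auto intro: order_trans[OF _ abs_ge_self]\<close>)
  then show ?thesis using assms(1) by (simp add: L2fun_def)
qed

lemma L2fun_integrable_inner:
  fixes f g :: "'x \<Rightarrow> 'b::euclidean_space"
  assumes "f \<in> L2fun M" "g \<in> L2fun M"
  shows "integrable M (\<lambda>x. f x \<bullet> g x)"
proof (rule Bochner_Integration.integrable_bound)
  show "integrable M (\<lambda>x. (norm (f x))\<^sup>2 + (norm (g x))\<^sup>2)"
    using assms by (auto simp: L2fun_def)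
  show "(\<lambda>x. f x \<bullet> g x) \<in> borel_measurable M" using assms by (auto simp: L2fun_def)
  have "\<bar>f x \<bullet> g x\<bar> \<le> (norm (f x))\<^sup>2 + (norm (g x))\<^sup>2" for x
    using Cauchy_Schwarz_ineq2[of "f x" "g x"] sum_squares_bound[of "norm (f x)" "norm (g x)"]
      mult_nonneg_nonneg[OF norm_ge_zero norm_ge_zero, of "f x" "g x"] by linarith
  then show "AE x in M. norm (f x \<bullet> g x) \<le> norm ((norm (f x))\<^sup>2 + (norm (g x))\<^sup>2)" by simp
qed

interpretation L2: semi_inner "L2fun M :: ('x \<Rightarrow> 'b::euclidean_space) set" "\<lambda>f g. integral\<^sup>L M (\<lambda>x. f x \<bullet> g x)"
  for M
proof
  show "(\<lambda>_. 0) \<in> L2fun M" by (simp add: L2fun_def)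
next
  fix f g :: "'x \<Rightarrow> 'b" assume "f \<in> L2fun M" "g \<in> L2fun M"
  then show "(\<lambda>x. f x + g x) \<in> L2fun M"
  proof (intro L2fun_dominated[of _ _ "\<lambda>x. 2 * (norm (f x))\<^sup>2 + 2 * (norm (g x))\<^sup>2"])
    fix x
    have "(norm (f x + g x))\<^sup>2 \<le> (norm (f x) + norm (g x))\<^sup>2"
      by (intro power_mono norm_triangle_ineq) auto
    also have "\<dots> \<le> 2 * (norm (f x))\<^sup>2 + 2 * (norm (g x))\<^sup>2"
      using sum_squares_bound[of "norm (f x)" "norm (g x)"] by (simp add: power2_sum)
    finally show "(norm (f x + g x))\<^sup>2 \<le> 2 * (norm (f x))\<^sup>2 + 2 * (norm (g x))\<^sup>2" .
  qed (auto simp: L2fun_def)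
next
  fix f :: "'x \<Rightarrow> 'b" and r :: real assume "f \<in> L2fun M"
  then show "(\<lambda>x. r *\<^sub>R f x) \<in> L2fun M" by (auto simp: L2fun_def power_mult_distrib)
next
  fix f g :: "'x \<Rightarrow> 'b"
  show "(LINT x|M. f x \<bullet> g x) = (LINT x|M. g x \<bullet> f x)" by (simp add: inner_commute)
qed (simp_all add: inner_add_left L2fun_integrable_inner)

text \<open>On a finite measure space a subsequence with L2 increments below 2^-k has summable L1
  increments and so converges almost everywhere. Fatou's lemma along this subsequence gives L2
  convergence of the whole sequence.\<close>

lemma Riesz_Fischer:
  fixes f :: "nat \<Rightarrow> 'x \<Rightarrow> 'b::euclidean_space"
  assumes fin: "finite_measure M"
    and f: "\<And>n. f n \<in> L2fun M"
    and cauchy: "\<And>\<epsilon>. \<epsilon> > 0 \<Longrightarrow> \<exists>n0. \<forall>m\<ge>n0. \<forall>n\<ge>n0. integral\<^sup>L M (\<lambda>x. (norm (f m x - f n x))\<^sup>2) < \<epsilon>"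
  shows "\<exists>g\<in>L2fun M. (\<lambda>n. integral\<^sup>L M (\<lambda>x. (norm (f n x - g x))\<^sup>2)) \<longlonglongrightarrow> 0"
proof -
  interpret finite_measure M by (rule fin)
  have diff: "(\<lambda>x. f m x - f n x) \<in> L2fun M" for m n by (rule L2.diff_mem[OF f f])
  have meas [measurable]: "f n \<in> borel_measurable M" for n using f by (simp add: L2fun_def)
  have sq_int: "integrable M (\<lambda>x. (norm (f m x - f n x))\<^sup>2)" for m n
    using diff[of m n] by (simp add: L2fun_def)
  obtain s where s: "\<And>k m n. m \<ge> s k \<Longrightarrow> n \<ge> s k \<Longrightarrow> integral\<^sup>L M (\<lambda>x. (norm (f m x - f n x))\<^sup>2) < (1/4) ^ k"
    using cauchy[of "(1/4) ^ _"] by (metis zero_less_divide_1_iff zero_less_numeral zero_less_power)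
  \<comment> \<open>The sum makes the indices monotone and at least \<open>s k\<close>; the summand
    k makes them tend to infinity.\<close>
  define r where "r k = (\<Sum>i\<le>k. s i) + k" for k
  have r: "s k \<le> r k" "r k \<le> r (Suc k)" "k \<le> r k" for k
    using member_le_sum[of k "{..k}" s] by (auto simp: r_def)
  define d where "d k x = f (r (Suc k)) x - f (r k) x" for k x
  have d_meas [measurable]: "d k \<in> borel_measurable M" for k unfolding d_def by simp
  have d_le: "(\<integral>\<^sup>+x. ennreal (norm (d k x)) \<partial>M) \<le> ennreal ((measure M (space M) + 1) / 2 * (1/2) ^ k)" for k
  proof -
    \<comment> \<open>From (1 - 2^k |d|)^2 >= 0. The weights are balanced so that both terms
      integrate to multiples of 2^-k.\<close>
    have pt: "norm (d k x) \<le> (1/2) ^ k / 2 + 2 ^ k / 2 * (norm (d k x))\<^sup>2" for x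
    proof -
      have "0 \<le> (1 - 2 ^ k * norm (d k x))\<^sup>2 * (1/2) ^ k" by simp
      also have "\<dots> = (1/2) ^ k - 2 * norm (d k x) + 2 ^ k * (norm (d k x))\<^sup>2"
        by (simp add: power2_eq_square algebra_simps power_divide)
      finally show ?thesis by (simp add: algebra_simps)
    qed
    have int: "integrable M (\<lambda>x. (1/2) ^ k / 2 + 2 ^ k / 2 * (norm (d k x))\<^sup>2)"
      unfolding d_def using sq_int by (intro Bochner_Integration.integrable_add integrable_const integrable_mult_right) auto
    have "(\<integral>\<^sup>+x. ennreal (norm (d k x)) \<partial>M) \<le> (\<integral>\<^sup>+x. ennreal ((1/2) ^ k / 2 + 2 ^ k / 2 * (norm (d k x))\<^sup>2) \<partial>M)"
      by (intro nn_integral_mono ennreal_leI pt)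
    also have "\<dots> = ennreal (\<integral>x. ((1/2) ^ k / 2 + 2 ^ k / 2 * (norm (d k x))\<^sup>2) \<partial>M)"
      by (rule nn_integral_eq_integral[OF int]) auto
    also have "(\<integral>x. ((1/2) ^ k / 2 + 2 ^ k / 2 * (norm (d k x))\<^sup>2) \<partial>M)
        = measure M (space M) * ((1/2) ^ k / 2) + 2 ^ k / 2 * (\<integral>x. (norm (d k x))\<^sup>2 \<partial>M)"
      unfolding d_def using sq_int by (subst Bochner_Integration.integral_add) auto
    also have "\<dots> \<le> measure M (space M) * ((1/2) ^ k / 2) + 2 ^ k / 2 * (1/4) ^ k"
      unfolding d_def using s[of k "r (Suc k)" "r k"] r[of k]
      by (intro add_left_mono mult_left_mono) auto
    also have "\<dots> = (measure M (space M) + 1) / 2 * (1/2) ^ k"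
    proof -
      have "(2::real) ^ k * (1/4) ^ k = (1/2) ^ k" by (simp flip: power_mult_distrib)
      then show ?thesis by (simp add: algebra_simps)
    qed
    finally show ?thesis by (simp add: ennreal_leI)
  qed
  have "(\<integral>\<^sup>+x. (\<Sum>k. ennreal (norm (d k x))) \<partial>M) = (\<Sum>k. \<integral>\<^sup>+x. ennreal (norm (d k x)) \<partial>M)"
    by (rule nn_integral_suminf) simp
  also have "\<dots> \<le> (\<Sum>k. ennreal ((measure M (space M) + 1) / 2 * (1/2) ^ k))"
    by (intro suminf_le d_le) auto
  also have "\<dots> = ennreal (\<Sum>k. (measure M (space M) + 1) / 2 * (1/2) ^ k)"
    by (intro suminf_ennreal2 summable_mult summable_geometric) auto
  also have "\<dots> < \<infinity>" by simp
  finally have "AE x in M. (\<Sum>k. ennreal (norm (d k x))) \<noteq> \<infinity>"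
    by (intro nn_integral_PInf_AE) auto
  then have conv: "AE x in M. convergent (\<lambda>n. f (r n) x)"
  proof eventually_elim
    case (elim x)
    then have "summable (\<lambda>k. norm (d k x))" by (intro summable_suminf_not_top) auto
    then have "summable (\<lambda>k. d k x)" by (rule summable_norm_cancel)
    then have "convergent (\<lambda>n. \<Sum>k<n. d k x)" by (simp add: summable_iff_convergent)
    moreover have "(\<Sum>k<n. d k x) = f (r n) x - f (r 0) x" for n
      unfolding d_def by (rule sum_lessThan_telescope)
    ultimately have "convergent (\<lambda>n. f (r n) x - f (r 0) x)" by simp
    then have "convergent (\<lambda>n. f (r n) x - f (r 0) x + f (r 0) x)"
      by (intro convergent_add convergent_const)
    then show ?case by simp
  qed
  define g where "g x = lim (\<lambda>n. f (r n) x)" for x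
  have g_meas [measurable]: "g \<in> borel_measurable M" unfolding g_def by (rule borel_measurable_lim_metric) simp
  have lim: "AE x in M. (\<lambda>n. f (r n) x) \<longlonglongrightarrow> g x"
    using conv by eventually_elim (simp add: g_def convergent_LIMSEQ_iff)
  have bound: "(\<integral>\<^sup>+x. ennreal ((norm (f m x - g x))\<^sup>2) \<partial>M) \<le> ennreal ((1/4) ^ k)" if m: "m \<ge> s k" for m k
  proof -
    have "(\<integral>\<^sup>+x. ennreal ((norm (f m x - g x))\<^sup>2) \<partial>M)
        = (\<integral>\<^sup>+x. liminf (\<lambda>n. ennreal ((norm (f m x - f (r n) x))\<^sup>2)) \<partial>M)"
    proof (rule nn_integral_cong_AE)
      show "AE x in M. ennreal ((norm (f m x - g x))\<^sup>2) = liminf (\<lambda>n. ennreal ((norm (f m x - f (r n) x))\<^sup>2))"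
        using lim
      proof eventually_elim
        case (elim x)
        then have "(\<lambda>n. ennreal ((norm (f m x - f (r n) x))\<^sup>2)) \<longlonglongrightarrow> ennreal ((norm (f m x - g x))\<^sup>2)"
          by (intro tendsto_intros tendsto_ennrealI)
        then show ?case using lim_imp_Liminf[OF sequentially_bot] by metis
      qed
    qed
    also have "\<dots> \<le> liminf (\<lambda>n. \<integral>\<^sup>+x. ennreal ((norm (f m x - f (r n) x))\<^sup>2) \<partial>M)"
      by (rule nn_integral_liminf) simp
    also have "\<dots> \<le> ennreal ((1/4) ^ k)"
    proof (rule Liminf_le)
      show "\<forall>\<^sub>F n in sequentially. (\<integral>\<^sup>+x. ennreal ((norm (f m x - f (r n) x))\<^sup>2) \<partial>M) \<le> ennreal ((1/4) ^ k)"
        unfolding eventually_sequentially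
      proof (intro exI[of _ "s k"] allI impI)
        fix n assume "n \<ge> s k"
        then have "r n \<ge> s k" using r(3)[of n] by simp
        then show "(\<integral>\<^sup>+x. ennreal ((norm (f m x - f (r n) x))\<^sup>2) \<partial>M) \<le> ennreal ((1/4) ^ k)"
          using s[OF m, of "r n"] by (subst nn_integral_eq_integral[OF sq_int]) (auto intro!: ennreal_leI)
      qed
    qed simp
    finally show ?thesis .
  qed
  have fg_int: "integrable M (\<lambda>x. (norm (f m x - g x))\<^sup>2)" if "m \<ge> s k" for m k
    using bound[OF that] by (intro integrableI_bounded) (auto simp: le_less_trans[OF _ ennreal_less_top])
  have "(\<lambda>x. f (s 0) x - g x) \<in> L2fun M"
    using fg_int[of 0 "s 0"] by (simp add: L2fun_def)
  from L2.diff_mem[OF f[of "s 0"] this] have gL: "g \<in> L2fun M" by simp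
  have "(\<lambda>n. integral\<^sup>L M (\<lambda>x. (norm (f n x - g x))\<^sup>2)) \<longlonglongrightarrow> 0"
  proof (rule LIMSEQ_I)
    fix \<epsilon> :: real assume "\<epsilon> > 0"
    then obtain k where k: "(1/4) ^ k < \<epsilon>" using real_arch_pow_inv[of \<epsilon> "1/4"] by auto
    have "norm (integral\<^sup>L M (\<lambda>x. (norm (f n x - g x))\<^sup>2) - 0) < \<epsilon>" if "n \<ge> s k" for n
    proof -
      have "ennreal (integral\<^sup>L M (\<lambda>x. (norm (f n x - g x))\<^sup>2)) \<le> ennreal ((1/4) ^ k)"
        using bound[OF that] nn_integral_eq_integral[OF fg_int[OF that]] by simp
      then have "integral\<^sup>L M (\<lambda>x. (norm (f n x - g x))\<^sup>2) \<le> (1/4) ^ k" by (simp add: ennreal_le_iff)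
      moreover have "integral\<^sup>L M (\<lambda>x. (norm (f n x - g x))\<^sup>2) \<ge> 0" by (intro integral_nonneg_AE) auto
      ultimately show ?thesis using k by simp
    qed
    then show "\<exists>n0. \<forall>n\<ge>n0. norm (integral\<^sup>L M (\<lambda>x. (norm (f n x - g x))\<^sup>2) - 0) < \<epsilon>" by blast
  qed
  with gL show ?thesis by blast
qed

subsection \<open>Integration by parts and test functions\<close>

lemma integral_lborel_translate:
  fixes f :: "'a::euclidean_space \<Rightarrow> real"
  assumes "f \<in> borel_measurable borel"
  shows "integral\<^sup>L lborel (\<lambda>x. f (x + c)) = integral\<^sup>L lborel f"
proof -
  have "integral\<^sup>L lborel f = integral\<^sup>L (distr lborel borel ((+) c)) f"
    by (simp add: lborel_distr_plus)
  also have "\<dots> = integral\<^sup>L lborel (\<lambda>x. f (c + x))"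
    using assms by (subst integral_distr) auto
  finally show ?thesis by (simp add: add.commute)
qed

lemma integrable_continuous_compact_support:
  fixes f :: "'a::euclidean_space \<Rightarrow> 'b::euclidean_space"
  assumes "continuous_on UNIV f" "bounded S" "\<And>x. x \<notin> S \<Longrightarrow> f x = 0"
  shows "integrable lborel f"
proof -
  have "integrable lborel (\<lambda>x. indicator (closure S) x *\<^sub>R f x)"
    using assms by (intro borel_integrable_compact) (auto intro: continuous_on_subset simp: compact_closure)
  moreover have "indicator (closure S) x *\<^sub>R f x = f x" for x
    using assms(3)[of x] closure_subset[of S] by (auto simp: indicator_def)
  ultimately show ?thesis by simp
qed

text \<open>Difference quotients have integral zero by translation invariance.\<close>

lemma integral_directional_derivative_eq_0:
  fixes p :: "'a::euclidean_space \<Rightarrow> real"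
  assumes p: "\<And>x. (p has_derivative p' x) (at x)"
    and cont: "continuous_on UNIV (\<lambda>x. p' x b)"
    and S: "bounded S" "\<And>x. x \<notin> S \<Longrightarrow> p x = 0" "\<And>x. x \<notin> S \<Longrightarrow> p' x b = 0"
  shows "integral\<^sup>L lborel (\<lambda>x. p' x b) = 0"
proof -
  define h :: "nat \<Rightarrow> real" where "h n = 1 / real (Suc n)" for n
  define q where "q n x = (p (x + h n *\<^sub>R b) - p x) / h n" for n x
  have h: "h n > 0" "h n \<le> 1" for n by (auto simp: h_def)
  have pc: "continuous_on UNIV p"
    using p by (meson continuous_at_imp_continuous_on has_derivative_continuous)
  then have pm: "p \<in> borel_measurable borel" by (rule borel_measurable_continuous_onI)
  have pm2: "(\<lambda>x. p (x + c)) \<in> borel_measurable borel" for c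
    by (intro borel_measurable_continuous_onI continuous_on_compose2[OF pc] continuous_intros) auto
  have pint: "integrable lborel p" by (rule integrable_continuous_compact_support[OF pc S(1,2)])
  have pint2: "integrable lborel (\<lambda>x. p (x + c))" for c
  proof (rule integrable_continuous_compact_support)
    show "continuous_on UNIV (\<lambda>x. p (x + c))"
      by (intro continuous_on_compose2[OF pc] continuous_intros) auto
    show "bounded ((\<lambda>x. x - c) ` S)" using S(1) by (rule bounded_translation_minus)
    show "p (x + c) = 0" if "x \<notin> (\<lambda>x. x - c) ` S" for x
    proof (rule S(2))
      show "x + c \<notin> S" using that by (metis add_diff_cancel_right' image_eqI)
    qed
  qed
  have q0: "integral\<^sup>L lborel (q n) = 0" for n
    unfolding q_def using pint pint2 by (simp add: integral_lborel_translate[OF pm])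
  obtain R where R: "\<And>x. x \<in> S \<Longrightarrow> norm x \<le> R" using S(1) unfolding bounded_iff by auto
  \<comment> \<open>The radius is enlarged by \<open>norm b\<close> because h n <= 1: outside T
    neither x nor its translate meets S.\<close>
  define T where "T = cball (0::'a) (R + norm b)"
  have "bounded ((\<lambda>x. p' x b) ` T)"
    unfolding T_def by (intro compact_imp_bounded compact_continuous_image continuous_on_subset[OF cont]) auto
  then obtain C where C: "\<And>x. x \<in> T \<Longrightarrow> \<bar>p' x b\<bar> \<le> C" unfolding bounded_iff by auto
  have Call: "\<bar>p' x b\<bar> \<le> max C 0" for x
  proof (cases "x \<in> S")
    case True
    then have "norm x \<le> R + norm b" using R[of x] norm_ge_zero[of b] by linarith
    then have "x \<in> T" by (simp add: T_def)
    then show ?thesis using C[of x] by simp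
  qed (simp add: S(3))
  \<comment> \<open>By the mean value theorem a difference quotient is a value of the derivative, so
    one bound dominates all n.\<close>
  have bound: "norm (q n x) \<le> indicator T x *\<^sub>R max C 0" for n x
  proof (cases "x \<in> T")
    case True
    define \<phi> where "\<phi> t = p (x + t *\<^sub>R b)" for t
    have der: "(\<phi> has_real_derivative p' (x + t *\<^sub>R b) b) (at t)" for t
    proof -
      have "(\<phi> has_derivative (\<lambda>s. p' (x + t *\<^sub>R b) (s *\<^sub>R b))) (at t)"
        unfolding \<phi>_def by (rule has_derivative_compose[OF _ p]) (auto intro!: derivative_eq_intros)
      moreover have "(\<lambda>s. p' (x + t *\<^sub>R b) (s *\<^sub>R b)) = (*) (p' (x + t *\<^sub>R b) b)"
        using linear_scale[OF has_derivative_linear[OF p]] by (auto simp: mult.commute)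
      ultimately show ?thesis by (simp add: has_field_derivative_def)
    qed
    obtain z where "z > 0" "z < h n" "\<phi> (h n) - \<phi> 0 = (h n - 0) * p' (x + z *\<^sub>R b) b"
      using MVT2[OF h(1)[of n], of \<phi> "\<lambda>t. p' (x + t *\<^sub>R b) b"] der by auto
    then have "q n x = p' (x + z *\<^sub>R b) b" using h(1)[of n] by (simp add: q_def \<phi>_def)
    then show ?thesis using True Call by simp
  next
    case False
    then have xn: "norm x > R + norm b" by (simp add: T_def)
    have "norm (h n *\<^sub>R b) \<le> norm b" using h[of n] by (simp add: mult_left_le_one_le)
    then have "norm (x + h n *\<^sub>R b) > R" using xn norm_triangle_ineq4[of "x + h n *\<^sub>R b" "h n *\<^sub>R b"] by simp
    then have "x + h n *\<^sub>R b \<notin> S" using R by force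
    moreover have "x \<notin> S" using R[of x] xn norm_ge_zero[of b] by force
    ultimately show ?thesis using S(2) by (simp add: q_def)
  qed
  have lim: "(\<lambda>n. q n x) \<longlonglongrightarrow> p' x b" for x
  proof -
    have "((\<lambda>t. p (x + t *\<^sub>R b)) has_derivative (\<lambda>s. p' (x + 0 *\<^sub>R b) (s *\<^sub>R b))) (at 0)"
      by (rule has_derivative_compose[OF _ p]) (auto intro!: derivative_eq_intros)
    moreover have "(\<lambda>s. p' (x + 0 *\<^sub>R b) (s *\<^sub>R b)) = (*) (p' x b)"
      using linear_scale[OF has_derivative_linear[OF p]] by (auto simp: mult.commute)
    ultimately have "((\<lambda>t. p (x + t *\<^sub>R b)) has_real_derivative p' x b) (at 0)"
      by (simp add: has_field_derivative_def)
    then have "((\<lambda>t. (p (x + t *\<^sub>R b) - p x) / t) \<longlongrightarrow> p' x b) (at 0)"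
      by (simp add: DERIV_def)
    moreover have "filterlim h (at 0) sequentially"
    proof -
      have "h \<longlonglongrightarrow> 0" unfolding h_def using LIMSEQ_Suc[OF lim_1_over_n] by simp
      moreover have "h n \<noteq> 0" for n using h(1)[of n] by simp
      ultimately show ?thesis by (simp add: filterlim_at)
    qed
    ultimately show ?thesis unfolding q_def by (rule filterlim_compose)
  qed
  have "(\<lambda>n. integral\<^sup>L lborel (q n)) \<longlonglongrightarrow> integral\<^sup>L lborel (\<lambda>x. p' x b)"
  proof (rule integral_dominated_convergence)
    show "(\<lambda>x. p' x b) \<in> borel_measurable lborel" using borel_measurable_continuous_onI[OF cont] by simp
    show "q n \<in> borel_measurable lborel" for n
      unfolding q_def using pm pm2[of "h n *\<^sub>R b"] by simp
    show "integrable lborel (\<lambda>x. indicator T x *\<^sub>R max C 0)"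
      unfolding T_def by (intro borel_integrable_compact) auto
  qed (use lim bound in auto)
  then show ?thesis by (simp add: q0 LIMSEQ_const_iff)
qed

section \<open>Test functions and their gradients\<close>

lemma frechet_derivative_lincomb:
  fixes f g :: "'a::euclidean_space \<Rightarrow> real"
  assumes "f differentiable at x" "g differentiable at x"
  shows "frechet_derivative (\<lambda>x. r * f x + s * g x) (at x) b
     = r * frechet_derivative f (at x) b + s * frechet_derivative g (at x) b"
proof -
  have "((\<lambda>x. r * f x + s * g x) has_derivative
      (\<lambda>b. r * frechet_derivative f (at x) b + s * frechet_derivative g (at x) b)) (at x)"
    using assms unfolding frechet_derivative_works by (auto intro!: derivative_eq_intros)
  from frechet_derivative_at[OF this] show ?thesis by metis
qed

lemma Ck_on_lincomb:
  fixes f g :: "'a::euclidean_space \<Rightarrow> real"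
  assumes "Ck_on k UNIV f" "Ck_on k UNIV g"
  shows "Ck_on k UNIV (\<lambda>x. r * f x + s * g x)"
  using assms
proof (induction k arbitrary: f g)
  case 0
  then show ?case by (auto intro!: continuous_intros)
next
  case (Suc k)
  then have d: "f differentiable at x" "g differentiable at x" for x by auto
  then show ?case using Suc by (auto simp: frechet_derivative_lincomb)
qed

lemma test_fun_lincomb:
  assumes "test_fun \<Omega> \<phi>" "test_fun \<Omega> \<psi>"
  shows "test_fun \<Omega> (\<lambda>x. r * \<phi> x + s * \<psi> x)"
proof -
  let ?U = "closure {x. \<phi> x \<noteq> 0} \<union> closure {x. \<psi> x \<noteq> 0}"
  have "closure {x. r * \<phi> x + s * \<psi> x \<noteq> 0} \<subseteq> closure ({x. \<phi> x \<noteq> 0} \<union> {x. \<psi> x \<noteq> 0})"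
    by (intro closure_mono) auto
  then have sub: "closure {x. r * \<phi> x + s * \<psi> x \<noteq> 0} \<subseteq> ?U" by (simp add: closure_Un)
  have "compact ?U" "?U \<subseteq> \<Omega>" using assms by (auto simp: test_fun_def)
  then have "compact (closure {x. r * \<phi> x + s * \<psi> x \<noteq> 0})"
    using sub by (meson bounded_subset closed_closure compact_eq_bounded_closed)
  then show ?thesis
    using sub \<open>?U \<subseteq> \<Omega>\<close> assms by (auto simp: test_fun_def smooth_fun_def Ck_on_lincomb)
qed

lemma test_fun_has_derivative:
  assumes "test_fun \<Omega> \<phi>"
  shows "(\<phi> has_derivative frechet_derivative \<phi> (at x)) (at x)"
proof -
  have "Ck_on (Suc 0) UNIV \<phi>" using assms unfolding test_fun_def smooth_fun_def by blast
  then show ?thesis by (simp flip: frechet_derivative_works)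
qed

lemma test_fun_differentiable: "test_fun \<Omega> \<phi> \<Longrightarrow> \<phi> differentiable at x"
  using test_fun_has_derivative differentiableI by blast

lemma test_fun_continuous: "test_fun \<Omega> \<phi> \<Longrightarrow> continuous_on UNIV \<phi>"
  by (meson continuous_at_imp_continuous_on has_derivative_continuous test_fun_has_derivative)

lemma test_fun_support:
  assumes "test_fun \<Omega> \<phi>"
  shows "bounded (closure {x. \<phi> x \<noteq> 0})" "closure {x. \<phi> x \<noteq> 0} \<subseteq> \<Omega>"
  using assms by (auto simp: test_fun_def compact_imp_bounded)

lemma test_fun_eq_0: "x \<notin> closure {x. \<phi> x \<noteq> 0} \<Longrightarrow> \<phi> x = 0"
  using closure_subset[of "{x. \<phi> x \<noteq> 0}"] by auto

lemma test_fun_derivative_eq_0: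
  assumes "test_fun \<Omega> \<phi>" "x \<notin> closure {x. \<phi> x \<noteq> 0}"
  shows "frechet_derivative \<phi> (at x) b = 0"
proof -
  have "((\<lambda>_. 0) has_derivative (\<lambda>_. 0)) (at x)" by simp
  then have "(\<phi> has_derivative (\<lambda>_. 0)) (at x)"
    by (rule has_derivative_transform_within_open[of _ _ _ _ "- closure {x. \<phi> x \<noteq> 0}"])
      (use assms(2) test_fun_eq_0 in \<open>auto simp: open_Compl\<close>)
  from frechet_derivative_at[OF this] show ?thesis by metis
qed

text \<open>Unfolding \<open>Ck_on\<close> once transfers smoothness of all orders, and the support
  can only shrink. This is what lets the components of a gradient serve as test functions
  again.\<close>

lemma test_fun_partial:
  assumes "test_fun \<Omega> \<phi>" "b \<in> Basis"
  shows "test_fun \<Omega> (\<lambda>x. frechet_derivative \<phi> (at x) b)"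
proof -
  have "Ck_on (Suc k) UNIV \<phi>" for k using assms unfolding test_fun_def smooth_fun_def by blast
  then have "smooth_fun (\<lambda>x. frechet_derivative \<phi> (at x) b)" using assms(2) by (simp add: smooth_fun_def)
  moreover have sub: "closure {x. frechet_derivative \<phi> (at x) b \<noteq> 0} \<subseteq> closure {x. \<phi> x \<noteq> 0}"
    using test_fun_derivative_eq_0[OF assms(1)] by (intro closure_minimal) auto
  moreover have "compact (closure {x. frechet_derivative \<phi> (at x) b \<noteq> 0})"
    using sub test_fun_support(1)[OF assms(1)] by (meson bounded_subset closed_closure compact_eq_bounded_closed)
  ultimately show ?thesis using test_fun_support(2)[OF assms(1)] by (auto simp: test_fun_def)
qed

lemma cgrad_inner_Basis: "b \<in> Basis \<Longrightarrow> cgrad \<phi> x \<bullet> b = frechet_derivative \<phi> (at x) b"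
  unfolding cgrad_def by (simp add: inner_sum_left inner_Basis if_distrib cong: if_cong)

lemma cgrad_lincomb:
  assumes "test_fun \<Omega> \<phi>" "test_fun \<Omega> \<psi>"
  shows "cgrad (\<lambda>x. r * \<phi> x + s * \<psi> x) x = r *\<^sub>R cgrad \<phi> x + s *\<^sub>R cgrad \<psi> x"
  unfolding cgrad_def using assms
  by (simp add: frechet_derivative_lincomb test_fun_differentiable scaleR_sum_right scaleR_add_left sum.distrib)

lemma cgrad_continuous: "test_fun \<Omega> \<phi> \<Longrightarrow> continuous_on UNIV (cgrad \<phi>)"
  unfolding cgrad_def[abs_def] by (intro continuous_intros test_fun_continuous[OF test_fun_partial])

lemma cgrad_eq_0: "test_fun \<Omega> \<phi> \<Longrightarrow> x \<notin> closure {x. \<phi> x \<noteq> 0} \<Longrightarrow> cgrad \<phi> x = 0"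
  by (simp add: cgrad_def test_fun_derivative_eq_0)

lemma test_fun_supportE:
  assumes "test_fun \<Omega> \<phi>"
  obtains S where "bounded S" "S \<subseteq> \<Omega>" "\<And>x. x \<notin> S \<Longrightarrow> \<phi> x = 0"
    "\<And>x b. x \<notin> S \<Longrightarrow> frechet_derivative \<phi> (at x) b = 0" "\<And>x. x \<notin> S \<Longrightarrow> cgrad \<phi> x = 0"
  using that[of "closure {x. \<phi> x \<noteq> 0}"] test_fun_support[OF assms] test_fun_eq_0[of _ \<phi>]
    test_fun_derivative_eq_0[OF assms] cgrad_eq_0[OF assms] by blast

lemma borel_measurable_lebesgue_on:
  "f \<in> borel_measurable borel \<Longrightarrow> f \<in> borel_measurable (lebesgue_on \<Omega>)"
  by (intro measurable_restrict_space1 measurable_completion) simp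

text \<open>Translation invariance is exploited for \<open>lborel\<close> on the whole space,
  whereas the forms are integrals for the completed measure restricted to the domain. This lemma
  moves between the two.\<close>

lemma integral_lebesgue_on_eq_lborel:
  fixes f :: "'a::euclidean_space \<Rightarrow> 'b::euclidean_space"
  assumes "\<Omega> \<in> sets lebesgue" "f \<in> borel_measurable borel" "\<And>x. x \<notin> \<Omega> \<Longrightarrow> f x = 0"
  shows "integral\<^sup>L (lebesgue_on \<Omega>) f = integral\<^sup>L lborel f"
proof -
  have "indicator \<Omega> x *\<^sub>R f x = f x" for x using assms(3)[of x] by (simp add: indicator_def)
  then have "integral\<^sup>L (lebesgue_on \<Omega>) f = integral\<^sup>L lebesgue f"
    using assms(1) by (simp add: integral_restrict_space)
  also have "\<dots> = integral\<^sup>L lborel f" using assms(2) by (simp add: integral_completion)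
  finally show ?thesis .
qed

lemma L2fun_continuous_compact_support:
  fixes f :: "'a::euclidean_space \<Rightarrow> 'b::euclidean_space"
  assumes "\<Omega> \<in> sets lebesgue" "continuous_on UNIV f" "bounded S" "\<And>x. x \<notin> S \<Longrightarrow> f x = 0"
  shows "f \<in> L2fun (lebesgue_on \<Omega>)"
proof -
  have "integrable lborel (\<lambda>x. (norm (f x))\<^sup>2)"
    using assms by (intro integrable_continuous_compact_support[of _ S] continuous_intros) auto
  then have "integrable lebesgue (\<lambda>x. (norm (f x))\<^sup>2)" by (simp add: integrable_completion)
  then have "integrable (lebesgue_on \<Omega>) (\<lambda>x. (norm (f x))\<^sup>2)"
    using integrable_mult_indicator[OF assms(1), of "\<lambda>x. (norm (f x))\<^sup>2"] assms(1)
    by (simp add: integrable_restrict_space)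
  then show ?thesis
    using borel_measurable_lebesgue_on[OF borel_measurable_continuous_onI[OF assms(2)]] by (simp add: L2fun_def)
qed

lemma test_fun_L2:
  assumes "\<Omega> \<in> sets lebesgue" "test_fun \<Omega> \<phi>"
  shows "\<phi> \<in> L2fun (lebesgue_on \<Omega>)" "cgrad \<phi> \<in> L2fun (lebesgue_on \<Omega>)"
proof -
  obtain S where "bounded S" "\<And>x. x \<notin> S \<Longrightarrow> \<phi> x = 0" "\<And>x. x \<notin> S \<Longrightarrow> cgrad \<phi> x = 0"
    using test_fun_supportE[OF assms(2)] by metis
  then show "\<phi> \<in> L2fun (lebesgue_on \<Omega>)" "cgrad \<phi> \<in> L2fun (lebesgue_on \<Omega>)"
    using L2fun_continuous_compact_support[OF assms(1)] test_fun_continuous[OF assms(2)]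
      cgrad_continuous[OF assms(2)] by blast+
qed

text \<open>The b-derivative of the product \<phi> \<psi> has integral zero over the whole space,
  and both of its terms vanish outside the domain.\<close>

lemma test_fun_by_parts:
  assumes \<Omega>: "\<Omega> \<in> sets lebesgue" and \<phi>: "test_fun \<Omega> \<phi>" and \<psi>: "test_fun \<Omega> \<psi>" and b: "b \<in> Basis"
  shows "integral\<^sup>L (lebesgue_on \<Omega>) (\<lambda>x. frechet_derivative \<phi> (at x) b * \<psi> x)
     = - integral\<^sup>L (lebesgue_on \<Omega>) (\<lambda>x. \<phi> x * frechet_derivative \<psi> (at x) b)"
proof -
  let ?p' = "\<lambda>x b. \<phi> x * frechet_derivative \<psi> (at x) b + frechet_derivative \<phi> (at x) b * \<psi> x"
  note c = test_fun_continuous[OF \<phi>] test_fun_continuous[OF \<psi>]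
    test_fun_continuous[OF test_fun_partial[OF \<phi> b]] test_fun_continuous[OF test_fun_partial[OF \<psi> b]]
  obtain S where S: "bounded S" "S \<subseteq> \<Omega>" and z: "\<And>x. x \<notin> S \<Longrightarrow> \<phi> x = 0"
    "\<And>x b. x \<notin> S \<Longrightarrow> frechet_derivative \<phi> (at x) b = 0" using test_fun_supportE[OF \<phi>] by metis
  have z0: "x \<notin> \<Omega> \<Longrightarrow> \<phi> x = 0" "x \<notin> \<Omega> \<Longrightarrow> frechet_derivative \<phi> (at x) b = 0" for x
    using S(2) z by blast+
  have "integral\<^sup>L lborel (\<lambda>x. ?p' x b) = 0"
  proof (rule integral_directional_derivative_eq_0[where S = S and p' = ?p'])
    show "((\<lambda>x. \<phi> x * \<psi> x) has_derivative ?p' x) (at x)" for x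
      by (rule has_derivative_mult[OF test_fun_has_derivative[OF \<phi>] test_fun_has_derivative[OF \<psi>]])
    show "continuous_on UNIV (\<lambda>x. ?p' x b)" by (intro continuous_intros c)
    show "bounded S" by (rule S(1))
  qed (simp_all add: z)
  moreover have "integrable lborel (\<lambda>x. \<phi> x * frechet_derivative \<psi> (at x) b)"
    "integrable lborel (\<lambda>x. frechet_derivative \<phi> (at x) b * \<psi> x)"
    by (intro integrable_continuous_compact_support[of _ S] continuous_intros c S(1), simp add: z)+
  ultimately have "integral\<^sup>L lborel (\<lambda>x. \<phi> x * frechet_derivative \<psi> (at x) b)
      + integral\<^sup>L lborel (\<lambda>x. frechet_derivative \<phi> (at x) b * \<psi> x) = 0" by simp
  moreover have "integral\<^sup>L (lebesgue_on \<Omega>) (\<lambda>x. \<phi> x * frechet_derivative \<psi> (at x) b)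
      = integral\<^sup>L lborel (\<lambda>x. \<phi> x * frechet_derivative \<psi> (at x) b)"
    by (intro integral_lebesgue_on_eq_lborel \<Omega> borel_measurable_continuous_onI continuous_intros c)
      (simp add: z0)
  moreover have "integral\<^sup>L (lebesgue_on \<Omega>) (\<lambda>x. frechet_derivative \<phi> (at x) b * \<psi> x)
      = integral\<^sup>L lborel (\<lambda>x. frechet_derivative \<phi> (at x) b * \<psi> x)"
    by (intro integral_lebesgue_on_eq_lborel \<Omega> borel_measurable_continuous_onI continuous_intros c)
      (simp add: z0)
  ultimately show ?thesis by simp
qed

text \<open>The b-derivative of (x . b) \<phi>^2 has integral zero, which expresses the integral of
  \<phi>^2 by that of -2 (x . b) \<phi> times the b-derivative of \<phi>. On the domain |x . b| <=
  R; splitting the product so that half of the integral of \<phi>^2 is absorbed on the left produces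
  4 R^2.\<close>

lemma Poincare_test_fun:
  fixes \<phi> :: "'a::euclidean_space \<Rightarrow> real"
  assumes \<Omega>: "\<Omega> \<in> sets lebesgue" and R: "\<And>x. x \<in> \<Omega> \<Longrightarrow> norm x \<le> R" and \<phi>: "test_fun \<Omega> \<phi>"
  shows "integral\<^sup>L (lebesgue_on \<Omega>) (\<lambda>x. (\<phi> x)\<^sup>2) \<le> 4 * R\<^sup>2 * integral\<^sup>L (lebesgue_on \<Omega>) (\<lambda>x. (norm (cgrad \<phi> x))\<^sup>2)"
proof -
  obtain b :: 'a where b: "b \<in> Basis" using nonempty_Basis by blast
  let ?d = "\<lambda>x. frechet_derivative \<phi> (at x)"
  let ?p' = "\<lambda>x v. (x \<bullet> b) * (2 * \<phi> x * ?d x v) + (v \<bullet> b) * (\<phi> x)\<^sup>2"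
  note c = test_fun_continuous[OF \<phi>] test_fun_continuous[OF test_fun_partial[OF \<phi> b]] cgrad_continuous[OF \<phi>]
  obtain S where S: "bounded S" "S \<subseteq> \<Omega>" and z: "\<And>x. x \<notin> S \<Longrightarrow> \<phi> x = 0"
    "\<And>x b. x \<notin> S \<Longrightarrow> frechet_derivative \<phi> (at x) b = 0" "\<And>x. x \<notin> S \<Longrightarrow> cgrad \<phi> x = 0"
    using test_fun_supportE[OF \<phi>] by metis
  have z0: "x \<notin> \<Omega> \<Longrightarrow> \<phi> x = 0" "x \<notin> \<Omega> \<Longrightarrow> cgrad \<phi> x = 0" for x
    using S(2) z by blast+
  have "integral\<^sup>L lborel (\<lambda>x. ?p' x b) = 0"
  proof (rule integral_directional_derivative_eq_0[where S = S and p' = ?p'])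
    show "((\<lambda>x. (x \<bullet> b) * (\<phi> x)\<^sup>2) has_derivative ?p' x) (at x)" for x
      using test_fun_has_derivative[OF \<phi>, of x] by (auto intro!: derivative_eq_intros simp: fun_eq_iff)
    show "continuous_on UNIV (\<lambda>x. ?p' x b)" by (intro continuous_intros c)
  qed (simp_all add: z S)
  moreover have i1: "integrable lborel (\<lambda>x. (x \<bullet> b) * (2 * \<phi> x * ?d x b))" "integrable lborel (\<lambda>x. (\<phi> x)\<^sup>2)"
    and i2: "integrable lborel (\<lambda>x. (norm (cgrad \<phi> x))\<^sup>2)"
    by (intro integrable_continuous_compact_support[of _ S] continuous_intros c S(1), simp add: z)+
  ultimately have "integral\<^sup>L lborel (\<lambda>x. (\<phi> x)\<^sup>2) = integral\<^sup>L lborel (\<lambda>x. - ((x \<bullet> b) * (2 * \<phi> x * ?d x b)))"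
    using b by simp
  also have "\<dots> \<le> integral\<^sup>L lborel (\<lambda>x. 1/2 * (\<phi> x)\<^sup>2 + 2 * R\<^sup>2 * (norm (cgrad \<phi> x))\<^sup>2)"
  proof (rule integral_mono)
    fix x
    show "- ((x \<bullet> b) * (2 * \<phi> x * ?d x b)) \<le> 1/2 * (\<phi> x)\<^sup>2 + 2 * R\<^sup>2 * (norm (cgrad \<phi> x))\<^sup>2"
    proof (cases "x \<in> \<Omega>")
      case True
      have "(x \<bullet> b)\<^sup>2 \<le> R\<^sup>2"
        using R[OF True] Basis_le_norm[OF b, of x] by (metis abs_ge_zero order_trans power2_abs power_mono)
      moreover have "(?d x b)\<^sup>2 \<le> (norm (cgrad \<phi> x))\<^sup>2"
        using Basis_le_norm[OF b, of "cgrad \<phi> x"] cgrad_inner_Basis[OF b, of \<phi> x]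
        by (metis abs_ge_zero power2_abs power_mono)
      ultimately have "(x \<bullet> b)\<^sup>2 * (?d x b)\<^sup>2 \<le> R\<^sup>2 * (norm (cgrad \<phi> x))\<^sup>2" by (intro mult_mono) auto
      moreover have "0 \<le> (\<phi> x / 2 + (x \<bullet> b) * ?d x b)\<^sup>2 * 2" by simp
      then have "- ((x \<bullet> b) * (2 * \<phi> x * ?d x b)) \<le> 1/2 * (\<phi> x)\<^sup>2 + 2 * ((x \<bullet> b)\<^sup>2 * (?d x b)\<^sup>2)"
        by (simp add: power2_eq_square algebra_simps)
      ultimately show ?thesis by simp
    next
      case False
      then have "\<phi> x = 0" using S(2) z(1) by blast
      then show ?thesis by simp
    qed
  qed (use i1 i2 in auto)
  also have "\<dots> = 1/2 * integral\<^sup>L lborel (\<lambda>x. (\<phi> x)\<^sup>2) + 2 * R\<^sup>2 * integral\<^sup>L lborel (\<lambda>x. (norm (cgrad \<phi> x))\<^sup>2)"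
    using i1 i2 by simp
  finally have "integral\<^sup>L lborel (\<lambda>x. (\<phi> x)\<^sup>2) \<le> 4 * R\<^sup>2 * integral\<^sup>L lborel (\<lambda>x. (norm (cgrad \<phi> x))\<^sup>2)"
    by simp
  moreover have "integral\<^sup>L (lebesgue_on \<Omega>) (\<lambda>x. (\<phi> x)\<^sup>2) = integral\<^sup>L lborel (\<lambda>x. (\<phi> x)\<^sup>2)"
    by (intro integral_lebesgue_on_eq_lborel \<Omega> borel_measurable_continuous_onI continuous_intros c)
      (simp add: z0)
  moreover have "integral\<^sup>L (lebesgue_on \<Omega>) (\<lambda>x. (norm (cgrad \<phi> x))\<^sup>2)
      = integral\<^sup>L lborel (\<lambda>x. (norm (cgrad \<phi> x))\<^sup>2)"
    by (intro integral_lebesgue_on_eq_lborel \<Omega> borel_measurable_continuous_onI continuous_intros c)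
      (simp add: z0)
  ultimately show ?thesis by simp
qed

subsection \<open>The space of weakly differentiable functions vanishing on the boundary\<close>

locale bounded_domain =
  fixes \<Omega> :: "'a::euclidean_space set"
  assumes op: "open \<Omega>" and bd: "bounded \<Omega>"
begin

abbreviation M where "M \<equiv> lebesgue_on \<Omega>"

abbreviation ip :: "('a \<Rightarrow> 'b::euclidean_space) \<Rightarrow> ('a \<Rightarrow> 'b) \<Rightarrow> real" where
  "ip f g \<equiv> integral\<^sup>L M (\<lambda>x. f x \<bullet> g x)"

lemma meas_dom: "\<Omega> \<in> sets lebesgue" by (intro sets_completionI_sets) (simp add: op)

lemma finite_measure_M: "finite_measure M"
  by (intro finite_measure_lebesgue_on bounded_set_imp_lmeasurable bd meas_dom)

lemma set_integral_eq: "(LINT x:\<Omega>|lebesgue. f x) = integral\<^sup>L M f"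
  for f :: "'a \<Rightarrow> 'b::euclidean_space"
  using meas_dom by (simp add: set_lebesgue_integral_def integral_restrict_space)

lemma set_integrable_eq: "set_integrable lebesgue \<Omega> f \<longleftrightarrow> integrable M f"
  for f :: "'a \<Rightarrow> 'b::euclidean_space"
  using meas_dom by (simp add: set_integrable_def integrable_restrict_space)

lemma sq_int_eq: "sq_int \<Omega> g \<longleftrightarrow> g \<in> L2fun M"
  using meas_dom
  by (auto simp: sq_int_def L2fun_def set_integrable_eq set_borel_measurable_def borel_measurable_restrict_space_iff)

lemma L2inner_eq: "L2inner \<Omega> u v = ip u v"
  by (simp add: L2inner_def set_integral_eq)

lemma H01_grad_iff:
  "H01_grad \<Omega> u g \<longleftrightarrow> u \<in> L2fun M \<and> g \<in> L2fun M \<and>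
     (\<exists>\<phi>::nat \<Rightarrow> 'a \<Rightarrow> real. (\<forall>k. test_fun \<Omega> (\<phi> k)) \<and>
        (\<lambda>k. ip (\<lambda>x. \<phi> k x - u x) (\<lambda>x. \<phi> k x - u x)) \<longlonglongrightarrow> 0 \<and>
        (\<lambda>k. ip (\<lambda>x. cgrad (\<phi> k) x - g x) (\<lambda>x. cgrad (\<phi> k) x - g x)) \<longlonglongrightarrow> 0)"
  unfolding H01_grad_def sq_int_eq set_integral_eq by (simp only: power2_norm_eq_inner) (simp add: power2_eq_square)

lemma H01_grad_L2: "H01_grad \<Omega> u g \<Longrightarrow> u \<in> L2fun M" "H01_grad \<Omega> u g \<Longrightarrow> g \<in> L2fun M"
  by (auto simp: H01_grad_iff)

lemma H01_grad_lincomb: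
  assumes "H01_grad \<Omega> u g" "H01_grad \<Omega> v h"
  shows "H01_grad \<Omega> (\<lambda>x. r * u x + s * v x) (\<lambda>x. r *\<^sub>R g x + s *\<^sub>R h x)"
proof -
  obtain \<phi> where \<phi>: "\<And>k. test_fun \<Omega> (\<phi> k)"
    "(\<lambda>k. ip (\<lambda>x. \<phi> k x - u x) (\<lambda>x. \<phi> k x - u x)) \<longlonglongrightarrow> 0"
    "(\<lambda>k. ip (\<lambda>x. cgrad (\<phi> k) x - g x) (\<lambda>x. cgrad (\<phi> k) x - g x)) \<longlonglongrightarrow> 0"
    using assms(1) unfolding H01_grad_iff by blast
  obtain \<psi> where \<psi>: "\<And>k. test_fun \<Omega> (\<psi> k)"
    "(\<lambda>k. ip (\<lambda>x. \<psi> k x - v x) (\<lambda>x. \<psi> k x - v x)) \<longlonglongrightarrow> 0"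
    "(\<lambda>k. ip (\<lambda>x. cgrad (\<psi> k) x - h x) (\<lambda>x. cgrad (\<psi> k) x - h x)) \<longlonglongrightarrow> 0"
    using assms(2) unfolding H01_grad_iff by blast
  note L2 = test_fun_L2[OF meas_dom \<phi>(1)] test_fun_L2[OF meas_dom \<psi>(1)] H01_grad_L2[OF assms(1)] H01_grad_L2[OF assms(2)]
  have "(\<lambda>x. r *\<^sub>R u x + s *\<^sub>R v x) \<in> L2fun M" "(\<lambda>x. r *\<^sub>R g x + s *\<^sub>R h x) \<in> L2fun M"
    by (intro L2.add_mem L2.scale_mem L2)+
  moreover have "\<forall>k. test_fun \<Omega> (\<lambda>x. r * \<phi> k x + s * \<psi> k x)" using \<phi>(1) \<psi>(1) by (simp add: test_fun_lincomb)
  moreover note L2.lincomb_tendsto[OF L2(1,3) L2(5,7) \<phi>(2) \<psi>(2), of r s, unfolded real_scaleR_def]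
  moreover note L2.lincomb_tendsto[OF L2(2,4) L2(6,8) \<phi>(3) \<psi>(3), of r s]
  ultimately show ?thesis
    unfolding H01_grad_iff
    by (intro conjI exI[of _ "\<lambda>k x. r * \<phi> k x + s * \<psi> k x"])
      (simp_all add: cgrad_lincomb[OF \<phi>(1) \<psi>(1)])
qed

text \<open>The gradient is closable: integrating by parts, the limit \<open>h\<close> of the gradients is orthogonal to the
  approximating gradients themselves, since their components are again test functions.\<close>

lemma H01_grad_null:
  assumes "H01_grad \<Omega> u h" "ip u u = 0"
  shows "ip h h = 0"
proof -
  obtain \<phi> where \<phi>: "\<And>k. test_fun \<Omega> (\<phi> k)"
    "(\<lambda>k. ip (\<lambda>x. \<phi> k x - u x) (\<lambda>x. \<phi> k x - u x)) \<longlonglongrightarrow> 0"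
    "(\<lambda>k. ip (\<lambda>x. cgrad (\<phi> k) x - h x) (\<lambda>x. cgrad (\<phi> k) x - h x)) \<longlonglongrightarrow> 0"
    using assms(1) unfolding H01_grad_iff by blast
  note L2 = test_fun_L2[OF meas_dom \<phi>(1)] H01_grad_L2[OF assms(1)]
  have b_mem: "(\<lambda>x. \<psi> x *\<^sub>R b) \<in> L2fun M" if "test_fun \<Omega> \<psi>" for \<psi> and b :: 'a
    using test_fun_L2(1)[OF meas_dom that] by (auto simp: L2fun_def power_mult_distrib)
  have orth: "ip h (\<lambda>x. \<psi> x *\<^sub>R b) = 0" if \<psi>: "test_fun \<Omega> \<psi>" and b: "b \<in> Basis" for \<psi> b
  proof -
    have "(\<lambda>k. ip (cgrad (\<phi> k)) (\<lambda>x. \<psi> x *\<^sub>R b)) \<longlonglongrightarrow> ip h (\<lambda>x. \<psi> x *\<^sub>R b)"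
      by (rule L2.ip_tendsto[OF _ _ L2(4) b_mem[OF \<psi>] \<phi>(3)]) (simp_all add: L2 b_mem[OF \<psi>])
    moreover have "ip (cgrad (\<phi> k)) (\<lambda>x. \<psi> x *\<^sub>R b) = - ip (\<phi> k) (\<lambda>x. frechet_derivative \<psi> (at x) b)" for k
      using test_fun_by_parts[OF meas_dom \<phi>(1) \<psi> b, of k] b by (simp add: cgrad_inner_Basis mult.commute)
    moreover have "(\<lambda>k. - ip (\<phi> k) (\<lambda>x. frechet_derivative \<psi> (at x) b))
        \<longlonglongrightarrow> - ip u (\<lambda>x. frechet_derivative \<psi> (at x) b)"
      by (intro tendsto_minus L2.ip_tendsto[OF _ _ L2(3) test_fun_L2(1)[OF meas_dom test_fun_partial[OF \<psi> b]] \<phi>(2)])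
        (simp_all add: L2 test_fun_L2(1)[OF meas_dom test_fun_partial[OF \<psi> b]])
    moreover have "ip u (\<lambda>x. frechet_derivative \<psi> (at x) b) = 0"
      by (rule L2.null_imp_ip_eq_0[OF L2(3) test_fun_L2(1)[OF meas_dom test_fun_partial[OF \<psi> b]] assms(2)])
    ultimately show ?thesis using LIMSEQ_unique by fastforce
  qed
  have "ip h (cgrad (\<phi> k)) = 0" for k
  proof -
    have "ip h (\<lambda>x. \<Sum>b\<in>Basis. 1 *\<^sub>R (frechet_derivative (\<phi> k) (at x) b *\<^sub>R b))
        = (\<Sum>b\<in>Basis. 1 * ip h (\<lambda>x. frechet_derivative (\<phi> k) (at x) b *\<^sub>R b))"
      by (rule L2.ip_lincomb_right[OF b_mem[OF test_fun_partial[OF \<phi>(1)]] L2(4)])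
    then show ?thesis using orth[OF test_fun_partial[OF \<phi>(1)]] by (simp add: cgrad_def[abs_def])
  qed
  moreover have "(\<lambda>k. ip h (cgrad (\<phi> k))) \<longlonglongrightarrow> ip h h"
    by (rule L2.ip_tendsto[OF _ _ L2(4,4) _ \<phi>(3)]) (simp_all add: L2)
  ultimately show ?thesis by (simp add: LIMSEQ_const_iff)
qed

text \<open>The difference of two gradients of u is a gradient of 0 and hence null. Pairings are
  compared because gradients are determined only almost everywhere and \<open>wgrad\<close> is an
  arbitrary choice among them.\<close>

lemma H01_grad_unique:
  assumes "H01_grad \<Omega> u g" "H01_grad \<Omega> u g'" "h \<in> L2fun M"
  shows "ip g h = ip g' h"
proof -
  note L2 = H01_grad_L2(2)[OF assms(1)] H01_grad_L2(2)[OF assms(2)]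
  have "H01_grad \<Omega> (\<lambda>_. 0) (\<lambda>x. g x - g' x)"
    using H01_grad_lincomb[OF assms(1,2), of 1 "-1"] by simp
  from H01_grad_null[OF this] have "ip (\<lambda>x. g x - g' x) (\<lambda>x. g x - g' x) = 0" by simp
  from L2.null_imp_ip_eq_0[OF L2.diff_mem[OF L2] assms(3) this]
  show ?thesis using L2.ip_diff[OF L2 assms(3)] by simp
qed

lemma wgrad: "u \<in> H01 \<Omega> \<Longrightarrow> H01_grad \<Omega> u (wgrad \<Omega> u)"
  unfolding H01_def wgrad_def mem_Collect_eq by (rule someI_ex[of "H01_grad \<Omega> u"])

lemma H01I: "H01_grad \<Omega> u g \<Longrightarrow> u \<in> H01 \<Omega>"
  by (auto simp: H01_def)

lemma H01_L2: "u \<in> H01 \<Omega> \<Longrightarrow> u \<in> L2fun M" "u \<in> H01 \<Omega> \<Longrightarrow> wgrad \<Omega> u \<in> L2fun M"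
  using H01_grad_L2[OF wgrad] by auto

lemma grad_ip_eq:
  assumes "H01_grad \<Omega> u g" "H01_grad \<Omega> v h"
  shows "ip (wgrad \<Omega> u) (wgrad \<Omega> v) = ip g h"
proof -
  note w = wgrad[OF H01I[OF assms(1)]] wgrad[OF H01I[OF assms(2)]]
  have "ip (wgrad \<Omega> u) (wgrad \<Omega> v) = ip g (wgrad \<Omega> v)"
    by (rule H01_grad_unique[OF w(1) assms(1) H01_grad_L2(2)[OF w(2)]])
  also have "\<dots> = ip (wgrad \<Omega> v) g" by (simp add: inner_commute)
  also have "\<dots> = ip h g" by (rule H01_grad_unique[OF w(2) assms(2) H01_grad_L2(2)[OF assms(1)]])
  finally show ?thesis by (simp add: inner_commute)
qed

lemma grad_sq_eq: "H01_grad \<Omega> u g \<Longrightarrow> grad_sq \<Omega> u = ip g g"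
  using grad_ip_eq[of u g u g] by (simp add: grad_sq_def set_integral_eq power2_norm_eq_inner)

lemma grad_sq_nonneg: "u \<in> H01 \<Omega> \<Longrightarrow> grad_sq \<Omega> u \<ge> 0"
  using grad_sq_eq[OF wgrad] L2.ip_nonneg[OF H01_L2(2)] by metis

lemma H01_lincomb: "u \<in> H01 \<Omega> \<Longrightarrow> v \<in> H01 \<Omega> \<Longrightarrow> (\<lambda>x. r * u x + s * v x) \<in> H01 \<Omega>"
  using H01I[OF H01_grad_lincomb[OF wgrad wgrad]] by blast

lemma H01_grad_zero: "H01_grad \<Omega> (\<lambda>_. 0) (\<lambda>_. 0)"
proof -
  have "Ck_on k UNIV (\<lambda>_::'a. 0)" for k
    by (induction k) (auto simp: frechet_derivative_const)
  then have t: "test_fun \<Omega> (\<lambda>_. 0)" by (simp add: test_fun_def smooth_fun_def)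
  have "cgrad (\<lambda>_::'a. 0) = (\<lambda>_. 0)" by (simp add: cgrad_def[abs_def] frechet_derivative_const)
  then show ?thesis
    unfolding H01_grad_iff by (intro conjI L2.zero_mem exI[of _ "\<lambda>_ _. 0"]) (simp_all add: t)
qed

sublocale L: semi_inner "H01 \<Omega>" "L2inner \<Omega>"
proof
  show "(\<lambda>_. 0) \<in> H01 \<Omega>" by (rule H01I[OF H01_grad_zero])
next
  fix f g assume "f \<in> H01 \<Omega>" "g \<in> H01 \<Omega>"
  then show "(\<lambda>x. f x + g x) \<in> H01 \<Omega>" using H01_lincomb[of f g 1 1] by simp
next
  fix f r assume "f \<in> H01 \<Omega>"
  then show "(\<lambda>x. r *\<^sub>R f x) \<in> H01 \<Omega>" using H01_lincomb[of f f r 0] by simp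
next
  fix f g h assume "f \<in> H01 \<Omega>" "g \<in> H01 \<Omega>" "h \<in> H01 \<Omega>"
  then show "L2inner \<Omega> (\<lambda>x. f x + g x) h = L2inner \<Omega> f h + L2inner \<Omega> g h"
    unfolding L2inner_eq by (intro L2.ip_add H01_L2)
next
  fix f h r assume "f \<in> H01 \<Omega>" "h \<in> H01 \<Omega>"
  then show "L2inner \<Omega> (\<lambda>x. r *\<^sub>R f x) h = r * L2inner \<Omega> f h"
    unfolding L2inner_eq by (intro L2.ip_scale H01_L2)
next
  fix f assume "f \<in> H01 \<Omega>"
  then show "L2inner \<Omega> f f \<ge> 0" unfolding L2inner_eq by (intro L2.ip_nonneg H01_L2)
qed (simp add: L2inner_eq mult.commute)

text \<open>The inequality for test functions passes to the limit along an approximating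
  sequence.\<close>

lemma H01_Poincare: "\<exists>C. C \<ge> 0 \<and> (\<forall>u\<in>H01 \<Omega>. L2inner \<Omega> u u \<le> C * grad_sq \<Omega> u)"
proof -
  obtain R where R: "\<And>x. x \<in> \<Omega> \<Longrightarrow> norm x \<le> R" using bd unfolding bounded_iff by blast
  have "L2inner \<Omega> u u \<le> 4 * R\<^sup>2 * grad_sq \<Omega> u" if "u \<in> H01 \<Omega>" for u
  proof -
    note w = wgrad[OF that] and L2 = H01_L2[OF that]
    obtain \<phi> where \<phi>: "\<And>k. test_fun \<Omega> (\<phi> k)"
      "(\<lambda>k. ip (\<lambda>x. \<phi> k x - u x) (\<lambda>x. \<phi> k x - u x)) \<longlonglongrightarrow> 0"
      "(\<lambda>k. ip (\<lambda>x. cgrad (\<phi> k) x - wgrad \<Omega> u x) (\<lambda>x. cgrad (\<phi> k) x - wgrad \<Omega> u x)) \<longlonglongrightarrow> 0"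
      using w unfolding H01_grad_iff by blast
    have lim1: "(\<lambda>k. ip (\<phi> k) (\<phi> k)) \<longlonglongrightarrow> ip u u"
      by (rule L2.ip_tendsto[OF _ _ L2(1,1) \<phi>(2,2)]) (simp_all add: test_fun_L2[OF meas_dom \<phi>(1)])
    have lim2: "(\<lambda>k. ip (cgrad (\<phi> k)) (cgrad (\<phi> k))) \<longlonglongrightarrow> ip (wgrad \<Omega> u) (wgrad \<Omega> u)"
      by (rule L2.ip_tendsto[OF _ _ L2(2,2) \<phi>(3,3)]) (simp_all add: test_fun_L2[OF meas_dom \<phi>(1)])
    have "ip (\<phi> k) (\<phi> k) \<le> 4 * R\<^sup>2 * ip (cgrad (\<phi> k)) (cgrad (\<phi> k))" for k
      using Poincare_test_fun[OF meas_dom R \<phi>(1), of k] by (simp add: power2_norm_eq_inner power2_eq_square[of "\<phi> k _"])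
    then have "ip u u \<le> 4 * R\<^sup>2 * ip (wgrad \<Omega> u) (wgrad \<Omega> u)"
      by (intro LIMSEQ_le[OF lim1 tendsto_mult_left[OF lim2]]) blast
    then show ?thesis by (simp add: L2inner_eq grad_sq_eq[OF w])
  qed
  then show ?thesis by (intro exI[of _ "4 * R\<^sup>2"]) auto
qed

text \<open>Riesz-Fischer provides L2 limits w of the functions and h of the gradients. That h is a
  gradient of w is witnessed by a diagonal sequence: a test function within 1 / (n + 1) of u n in
  both squared norms.\<close>

lemma H01_complete:
  assumes u: "\<And>n. u n \<in> H01 \<Omega>"
    and cauchyL: "\<And>\<epsilon>. \<epsilon> > 0 \<Longrightarrow> \<exists>n0. \<forall>m\<ge>n0. \<forall>n\<ge>n0. L2inner \<Omega> (\<lambda>x. u m x - u n x) (\<lambda>x. u m x - u n x) < \<epsilon>"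
    and cauchyG: "\<And>\<epsilon>. \<epsilon> > 0 \<Longrightarrow> \<exists>n0. \<forall>m\<ge>n0. \<forall>n\<ge>n0. grad_sq \<Omega> (\<lambda>x. u m x - u n x) < \<epsilon>"
  shows "\<exists>w\<in>H01 \<Omega>. (\<lambda>n. grad_sq \<Omega> (\<lambda>x. u n x - w x)) \<longlonglongrightarrow> 0"
proof -
  let ?g = "\<lambda>n. wgrad \<Omega> (u n)"
  have gd: "grad_sq \<Omega> (\<lambda>x. u m x - v x) = ip (\<lambda>x. ?g m x - h x) (\<lambda>x. ?g m x - h x)" if "H01_grad \<Omega> v h" for m v h
    using grad_sq_eq[OF H01_grad_lincomb[OF wgrad[OF u[of m]] that, of 1 "-1"]] by simp
  obtain w where w: "w \<in> L2fun M" "(\<lambda>n. ip (\<lambda>x. u n x - w x) (\<lambda>x. u n x - w x)) \<longlonglongrightarrow> 0"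
    using Riesz_Fischer[OF finite_measure_M, of u] H01_L2(1)[OF u] cauchyL
    by (auto simp: L2inner_eq power2_eq_square)
  obtain h where h: "h \<in> L2fun M" "(\<lambda>n. ip (\<lambda>x. ?g n x - h x) (\<lambda>x. ?g n x - h x)) \<longlonglongrightarrow> 0"
    using Riesz_Fischer[OF finite_measure_M, of ?g] H01_L2(2)[OF u] cauchyG
    by (auto simp: gd[OF wgrad[OF u]] power2_norm_eq_inner)
  define near where "near n \<phi> \<longleftrightarrow> test_fun \<Omega> \<phi> \<and> ip (\<lambda>x. \<phi> x - u n x) (\<lambda>x. \<phi> x - u n x) < 1 / real (Suc n)
      \<and> ip (\<lambda>x. cgrad \<phi> x - ?g n x) (\<lambda>x. cgrad \<phi> x - ?g n x) < 1 / real (Suc n)" for n \<phi>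
  have "\<exists>\<phi>. near n \<phi>" for n
  proof -
    obtain \<phi> where \<phi>: "\<And>k. test_fun \<Omega> (\<phi> k)"
      "(\<lambda>k. ip (\<lambda>x. \<phi> k x - u n x) (\<lambda>x. \<phi> k x - u n x)) \<longlonglongrightarrow> 0"
      "(\<lambda>k. ip (\<lambda>x. cgrad (\<phi> k) x - ?g n x) (\<lambda>x. cgrad (\<phi> k) x - ?g n x)) \<longlonglongrightarrow> 0"
      using wgrad[OF u[of n]] unfolding H01_grad_iff by blast
    have "\<forall>\<^sub>F k in sequentially. ip (\<lambda>x. \<phi> k x - u n x) (\<lambda>x. \<phi> k x - u n x) < 1 / real (Suc n)
        \<and> ip (\<lambda>x. cgrad (\<phi> k) x - ?g n x) (\<lambda>x. cgrad (\<phi> k) x - ?g n x) < 1 / real (Suc n)"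
      by (intro eventually_conj order_tendstoD(2)[OF \<phi>(2)] order_tendstoD(2)[OF \<phi>(3)]) auto
    then show ?thesis using \<phi>(1) by (auto simp: near_def dest!: eventually_happens)
  qed
  then obtain \<phi> where "\<And>n. near n (\<phi> n)" by metis
  then have \<phi>: "\<And>n. test_fun \<Omega> (\<phi> n)"
    "\<And>n. ip (\<lambda>x. \<phi> n x - u n x) (\<lambda>x. \<phi> n x - u n x) < 1 / real (Suc n)"
    "\<And>n. ip (\<lambda>x. cgrad (\<phi> n) x - ?g n x) (\<lambda>x. cgrad (\<phi> n) x - ?g n x) < 1 / real (Suc n)"
    unfolding near_def by blast+
  note L2\<phi> = test_fun_L2[OF meas_dom \<phi>(1)]
  have inv: "(\<lambda>n. 2 * (1 / real (Suc n))) \<longlonglongrightarrow> 0"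
    by (rule tendsto_mult_right_zero[OF LIMSEQ_Suc[OF lim_1_over_n]])
  have "(\<lambda>n. ip (\<lambda>x. \<phi> n x - w x) (\<lambda>x. \<phi> n x - w x)) \<longlonglongrightarrow> 0"
  proof (rule Lim_null_comparison)
    show "(\<lambda>n. 2 * (1 / real (Suc n)) + 2 * ip (\<lambda>x. u n x - w x) (\<lambda>x. u n x - w x)) \<longlonglongrightarrow> 0"
      by (rule tendsto_add_zero[OF inv tendsto_mult_right_zero[OF w(2)]])
    show "\<forall>\<^sub>F n in sequentially. norm (ip (\<lambda>x. \<phi> n x - w x) (\<lambda>x. \<phi> n x - w x))
        \<le> 2 * (1 / real (Suc n)) + 2 * ip (\<lambda>x. u n x - w x) (\<lambda>x. u n x - w x)"
    proof (rule always_eventually, rule allI)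
      fix n
      show "norm (ip (\<lambda>x. \<phi> n x - w x) (\<lambda>x. \<phi> n x - w x))
        \<le> 2 * (1 / real (Suc n)) + 2 * ip (\<lambda>x. u n x - w x) (\<lambda>x. u n x - w x)"
        using L2.square_diff_le[OF L2\<phi>(1) H01_L2(1)[OF u] w(1), of n n] \<phi>(2)[of n]
          L2.ip_nonneg[OF L2.diff_mem[OF L2\<phi>(1) w(1)], of n] unfolding real_norm_def by linarith
    qed
  qed
  moreover have "(\<lambda>n. ip (\<lambda>x. cgrad (\<phi> n) x - h x) (\<lambda>x. cgrad (\<phi> n) x - h x)) \<longlonglongrightarrow> 0"
  proof (rule Lim_null_comparison)
    show "(\<lambda>n. 2 * (1 / real (Suc n)) + 2 * ip (\<lambda>x. ?g n x - h x) (\<lambda>x. ?g n x - h x)) \<longlonglongrightarrow> 0"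
      by (rule tendsto_add_zero[OF inv tendsto_mult_right_zero[OF h(2)]])
    show "\<forall>\<^sub>F n in sequentially. norm (ip (\<lambda>x. cgrad (\<phi> n) x - h x) (\<lambda>x. cgrad (\<phi> n) x - h x))
        \<le> 2 * (1 / real (Suc n)) + 2 * ip (\<lambda>x. ?g n x - h x) (\<lambda>x. ?g n x - h x)"
    proof (rule always_eventually, rule allI)
      fix n
      show "norm (ip (\<lambda>x. cgrad (\<phi> n) x - h x) (\<lambda>x. cgrad (\<phi> n) x - h x))
        \<le> 2 * (1 / real (Suc n)) + 2 * ip (\<lambda>x. ?g n x - h x) (\<lambda>x. ?g n x - h x)"
        using L2.square_diff_le[OF L2\<phi>(2) H01_L2(2)[OF u] h(1), of n n] \<phi>(3)[of n]
          L2.ip_nonneg[OF L2.diff_mem[OF L2\<phi>(2) h(1)], of n] unfolding real_norm_def by linarith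
    qed
  qed
  ultimately have wh: "H01_grad \<Omega> w h"
    unfolding H01_grad_iff using w(1) h(1) \<phi>(1) by (intro conjI exI[of _ \<phi>]) auto
  show ?thesis using H01I[OF wh] h(2) by (intro bexI[of _ w]) (simp_all only: gd[OF wh])
qed

end

subsection \<open>The energy form\<close>

locale schroedinger =
  fixes \<Omega> :: "'a::euclidean_space set" and V :: "'a \<Rightarrow> real"
  assumes std: "standing_assms \<Omega> V"

sublocale schroedinger \<subseteq> bounded_domain \<Omega>
  using std by unfold_locales (auto simp: standing_assms_def)

context schroedinger
begin

lemma potential_integrable:
  assumes "u \<in> H01 \<Omega>" "v \<in> H01 \<Omega>"
  shows "integrable M (\<lambda>x. V x * u x * v x)"
  using std assms by (simp add: standing_assms_def flip: set_integrable_eq)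

lemma aform_eq:
  assumes "H01_grad \<Omega> u g" "H01_grad \<Omega> v h"
  shows "aform \<Omega> V u v = ip g h + integral\<^sup>L M (\<lambda>x. V x * u x * v x)"
proof -
  note mem = H01I[OF assms(1)] H01I[OF assms(2)]
  have "aform \<Omega> V u v = ip (wgrad \<Omega> u) (wgrad \<Omega> v) + integral\<^sup>L M (\<lambda>x. V x * u x * v x)"
    unfolding aform_def set_integral_eq
    by (rule Bochner_Integration.integral_add[OF L2fun_integrable_inner[OF H01_L2(2)[OF mem(1)] H01_L2(2)[OF mem(2)]]
          potential_integrable[OF mem]])
  then show ?thesis using grad_ip_eq[OF assms] by simp
qed

lemma coercive:
  obtains c1 c2 where "c1 > 0" "c2 > 0"
    "\<And>u. u \<in> H01 \<Omega> \<Longrightarrow> c1 * grad_sq \<Omega> u \<le> aform \<Omega> V u u"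
    "\<And>u. u \<in> H01 \<Omega> \<Longrightarrow> aform \<Omega> V u u \<le> c2 * grad_sq \<Omega> u"
  using std unfolding standing_assms_def by blast

text \<open>By \<open>aform_eq\<close> the chosen gradient of a combination may be replaced by the
  combination of the chosen gradients; this makes the form linear although \<open>wgrad\<close>
  itself is not known to be.\<close>

sublocale a: semi_inner "H01 \<Omega>" "aform \<Omega> V"
proof
  fix f g assume "f \<in> H01 \<Omega>" "g \<in> H01 \<Omega>"
  show "aform \<Omega> V f g = aform \<Omega> V g f" by (simp add: aform_def inner_commute ac_simps)
next
  fix f g h assume m: "f \<in> H01 \<Omega>" "g \<in> H01 \<Omega>" "h \<in> H01 \<Omega>"
  note w = wgrad[OF m(1)] wgrad[OF m(2)] wgrad[OF m(3)]
  have "aform \<Omega> V (\<lambda>x. f x + g x) h = ip (\<lambda>x. wgrad \<Omega> f x + wgrad \<Omega> g x) (wgrad \<Omega> h)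
      + integral\<^sup>L M (\<lambda>x. V x * f x * h x + V x * g x * h x)"
    using aform_eq[OF H01_grad_lincomb[OF w(1,2), of 1 1] w(3)] by (simp add: algebra_simps)
  also have "\<dots> = aform \<Omega> V f h + aform \<Omega> V g h"
    using L2.ip_add[OF H01_L2(2)[OF m(1)] H01_L2(2)[OF m(2)] H01_L2(2)[OF m(3)]]
      potential_integrable[OF m(1,3)] potential_integrable[OF m(2,3)]
    by (simp add: aform_eq[OF w(1,3)] aform_eq[OF w(2,3)])
  finally show "aform \<Omega> V (\<lambda>x. f x + g x) h = aform \<Omega> V f h + aform \<Omega> V g h" .
next
  fix f h r assume m: "f \<in> H01 \<Omega>" "h \<in> H01 \<Omega>"
  note w = wgrad[OF m(1)] wgrad[OF m(2)]
  have "aform \<Omega> V (\<lambda>x. r *\<^sub>R f x) h = ip (\<lambda>x. r *\<^sub>R wgrad \<Omega> f x) (wgrad \<Omega> h)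
      + integral\<^sup>L M (\<lambda>x. r * (V x * f x * h x))"
    using aform_eq[OF H01_grad_lincomb[OF w(1,1), of r 0] w(2)] by (simp add: ac_simps)
  also have "\<dots> = r * aform \<Omega> V f h"
    using L2.ip_scale[OF H01_L2(2)[OF m(1)] H01_L2(2)[OF m(2)], of r]
    by (simp add: aform_eq[OF w] distrib_left)
  finally show "aform \<Omega> V (\<lambda>x. r *\<^sub>R f x) h = r * aform \<Omega> V f h" .
next
  fix f assume f: "f \<in> H01 \<Omega>"
  obtain c1 c2 where "c1 > 0" "c1 * grad_sq \<Omega> f \<le> aform \<Omega> V f f" using coercive f by metis
  then show "aform \<Omega> V f f \<ge> 0" using grad_sq_nonneg[OF f] by (meson mult_nonneg_nonneg less_imp_le order_trans)
qed (use L.zero_mem L.add_mem L.scale_mem in auto)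

text \<open>Coercivity and the Poincare inequality give K = C / c1 and turn an energy Cauchy
  sequence into one for functions and gradients. The upper bound c2 turns gradient convergence back
  into energy convergence.\<close>

lemma spectral:
  assumes "\<And>k. is_eigen \<Omega> V (lam k) (e k)"
    and "\<And>j k. L2inner \<Omega> (e j) (e k) = (if j = k then 1 else 0)"
    and "\<And>u. u \<in> H01 \<Omega> \<Longrightarrow> (\<And>k. L2inner \<Omega> u (e k) = 0) \<Longrightarrow> L2inner \<Omega> u u = 0"
  shows "\<exists>K. spectral_pair (H01 \<Omega>) (L2inner \<Omega>) (aform \<Omega> V) K e lam"
proof -
  obtain c1 c2 where c: "c1 > 0" "c2 > 0"
    "\<And>u. u \<in> H01 \<Omega> \<Longrightarrow> c1 * grad_sq \<Omega> u \<le> aform \<Omega> V u u"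
    "\<And>u. u \<in> H01 \<Omega> \<Longrightarrow> aform \<Omega> V u u \<le> c2 * grad_sq \<Omega> u" using coercive by metis
  obtain C where C: "C \<ge> 0" "\<And>u. u \<in> H01 \<Omega> \<Longrightarrow> L2inner \<Omega> u u \<le> C * grad_sq \<Omega> u" using H01_Poincare by blast
  have g_le: "grad_sq \<Omega> u \<le> 1 / c1 * aform \<Omega> V u u" if "u \<in> H01 \<Omega>" for u
    using c(1) c(3)[OF that] by (simp add: field_simps)
  have L_le: "L2inner \<Omega> u u \<le> C / c1 * aform \<Omega> V u u" if "u \<in> H01 \<Omega>" for u
    using order_trans[OF C(2)[OF that] mult_left_mono[OF g_le[OF that] C(1)]] by simp
  have "spectral_pair (H01 \<Omega>) (L2inner \<Omega>) (aform \<Omega> V) (C / c1) e lam"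
  proof
    fix u assume u: "u \<in> H01 \<Omega>" "L2inner \<Omega> u u = 0"
    have "grad_sq \<Omega> u = 0"
      using H01_grad_null[OF wgrad[OF u(1)]] u by (simp only: L2inner_eq grad_sq_eq[OF wgrad[OF u(1)]])
    then show "aform \<Omega> V u u = 0" using c(4)[OF u(1)] a.ip_nonneg[OF u(1)] by simp
  next
    fix u :: "nat \<Rightarrow> 'a \<Rightarrow> real"
    assume u: "\<And>n. u n \<in> H01 \<Omega>"
      and cauchy: "\<And>\<epsilon>. \<epsilon> > 0 \<Longrightarrow> \<exists>n0. \<forall>m\<ge>n0. \<forall>n\<ge>n0. aform \<Omega> V (\<lambda>x. u m x - u n x) (\<lambda>x. u m x - u n x) < \<epsilon>"
    have d: "(\<lambda>x. u m x - u n x) \<in> H01 \<Omega>" for m n by (rule L.diff_mem[OF u u])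
    \<comment> \<open>Stated for a general f to serve the L2 part and the gradient part alike.
      Dividing by D + 1 avoids a case distinction for D = 0.\<close>
    have small: "\<exists>n0. \<forall>m\<ge>n0. \<forall>n\<ge>n0. f (\<lambda>x. u m x - u n x) < \<epsilon>"
      if "\<epsilon> > 0" and f: "\<And>w. w \<in> H01 \<Omega> \<Longrightarrow> f w \<le> D * aform \<Omega> V w w" and "D \<ge> 0"
      for \<epsilon> D :: real and f :: "('a \<Rightarrow> real) \<Rightarrow> real"
    proof -
      obtain n0 where n0: "\<And>m n. m \<ge> n0 \<Longrightarrow> n \<ge> n0 \<Longrightarrow>
          aform \<Omega> V (\<lambda>x. u m x - u n x) (\<lambda>x. u m x - u n x) < \<epsilon> / (D + 1)"
        using cauchy[of "\<epsilon> / (D + 1)"] \<open>\<epsilon> > 0\<close> \<open>D \<ge> 0\<close> by (auto simp: add_nonneg_pos)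
      have "f (\<lambda>x. u m x - u n x) < \<epsilon>" if mn: "m \<ge> n0" "n \<ge> n0" for m n
      proof -
        let ?A = "aform \<Omega> V (\<lambda>x. u m x - u n x) (\<lambda>x. u m x - u n x)"
        have "f (\<lambda>x. u m x - u n x) \<le> D * ?A" by (rule f[OF d])
        also have "\<dots> \<le> (D + 1) * ?A" using a.ip_nonneg[OF d, of m n] by (simp add: distrib_right)
        also have "\<dots> < \<epsilon>" using n0[OF mn] \<open>D \<ge> 0\<close> by (simp add: field_simps)
        finally show ?thesis .
      qed
      then show ?thesis by blast
    qed
    obtain w where w: "w \<in> H01 \<Omega>" "(\<lambda>n. grad_sq \<Omega> (\<lambda>x. u n x - w x)) \<longlonglongrightarrow> 0"
      using H01_complete[of u, OF u] small[of _ "\<lambda>w. L2inner \<Omega> w w", OF _ L_le] small[of _ "grad_sq \<Omega>", OF _ g_le] C(1) c(1)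
      by (auto simp: less_imp_le)
    have "(\<lambda>n. aform \<Omega> V (\<lambda>x. u n x - w x) (\<lambda>x. u n x - w x)) \<longlonglongrightarrow> 0"
    proof (rule Lim_null_comparison)
      have dw: "(\<lambda>x. u n x - w x) \<in> H01 \<Omega>" for n by (rule L.diff_mem[OF u w(1)])
      show "\<forall>\<^sub>F n in sequentially. norm (aform \<Omega> V (\<lambda>x. u n x - w x) (\<lambda>x. u n x - w x))
          \<le> c2 * grad_sq \<Omega> (\<lambda>x. u n x - w x)"
        using c(4)[OF dw] a.ip_nonneg[OF dw] by simp
      show "(\<lambda>n. c2 * grad_sq \<Omega> (\<lambda>x. u n x - w x)) \<longlonglongrightarrow> 0"
        by (rule tendsto_mult_right_zero[OF w(2)])
    qed
    with w(1) show "\<exists>w\<in>H01 \<Omega>. (\<lambda>n. aform \<Omega> V (\<lambda>x. u n x - w x) (\<lambda>x. u n x - w x)) \<longlonglongrightarrow> 0" by blast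
  qed (use assms L_le in \<open>auto simp: is_eigen_def\<close>)
  then show ?thesis by blast
qed

lemma L2inner_le_H1norm: "u \<in> H01 \<Omega> \<Longrightarrow> L2inner \<Omega> u u \<le> (H1norm \<Omega> u)\<^sup>2"
  using L.ip_nonneg[of u] grad_sq_nonneg[of u] by (simp add: H1norm_def)

end

subsection \<open>Convergence of the flow\<close>

text \<open>The substitution s = Q^T y preserves the Euclidean norm and turns the s-combination of
  UQ into the y-combination of U, so a lower bound for the Gram matrix of UQ is one for that of
  U.\<close>

lemma psd_quasi_stiefel:
  assumes H: "semi_inner H (L2inner \<Omega>)" and U: "\<And>j. j < N \<Longrightarrow> U j \<in> H"
    and Q: "orthogonal_mat N Q" "tmul N U Q \<in> quasi_stiefel \<Omega> N"
  shows "(\<Sum>j<N. (y j)\<^sup>2) \<le> (\<Sum>i<N. \<Sum>j<N. y i * L2inner \<Omega> (U i) (U j) * y j)"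
proof -
  interpret L: semi_inner H "L2inner \<Omega>" by (rule H)
  note lincomb = L.lincomb_mem[unfolded real_scaleR_def] L.ip_lincomb[unfolded real_scaleR_def]
    L.ip_lincomb_right[unfolded real_scaleR_def]
  have cols: "(\<Sum>k<N. Q k i * Q k j) = delta i j" if "i < N" "j < N" for i j
    using Q(1) that by (simp add: orthogonal_mat_def)
  have rows: "(\<Sum>k<N. Q i k * Q j k) = delta i j" if "i < N" "j < N" for i j
    using orthonormal_rows_imp_columns[of N "\<lambda>i j. Q j i"] cols that by simp
  define s where "s k = (\<Sum>i<N. y i * Q i k)" for k
  have s_y: "(\<Sum>k<N. s k * Q j k) = y j" if "j < N" for j
  proof -
    have "(\<Sum>k<N. s k * Q j k) = (\<Sum>i<N. y i * (\<Sum>k<N. Q i k * Q j k))"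
      unfolding s_def sum_distrib_left sum_distrib_right by (subst sum.swap) (simp add: mult.assoc)
    also have "\<dots> = (\<Sum>i<N. y i * delta i j)" by (rule sum.cong[OF refl]) (simp only: rows that lessThan_iff)
    also have "\<dots> = y j" by (rule sum_delta_mult(4)[OF that])
    finally show ?thesis .
  qed
  have norm: "(\<Sum>k<N. (s k)\<^sup>2) = (\<Sum>j<N. (y j)\<^sup>2)"
  proof -
    have "(\<Sum>k<N. (s k)\<^sup>2) = (\<Sum>k<N. \<Sum>j<N. y j * (s k * Q j k))"
      unfolding power2_eq_square by (subst (2) s_def) (simp add: sum_distrib_left ac_simps)
    also have "\<dots> = (\<Sum>j<N. y j * (\<Sum>k<N. s k * Q j k))"
      unfolding sum_distrib_left by (rule sum.swap)
    also have "\<dots> = (\<Sum>j<N. (y j)\<^sup>2)" using s_y by (simp add: power2_eq_square)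
    finally show ?thesis .
  qed
  have quad: "(\<Sum>i<N. \<Sum>j<N. r i * L2inner \<Omega> (W i) (W j) * r j)
      = L2inner \<Omega> (\<lambda>x. \<Sum>j<N. r j * W j x) (\<lambda>x. \<Sum>j<N. r j * W j x)"
    if W: "\<And>j. j < N \<Longrightarrow> W j \<in> H" for W r
  proof -
    have "L2inner \<Omega> (\<lambda>x. \<Sum>j<N. r j * W j x) (\<lambda>x. \<Sum>j<N. r j * W j x)
        = (\<Sum>i<N. r i * L2inner \<Omega> (W i) (\<lambda>x. \<Sum>j<N. r j * W j x))"
      using W by (intro lincomb(1,2)) auto
    also have "\<dots> = (\<Sum>i<N. r i * (\<Sum>j<N. r j * L2inner \<Omega> (W i) (W j)))"
      using W by (intro sum.cong refl arg_cong2[of _ _ _ _ "(*)"] lincomb(3)) auto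
    finally show ?thesis by (simp add: sum_distrib_left ac_simps)
  qed
  have mem: "tmul N U Q j \<in> H" for j unfolding tmul_def using U by (intro lincomb) auto
  have "(\<lambda>x. \<Sum>j<N. s j * tmul N U Q j x) = (\<lambda>x. \<Sum>i<N. y i * U i x)"
  proof
    fix x
    have "(\<Sum>j<N. s j * tmul N U Q j x) = (\<Sum>i<N. (\<Sum>j<N. s j * Q i j) * U i x)"
      unfolding tmul_def sum_distrib_left sum_distrib_right by (subst sum.swap) (simp add: mult.assoc)
    then show "(\<Sum>j<N. s j * tmul N U Q j x) = (\<Sum>i<N. y i * U i x)" using s_y by simp
  qed
  then have "(\<Sum>i<N. \<Sum>j<N. s i * L2inner \<Omega> (tmul N U Q i) (tmul N U Q j) * s j)
      = (\<Sum>i<N. \<Sum>j<N. y i * L2inner \<Omega> (U i) (U j) * y j)"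
    using quad[of "tmul N U Q" s] quad[of U y] U mem by simp
  moreover have "(\<Sum>i<N. \<Sum>j<N. s i * (gram \<Omega> (tmul N U Q) (tmul N U Q) i j - delta i j) * s j) \<ge> 0"
    using Q(2) by (simp add: quasi_stiefel_def psd_mat_def)
  moreover have "(\<Sum>i<N. \<Sum>j<N. s i * (gram \<Omega> (tmul N U Q) (tmul N U Q) i j - delta i j) * s j)
      = (\<Sum>i<N. \<Sum>j<N. s i * L2inner \<Omega> (tmul N U Q i) (tmul N U Q j) * s j) - (\<Sum>k<N. (s k)\<^sup>2)"
  proof -
    have "(\<Sum>j<N. s i * delta i j * s j) = (s i)\<^sup>2" if "i < N" for i
      using sum_delta_mult(1)[OF that, of s] by (simp add: power2_eq_square mult.assoc flip: sum_distrib_left)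
    then show ?thesis
      by (simp add: gram_def right_diff_distrib left_diff_distrib sum_subtractf)
  qed
  ultimately show ?thesis using norm by simp
qed

theorem theorem3p9:
  fixes \<Omega> :: "'a::euclidean_space set"
    and V :: "'a \<Rightarrow> real"
    and N :: nat
    and lam :: "nat \<Rightarrow> real"
    and Vs :: "'a tuple"
    and U :: "real \<Rightarrow> 'a tuple"
  assumes std: "standing_assms \<Omega> V"
    and N1: "N \<ge> 1"
    and eig: "eigenvalue_seq \<Omega> V lam"
    and gap: "lam (N - 1) < lam N"
    and Vs_eig: "\<forall>i<N. is_eigen \<Omega> V (lam i) (Vs i)"
    and Vs_on: "\<forall>i<N. \<forall>j<N. L2inner \<Omega> (Vs i) (Vs j) = (if i = j then 1 else 0)"
    and sol: "flow_solution \<Omega> V N U"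
    and U0_S: "in_H01N \<Omega> N (U 0) \<and>
      (\<exists>Q. orthogonal_mat N Q \<and> tmul N (U 0) Q \<in> quasi_stiefel \<Omega> N) \<and>
      energy \<Omega> V N (U 0) \<le>
        (energy \<Omega> V N Vs + ((\<Sum>i<N - 1. lam i) + lam N) / 2) / 2"
  shows "(\<exists>Qs. orthogonal_mat N Qs \<and>
            ((\<lambda>t. anorm \<Omega> V N (tsub (U t) (tmul N Vs Qs))) \<longlongrightarrow> 0) at_top) \<and>
         ((\<lambda>t. energy \<Omega> V N (U t)) \<longlongrightarrow> energy \<Omega> V N Vs) at_top \<and>
         ((\<lambda>t. anorm \<Omega> V N (gradGE \<Omega> V N (U t))) \<longlongrightarrow> 0) at_top"
proof -

  \<comment> \<open>An eigenbasis that begins with V_*\<close>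
  interpret schroedinger \<Omega> V by unfold_locales (rule std)
  have lam_mono: "mono lam" using eig by (simp add: eigenvalue_seq_def)
  obtain e0 where e0: "\<And>k. is_eigen \<Omega> V (lam k) (e0 k)"
    "\<And>j k. L2inner \<Omega> (e0 j) (e0 k) = (if j = k then 1 else 0)"
    "\<And>u. u \<in> H01 \<Omega> \<Longrightarrow> (\<And>k. L2inner \<Omega> u (e0 k) = 0) \<Longrightarrow> L2inner \<Omega> u u = 0"
    using eig unfolding eigenvalue_seq_def by blast
  obtain K where "spectral_pair (H01 \<Omega>) (L2inner \<Omega>) (aform \<Omega> V) K e0 lam"
    using spectral[OF e0] by blast
  then interpret S0: spectral_pair "H01 \<Omega>" "L2inner \<Omega>" "aform \<Omega> V" K e0 lam .
  \<comment> \<open>With the prescribed eigenfunctions in front, the limit of the low coefficient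
    block directly relates the limit of U to V_*.\<close>
  define e where "e = (\<lambda>k. if k < N then Vs k else e0 k)"
  have "spectral_pair (H01 \<Omega>) (L2inner \<Omega>) (aform \<Omega> V) K e lam"
    unfolding e_def
  proof (rule S0.replace_low_eigenfunctions)
    show "lam i < lam k" if "i < N" "N \<le> k" for i k
      using gap monoD[OF lam_mono, of i "N - 1"] monoD[OF lam_mono, of N k] that by linarith
  qed (use Vs_eig Vs_on in \<open>auto simp: is_eigen_def\<close>)
  then interpret S: spectral_pair "H01 \<Omega>" "L2inner \<Omega>" "aform \<Omega> V" K e lam .

  \<comment> \<open>The inverse operator and the flow in coefficients\<close>
  have G: "Gop \<Omega> V f \<in> H01 \<Omega> \<and> (\<forall>v\<in>H01 \<Omega>. aform \<Omega> V (Gop \<Omega> V f) v = L2inner \<Omega> f v)"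
    if "f \<in> H01 \<Omega>" for f
    unfolding Gop_def
    by (rule someI_ex[of "\<lambda>g. g \<in> H01 \<Omega> \<and> (\<forall>v\<in>H01 \<Omega>. aform \<Omega> V g v = L2inner \<Omega> f v)"])
      (use S.Riesz[OF that] in blast)
  have G_mem: "Gop \<Omega> V f \<in> H01 \<Omega>" if "f \<in> H01 \<Omega>" for f using G[OF that] by simp
  \<comment> \<open>Testing with the eigenfunction \<open>e k\<close> shows that G divides
    coefficients by \<open>lam k\<close>.\<close>
  have G_coeff: "L2inner \<Omega> (Gop \<Omega> V f) (e k) = L2inner \<Omega> f (e k) / lam k" if "f \<in> H01 \<Omega>" for f k
    using G[OF that] S.a_eig_right[OF G_mem[OF that], of k] S.e_mem[of k] S.lam_pos[of k] by (simp add: field_simps)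

  have U_mem: "U t j \<in> H01 \<Omega>" if "t \<ge> 0" "j < N" for t j
    using sol that by (simp add: flow_solution_def in_H01N_def)
  define c where "c t j k = L2inner \<Omega> (U t j) (e k)" for t j k
  define P where "P t i j = L2inner \<Omega> (U t i) (U t j)" for t i j
  define B where "B t i j = L2inner \<Omega> (Gop \<Omega> V (U t i)) (U t j)" for t i j
  let ?g = "\<lambda>t. gradGE \<Omega> V N (U t)"
  have g_eq: "?g t j = (\<lambda>x. Gop \<Omega> V (U t j) x - (\<Sum>i<N. B t i j * U t i x))" for t j
    by (simp add: gradGE_def tsub_def Gtuple_def tmul_def gram_def B_def)
  have comb_mem: "(\<lambda>x. \<Sum>i<N. B t i j * U t i x) \<in> H01 \<Omega>" if "t \<ge> 0" for t j
    using U_mem[OF that] by (intro S.lincomb_mem) auto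
  have g_mem: "?g t j \<in> H01 \<Omega>" if "t \<ge> 0" "j < N" for t j
    unfolding g_eq by (intro L.diff_mem G_mem U_mem comb_mem that)
  have g_L: "L2inner \<Omega> (?g t j) v = L2inner \<Omega> (Gop \<Omega> V (U t j)) v - (\<Sum>i<N. B t i j * L2inner \<Omega> (U t i) v)"
    if "t \<ge> 0" "j < N" "v \<in> H01 \<Omega>" for t j v
    unfolding g_eq using that U_mem[OF that(1)] S.L_lincomb[of "{..<N}" "U t" v "\<lambda>i. B t i j"]
    by (simp add: L.ip_diff G_mem comb_mem)
  have B_sym: "B t i j = B t j i" if "t \<ge> 0" "i < N" "j < N" for t i j
  proof -
    note m = U_mem[OF that(1,2)] U_mem[OF that(1,3)]
    have "B t i j = L2inner \<Omega> (U t j) (Gop \<Omega> V (U t i))" unfolding B_def by (rule L.ip_sym[OF G_mem[OF m(1)] m(2)])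
    also have "\<dots> = aform \<Omega> V (Gop \<Omega> V (U t j)) (Gop \<Omega> V (U t i))" using G m by simp
    also have "\<dots> = aform \<Omega> V (Gop \<Omega> V (U t i)) (Gop \<Omega> V (U t j))" by (rule a.ip_sym[OF G_mem[OF m(2)] G_mem[OF m(1)]])
    also have "\<dots> = L2inner \<Omega> (U t i) (Gop \<Omega> V (U t j))" using G m by simp
    also have "\<dots> = B t j i" unfolding B_def by (rule L.ip_sym[OF m(1) G_mem[OF m(2)]])
    finally show ?thesis .
  qed
  \<comment> \<open>The H1 norm dominates the L2 norm, so the difference quotients also converge in
    L2, as the product rule for \<open>L2inner\<close> asks.\<close>
  have quot: "((\<lambda>s. L2inner \<Omega> (\<lambda>x. (1 / (s - t)) *\<^sub>R (U s j x - U t j x) - ?g t j x)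
        (\<lambda>x. (1 / (s - t)) *\<^sub>R (U s j x - U t j x) - ?g t j x)) \<longlongrightarrow> 0) (at t within {0..})"
    if t: "t \<ge> 0" and j: "j < N" for t j
  proof (rule Lim_null_comparison)
    let ?d = "\<lambda>s x. (1 / (s - t)) *\<^sub>R (U s j x - U t j x) - ?g t j x"
    have "((\<lambda>s. H1norm \<Omega> (?d s)) \<longlongrightarrow> 0) (at t within {0..})"
      using sol t j by (simp add: flow_solution_def)
    from tendsto_power[OF this, of 2] show "((\<lambda>s. (H1norm \<Omega> (?d s))\<^sup>2) \<longlongrightarrow> 0) (at t within {0..})" by simp
    have d_mem: "?d s \<in> H01 \<Omega>" if "s \<ge> 0" for s
      by (intro L.diff_mem L.scale_mem U_mem g_mem t j that)
    show "\<forall>\<^sub>F s in at t within {0..}. norm (L2inner \<Omega> (?d s) (?d s)) \<le> (H1norm \<Omega> (?d s))\<^sup>2"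
      unfolding eventually_at_filter
      by (rule always_eventually) (use L2inner_le_H1norm[OF d_mem] L.ip_nonneg[OF d_mem] in auto)
  qed
  have U0_mem: "U 0 j \<in> H01 \<Omega>" if "j < N" for j using U_mem that by simp

  \<comment> \<open>Invertibility of the initial block\<close>
  have "\<exists>A. \<forall>i<N. \<forall>j<N. (\<Sum>k<N. c 0 i k * A k j) = delta i j"
  proof (rule right_inverse_exists, rule ccontr)
    fix y assume y: "\<And>k. k < N \<Longrightarrow> (\<Sum>j<N. y j * c 0 j k) = 0" "\<not> (\<forall>j<N. y j = 0)"
    obtain Q where Q: "orthogonal_mat N Q" "tmul N (U 0) Q \<in> quasi_stiefel \<Omega> N" using U0_S by blast
    have "(\<Sum>i<N - 1. lam i) + lam N \<le> (\<Sum>j<N. aform \<Omega> V (U 0 j) (U 0 j))"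
    proof (rule energy_lower_bound_of_kernel[where c = "c 0" and P = "P 0" and y = y
            and R = "\<lambda>i j. aform \<Omega> V (U 0 i) (U 0 j)"])
      show "(\<Sum>j<N. (z j)\<^sup>2) \<le> (\<Sum>i<N. \<Sum>j<N. z i * P 0 i j * z j)" for z
        unfolding P_def by (rule psd_quasi_stiefel[OF L.semi_inner_axioms U0_mem Q])
      show "(\<lambda>k. c 0 i k * c 0 j k) sums P 0 i j" if "i < N" "j < N" for i j
        unfolding c_def P_def using that by (intro S.Parseval U0_mem)
      show "(\<lambda>k. lam k * (c 0 i k * c 0 j k)) sums aform \<Omega> V (U 0 i) (U 0 j)" if "i < N" "j < N" for i j
        unfolding c_def using that by (intro S.Parseval U0_mem)
    qed (use y lam_mono S.lam_pos N1 in \<open>auto simp: less_imp_le\<close>)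
    moreover have "energy \<Omega> V N Vs = (\<Sum>i<N. lam i) / 2"
      using Vs_eig Vs_on by (simp add: energy_def is_eigen_def)
    moreover have "(\<Sum>i<N. lam i) = (\<Sum>i<N - 1. lam i) + lam (N - 1)"
      using N1 sum.lessThan_Suc[of lam "N - 1"] by simp
    moreover have "energy \<Omega> V N (U 0) = (\<Sum>j<N. aform \<Omega> V (U 0 j) (U 0 j)) / 2" by (simp add: energy_def)
    ultimately show False using U0_S gap by (simp add: field_simps)
  qed
  then obtain A where A: "\<And>i j. i < N \<Longrightarrow> j < N \<Longrightarrow> (\<Sum>k<N. c 0 i k * A k j) = delta i j" by blast

  \<comment> \<open>The coefficient system of the flow\<close>
  interpret oja_coefficients N lam c P B A
  proof
    show "(\<lambda>k. c t i k * c t j k) sums P t i j" if "t \<ge> 0" "i < N" "j < N" for t i j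
      unfolding c_def P_def using that by (intro S.Parseval U_mem)
    show "(\<lambda>k. c t i k * c t j k / lam k) sums B t i j" if "t \<ge> 0" "i < N" "j < N" for t i j
      using S.Parseval(1)[OF G_mem[OF U_mem[OF that(1,2)]] U_mem[OF that(1,3)]]
      by (simp add: G_coeff U_mem that B_def c_def)
    show "summable (\<lambda>k. lam k * (c t j k)\<^sup>2)" if "t \<ge> 0" "j < N" for t j
      using sums_summable[OF S.Parseval(2)[OF U_mem[OF that] U_mem[OF that]]] by (simp add: c_def power2_eq_square)
    show "((\<lambda>t. c t j k) has_real_derivative c t j k / lam k - (\<Sum>i<N. B t i j * c t i k)) (at t within {0..})"
      if t: "t \<ge> 0" and j: "j < N" for t j k
    proof -
      \<comment> \<open>The fixed eigenfunction counts as a curve with derivative zero, so the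
        product rule applies.\<close>
      have "((\<lambda>s. L2inner \<Omega> (U s j) (e k)) has_real_derivative
          L2inner \<Omega> (?g t j) (e k) + L2inner \<Omega> (U t j) (\<lambda>_. 0)) (at t within {0..})"
        by (rule L.ip_has_derivative[of _ "\<lambda>s. U s j" "\<lambda>_. e k", OF _ _ g_mem[OF t j] L.zero_mem _ quot[OF t j]])
          (use t j U_mem S.e_mem L.ip_zero[OF L.zero_mem] in auto)
      moreover have "L2inner \<Omega> (U t j) (\<lambda>_. 0) = 0"
        using L.ip_sym[OF U_mem[OF t j] L.zero_mem] L.ip_zero[OF U_mem[OF t j]] by simp
      ultimately show ?thesis
        using g_L[OF t j S.e_mem, of k] G_coeff[OF U_mem[OF t j], of k] by (simp add: c_def)
    qed
    show "((\<lambda>t. P t i j) has_real_derivative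
          2 * B t i j - (\<Sum>l<N. B t l i * P t l j) - (\<Sum>l<N. P t i l * B t l j)) (at t within {0..})"
      if t: "t \<ge> 0" and i: "i < N" and j: "j < N" for t i j
    proof -
      have "((\<lambda>s. L2inner \<Omega> (U s i) (U s j)) has_real_derivative
          L2inner \<Omega> (?g t i) (U t j) + L2inner \<Omega> (U t i) (?g t j)) (at t within {0..})"
        by (rule L.ip_has_derivative[of _ "\<lambda>s. U s i" "\<lambda>s. U s j", OF _ _ g_mem[OF t i] g_mem[OF t j] _ quot[OF t i] quot[OF t j]])
          (use t i j U_mem in auto)
      moreover have "L2inner \<Omega> (?g t i) (U t j) = B t i j - (\<Sum>l<N. B t l i * P t l j)"
        using g_L[OF t i U_mem[OF t j]] by (simp add: B_def P_def)
      moreover have "L2inner \<Omega> (U t i) (?g t j) = B t i j - (\<Sum>l<N. P t i l * B t l j)"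
      proof -
        have "L2inner \<Omega> (U t i) (?g t j) = L2inner \<Omega> (?g t j) (U t i)"
          by (rule L.ip_sym[OF U_mem[OF t i] g_mem[OF t j]])
        also have "\<dots> = B t j i - (\<Sum>l<N. B t l j * P t l i)"
          using g_L[OF t j U_mem[OF t i]] by (simp add: B_def P_def)
        also have "(\<Sum>l<N. B t l j * P t l i) = (\<Sum>l<N. P t i l * B t l j)"
          unfolding P_def using L.ip_sym[OF U_mem[OF t i] U_mem[OF t]] by (intro sum.cong) auto
        finally show ?thesis using B_sym[OF t i j] by simp
      qed
      ultimately show ?thesis by (simp add: P_def algebra_simps)
    qed
  qed (use N1 lam_mono S.lam_pos gap A in auto)

  \<comment> \<open>From coefficients back to functions\<close>
  obtain q where q: "\<And>i j. i < N \<Longrightarrow> j < N \<Longrightarrow> (\<Sum>k<N. q i k * q j k) = delta i j"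
    "\<And>j. j < N \<Longrightarrow> ((\<lambda>t. \<Sum>k. lam k * (c t j k - (if k < N then q j k else 0))\<^sup>2) \<longlongrightarrow> 0) at_top"
    "\<And>j. j < N \<Longrightarrow> ((\<lambda>t. \<Sum>k. lam k * (c t j k)\<^sup>2) \<longlongrightarrow> (\<Sum>k<N. lam k * (q j k)\<^sup>2)) at_top"
    using coefficients_converge by blast
  have a_coeff: "aform \<Omega> V u u = (\<Sum>k. lam k * (L2inner \<Omega> u (e k))\<^sup>2)" if "u \<in> H01 \<Omega>" for u
    using sums_unique[OF S.Parseval(2)[OF that that]] by (simp add: power2_eq_square)
  have ev0: "\<forall>\<^sub>F t in at_top. t \<ge> (0::real)" by (rule eventually_ge_at_top)

  \<comment> \<open>The square matrix q has orthonormal rows and therefore orthonormal columns, so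
    each \<open>lam k\<close> enters the limit energy with weight one.\<close>
  have cols: "(\<Sum>j<N. (q j k)\<^sup>2) = 1" if "k < N" for k
    using orthonormal_rows_imp_columns[OF q(1) that that] by (simp add: power2_eq_square)
  have limit_energy: "(\<Sum>j<N. \<Sum>k<N. lam k * (q j k)\<^sup>2) / 2 = energy \<Omega> V N Vs"
  proof -
    have "(\<Sum>j<N. \<Sum>k<N. lam k * (q j k)\<^sup>2) = (\<Sum>k<N. lam k * (\<Sum>j<N. (q j k)\<^sup>2))"
      unfolding sum_distrib_left by (rule sum.swap)
    then show ?thesis using cols Vs_eig Vs_on by (simp add: energy_def is_eigen_def)
  qed
  \<comment> \<open>Transposed, because \<open>tmul\<close> sums over the first index of its matrix
    while the first index of q numbers the components. Orthonormal columns of Qs are orthonormal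
    rows of q.\<close>
  define Qs where "Qs i j = q j i" for i j
  have "((\<lambda>t. energy \<Omega> V N (U t)) \<longlongrightarrow> energy \<Omega> V N Vs) at_top"
  proof -
    have "((\<lambda>t. (\<Sum>j<N. \<Sum>k. lam k * (c t j k)\<^sup>2) / 2) \<longlongrightarrow> (\<Sum>j<N. \<Sum>k<N. lam k * (q j k)\<^sup>2) / 2) at_top"
      by (intro tendsto_intros q(3)) auto
    moreover have "\<forall>\<^sub>F t in at_top. (\<Sum>j<N. \<Sum>k. lam k * (c t j k)\<^sup>2) / 2 = energy \<Omega> V N (U t)"
      using ev0 by eventually_elim (simp add: energy_def a_coeff U_mem c_def)
    ultimately show ?thesis unfolding limit_energy by (rule Lim_transform_eventually)
  qed
  moreover have "((\<lambda>t. anorm \<Omega> V N (?g t)) \<longlongrightarrow> 0) at_top"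
  proof -
    have "((\<lambda>t. sqrt (\<Sum>j<N. \<Sum>k. lam k * (dc t j k)\<^sup>2)) \<longlongrightarrow> sqrt (\<Sum>j<N. 0)) at_top"
      by (intro tendsto_intros energy_dc_tendsto_0) auto
    moreover have "\<forall>\<^sub>F t in at_top. sqrt (\<Sum>j<N. \<Sum>k. lam k * (dc t j k)\<^sup>2) = anorm \<Omega> V N (?g t)"
      using ev0
    proof eventually_elim
      case (elim t)
      \<comment> \<open>Since \<open>dc\<close> lists the coefficients of the gradient field,
        Parseval for the energy form identifies the weighted sum with its squared norm.\<close>
      have "L2inner \<Omega> (?g t j) (e k) = dc t j k" if "j < N" for j k
        using g_L[OF elim that S.e_mem, of k] G_coeff[OF U_mem[OF elim that], of k] by (simp add: dc_def c_def)
      then show ?case by (simp add: anorm_def a_coeff g_mem elim)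
    qed
    ultimately show ?thesis using Lim_transform_eventually by fastforce
  qed
  moreover have "((\<lambda>t. anorm \<Omega> V N (tsub (U t) (tmul N Vs Qs))) \<longlongrightarrow> 0) at_top"
  proof -
    have "((\<lambda>t. sqrt (\<Sum>j<N. \<Sum>k. lam k * (c t j k - (if k < N then q j k else 0))\<^sup>2)) \<longlongrightarrow> sqrt (\<Sum>j<N. 0)) at_top"
      by (intro tendsto_intros q(2)) auto
    moreover have "\<forall>\<^sub>F t in at_top. sqrt (\<Sum>j<N. \<Sum>k. lam k * (c t j k - (if k < N then q j k else 0))\<^sup>2)
        = anorm \<Omega> V N (tsub (U t) (tmul N Vs Qs))"
      using ev0
    proof eventually_elim
      case (elim t)
      have Vq: "tmul N Vs Qs j = (\<lambda>x. \<Sum>i<N. q j i * e i x)" for j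
        by (simp add: tmul_def Qs_def e_def)
      have Vq_mem: "tmul N Vs Qs j \<in> H01 \<Omega>" for j unfolding Vq by (intro S.lincomb_mem S.e_mem)
      have Vq_coeff: "L2inner \<Omega> (tmul N Vs Qs j) (e k) = (if k < N then q j k else 0)" for j k
      proof -
        have "L2inner \<Omega> (tmul N Vs Qs j) (e k) = (\<Sum>i<N. q j i * L2inner \<Omega> (e i) (e k))"
          unfolding Vq by (intro S.L_lincomb S.e_mem)
        then show ?thesis by (simp add: S.e_on if_distrib cong: if_cong)
      qed
      have eq: "tsub (U t) (tmul N Vs Qs) j = (\<lambda>x. U t j x - tmul N Vs Qs j x)" for j by (simp add: tsub_def)
      have "aform \<Omega> V (tsub (U t) (tmul N Vs Qs) j) (tsub (U t) (tmul N Vs Qs) j)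
          = (\<Sum>k. lam k * (c t j k - (if k < N then q j k else 0))\<^sup>2)" if "j < N" for j
        unfolding eq using a_coeff[OF L.diff_mem[OF U_mem[OF elim that] Vq_mem]]
        by (simp add: L.ip_diff U_mem elim that Vq_mem S.e_mem Vq_coeff c_def)
      then show ?case by (simp add: anorm_def)
    qed
    ultimately show ?thesis using Lim_transform_eventually by fastforce
  qed
  moreover have "orthogonal_mat N Qs" using q(1) by (simp add: orthogonal_mat_def Qs_def)
  ultimately show ?thesis by blast
qed

end
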